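(* The BSTSO problem is NP-hard.
   Context: BSTSO: Fix an associative, commutative binary operator $\circ\colon\{0,1\}^2\to\{0,1\}$. An instance is a finite family $\mathcal{T}$ of subsets of $\{1,\dots,n\}$ (trees). A circuit is a directed acyclic graph whose vertices are inputs (in-degree $0$, each associated with one variable $x_i$) and gates (in-degree exactly $2$). Every vertex $v$ carries a variable set $S(v)$: $S(v)=\{i\}$ for the input of $x_i$, and for a gate $v$ with predecessors $u,w$ one requires $S(u)\cap S(w)=\emptyset$ and $S(v)=S(u)\cup S(w)$; $v$ computes $\bigcirc_{i\in S(v)}x_i$. A circuit is a solution for $\mathcal{T}$ if for every $T\in\mathcal{T}$ some vertex $v$ has $S(v)=T$. The goal is to find a solution with the minimum number of gates. *)

theory Defs
  imports "HOL-Computational_Algebra.Polynomial"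
begin

section \<open>Polynomial time, NP and NP-hardness\<close>

text \<open>
  Multi-tape Turing machines with two-way infinite tapes. States and tape symbols are initial
  segments of the natural numbers. State 0 is the start state and state 1 the accepting state;
  symbol 0 is the blank, symbols 1 and 2 are the input bits. A transition
  \<open>((q, rs), (q', ws))\<close> applies in state \<open>q\<close> if \<open>rs\<close> is the list of symbols under the heads; it
  changes to state \<open>q'\<close> and \<open>ws\<close> lists, for each tape, the symbol to write and the head
  displacement.
\<close>

record tm =
  tm_tapes :: nat
  tm_symbols :: nat
  tm_states :: nat
  tm_trans :: "((nat \<times> nat list) \<times> (nat \<times> (nat \<times> int) list)) set"

definition wf_tm :: "tm \<Rightarrow> bool" where
  "wf_tm M \<longleftrightarrow> 1 \<le> tm_tapes M \<and> 3 \<le> tm_symbols M \<and> 2 \<le> tm_states M \<and>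
    (\<forall>q rs q' ws. ((q, rs), (q', ws)) \<in> tm_trans M \<longrightarrow>
       q < tm_states M \<and> q \<noteq> 1 \<and> q' < tm_states M \<and>
       length rs = tm_tapes M \<and> (\<forall>s\<in>set rs. s < tm_symbols M) \<and>
       length ws = tm_tapes M \<and> (\<forall>(s, d)\<in>set ws. s < tm_symbols M \<and> d \<in> {-1, 0, 1}))"

definition deterministic_tm :: "tm \<Rightarrow> bool" where
  "deterministic_tm M \<longleftrightarrow> wf_tm M \<and> single_valued (tm_trans M)"

record conf =
  conf_state :: nat
  conf_tape :: "nat \<Rightarrow> int \<Rightarrow> nat"
  conf_head :: "nat \<Rightarrow> int"

definition tm_step :: "tm \<Rightarrow> (conf \<times> conf) set" where
  "tm_step M = {(c, c'). \<exists>q' ws.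
     ((conf_state c, map (\<lambda>i. conf_tape c i (conf_head c i)) [0..<tm_tapes M]), (q', ws))
        \<in> tm_trans M \<and>
     c' = \<lparr>conf_state = q',
           conf_tape = (\<lambda>i. if i < tm_tapes M
                            then (conf_tape c i)(conf_head c i := fst (ws ! i))
                            else conf_tape c i),
           conf_head = (\<lambda>i. if i < tm_tapes M then conf_head c i + snd (ws ! i)
                            else conf_head c i)\<rparr>}"

definition bit_symbol :: "bool \<Rightarrow> nat" where
  "bit_symbol b = (if b then 2 else 1)"

definition init_conf :: "bool list \<Rightarrow> conf" where
  "init_conf x = \<lparr>conf_state = 0,
     conf_tape = (\<lambda>i j. if i = 0 \<and> 0 \<le> j \<and> nat j < length x then bit_symbol (x ! nat j) else 0),
     conf_head = (\<lambda>i. 0)\<rparr>"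

text \<open>The output is the word on the last tape from cell 0 up to the first blank.\<close>

definition has_output :: "tm \<Rightarrow> conf \<Rightarrow> bool list \<Rightarrow> bool" where
  "has_output M c y \<longleftrightarrow>
     (\<forall>j<length y. conf_tape c (tm_tapes M - 1) (int j) = bit_symbol (y ! j)) \<and>
     conf_tape c (tm_tapes M - 1) (int (length y)) = 0"

definition poly_time_computable :: "(bool list \<Rightarrow> bool list) \<Rightarrow> bool" where
  "poly_time_computable f \<longleftrightarrow> (\<exists>M (p :: nat poly). deterministic_tm M \<and>
     (\<forall>x. \<exists>m c. m \<le> poly p (length x) \<and> (init_conf x, c) \<in> tm_step M ^^ m \<and>
        c \<notin> Domain (tm_step M) \<and> has_output M c (f x)))"

text \<open>A language is in NP if some nondeterministic machine accepts exactly its words and all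
  computations on inputs of length \<open>l\<close> have at most polynomially many (in \<open>l\<close>) steps.\<close>

definition NP :: "bool list set set" where
  "NP = {L. \<exists>M (p :: nat poly). wf_tm M \<and>
     (\<forall>x m c. (init_conf x, c) \<in> tm_step M ^^ m \<longrightarrow> m \<le> poly p (length x)) \<and>
     (\<forall>x. x \<in> L \<longleftrightarrow> (\<exists>c. (init_conf x, c) \<in> (tm_step M)\<^sup>* \<and> conf_state c = 1))}"

definition poly_time_reducible :: "bool list set \<Rightarrow> bool list set \<Rightarrow> bool" where
  "poly_time_reducible A B \<longleftrightarrow>
     (\<exists>f. poly_time_computable f \<and> (\<forall>x. x \<in> A \<longleftrightarrow> f x \<in> B))"

definition NP_hard :: "bool list set \<Rightarrow> bool" where
  "NP_hard B \<longleftrightarrow> (\<forall>A\<in>NP. poly_time_reducible A B)"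


section \<open>Circuits\<close>

record circuit =
  verts :: "nat set"
  edges :: "(nat \<times> nat) set"
  input_var :: "nat \<Rightarrow> nat"
  var_set :: "nat \<Rightarrow> nat set"

definition preds :: "circuit \<Rightarrow> nat \<Rightarrow> nat set" where
  "preds C v = {u. (u, v) \<in> edges C}"

definition inputs :: "circuit \<Rightarrow> nat set" where
  "inputs C = {v \<in> verts C. card (preds C v) = 0}"

definition gates :: "circuit \<Rightarrow> nat set" where
  "gates C = {v \<in> verts C. card (preds C v) = 2}"

definition is_circuit :: "nat \<Rightarrow> circuit \<Rightarrow> bool" where
  "is_circuit n C \<longleftrightarrow>
     finite (verts C) \<and> edges C \<subseteq> verts C \<times> verts C \<and> acyclic (edges C) \<and>
     verts C = inputs C \<union> gates C \<and>
     (\<forall>v\<in>inputs C. input_var C v \<in> {1..n} \<and> var_set C v = {input_var C v}) \<and>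
     (\<forall>v\<in>gates C. \<forall>u w. preds C v = {u, w} \<longrightarrow>
        var_set C u \<inter> var_set C w = {} \<and> var_set C v = var_set C u \<union> var_set C w)"

inductive evaluates :: "(bool \<Rightarrow> bool \<Rightarrow> bool) \<Rightarrow> circuit \<Rightarrow> (nat \<Rightarrow> bool) \<Rightarrow> nat \<Rightarrow> bool \<Rightarrow> bool"
  for f C x where
  input: "v \<in> inputs C \<Longrightarrow> evaluates f C x v (x (input_var C v))"
| gate: "v \<in> gates C \<Longrightarrow> preds C v = {u, w} \<Longrightarrow> evaluates f C x u a \<Longrightarrow> evaluates f C x w b
     \<Longrightarrow> evaluates f C x v (f a b)"

text \<open>The iterated operator over a nonempty finite set. The operator need not have a neutral
  element, so the fold starts with one of the operands.\<close>

definition big_op :: "(bool \<Rightarrow> bool \<Rightarrow> bool) \<Rightarrow> (nat \<Rightarrow> bool) \<Rightarrow> nat set \<Rightarrow> bool" where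
  "big_op f x S = Finite_Set.fold (\<lambda>i. f (x i)) (x (Min S)) (S - {Min S})"

definition vertex_computes :: "(bool \<Rightarrow> bool \<Rightarrow> bool) \<Rightarrow> circuit \<Rightarrow> nat \<Rightarrow> nat set \<Rightarrow> bool" where
  "vertex_computes f C v T \<longleftrightarrow> (\<forall>x b. evaluates f C x v b \<longleftrightarrow> b = big_op f x T)"

text \<open>The last conjunct is automatic for associative and commutative operators, see
  \<open>circuit_computes\<close> below.\<close>

definition is_solution :: "(bool \<Rightarrow> bool \<Rightarrow> bool) \<Rightarrow> nat \<Rightarrow> nat set set \<Rightarrow> circuit \<Rightarrow> bool" where
  "is_solution f n \<T> C \<longleftrightarrow> is_circuit n C \<and>
     (\<forall>T\<in>\<T>. \<exists>v\<in>verts C. var_set C v = T \<and> vertex_computes f C v T)"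


section \<open>The decision problem\<close>

text \<open>Little-endian binary representation.\<close>

fun binary :: "nat \<Rightarrow> bool list" where
  "binary k = (if k = 0 then [] else odd k # binary (k div 2))"

declare binary.simps [simp del]

definition block :: "bool list \<Rightarrow> bool list" where
  "block w = concat (map (\<lambda>b. [True, b]) w) @ [False]"

text \<open>Trees are given as incidence vectors of length \<open>n\<close>; writing \<open>n\<close> itself in unary therefore
  does not change the order of magnitude of the encoding.\<close>

definition encode_instance :: "nat \<Rightarrow> nat set list \<Rightarrow> nat \<Rightarrow> bool list" where
  "encode_instance n Ts k =
     block (replicate n True) @ block (binary k) @
     concat (map (\<lambda>T. block (map (\<lambda>i. i \<in> T) [1..<Suc n])) Ts)"

text \<open>The decision version of the minimization problem: given the family and a bound \<open>k\<close>, is there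
  a solution with at most \<open>k\<close> gates?\<close>

definition BSTSO :: "(bool \<Rightarrow> bool \<Rightarrow> bool) \<Rightarrow> bool list set" where
  "BSTSO f = {encode_instance n Ts k | n Ts k.
     (\<forall>T\<in>set Ts. T \<subseteq> {1..n}) \<and> (\<exists>C. is_solution f n (set Ts) C \<and> card (gates C) \<le> k)}"


section \<open>Sanity checks\<close>

lemma block_append_eq_iff: "block a @ u = block b @ v \<longleftrightarrow> a = b \<and> u = v"
proof (induction a arbitrary: b)
  case Nil
  then show ?case by (cases b) (auto simp: block_def)
next
  case (Cons x a)
  show ?case
  proof (cases b)
    case Nil
    then show ?thesis by (auto simp: block_def)
  next
    case (Cons y b')
    then show ?thesis using Cons.IH[of b'] by (auto simp: block_def)
  qed
qed

lemma binary_0 [simp]: "binary 0 = []"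
  by (subst binary.simps) simp

lemma binary_pos: "k \<noteq> 0 \<Longrightarrow> binary k = odd k # binary (k div 2)"
  by (subst binary.simps) simp

lemma binary_inject: "binary k = binary l \<longleftrightarrow> k = l"
proof (induction k arbitrary: l rule: less_induct)
  case (less k)
  consider "k = 0" "l = 0" | "k = 0" "l \<noteq> 0" | "k \<noteq> 0" "l = 0" | "k \<noteq> 0" "l \<noteq> 0" by blast
  then show ?case
  proof cases
    case 4
    have IH: "binary (k div 2) = binary (l div 2) \<longleftrightarrow> k div 2 = l div 2"
      using 4 by (intro less.IH) simp
    have "binary k = binary l \<longleftrightarrow> odd k = odd l \<and> k div 2 = l div 2"
      unfolding binary_pos[OF 4(1)] binary_pos[OF 4(2)] list.inject IH ..
    also have "\<dots> \<longleftrightarrow> k = l" by presburger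
    finally show ?thesis .
  qed (use binary_pos[of k] binary_pos[of l] in force)+
qed

lemma encode_instance_inject:
  assumes "\<forall>T\<in>set Ts. T \<subseteq> {1..n}" "\<forall>T\<in>set Ts'. T \<subseteq> {1..n'}"
  shows "encode_instance n Ts k = encode_instance n' Ts' k' \<longleftrightarrow> n = n' \<and> Ts = Ts' \<and> k = k'"
proof -
  have block_ne: "block w \<noteq> []" for w by (simp add: block_def)
  have vec: "map (\<lambda>i. i \<in> T) [1..<Suc n] = map (\<lambda>i. i \<in> T') [1..<Suc n] \<longleftrightarrow> T = T'"
    if "T \<subseteq> {1..n}" "T' \<subseteq> {1..n}" for T T' :: "nat set"
  proof -
    have "set [1..<Suc n] = {1..n}" by auto
    then show ?thesis using that unfolding map_eq_conv by blast
  qed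
  have lists: "concat (map (\<lambda>T. block (map (\<lambda>i. i \<in> T) [1..<Suc n])) A) =
      concat (map (\<lambda>T. block (map (\<lambda>i. i \<in> T) [1..<Suc n])) B) \<longleftrightarrow> A = B"
    if "\<forall>T\<in>set A. T \<subseteq> {1..n}" "\<forall>T\<in>set B. T \<subseteq> {1..n}" for A B :: "nat set list"
    using that
  proof (induction A arbitrary: B)
    case Nil
    then show ?case by (cases B) (auto simp: block_ne)
  next
    case (Cons T A)
    show ?case
    proof (cases B)
      case Nil
      then show ?thesis by (simp add: block_ne del: upt_Suc)
    next
      case (Cons T' B')
      then have "T \<subseteq> {1..n}" "T' \<subseteq> {1..n}" and "\<forall>T\<in>set A. T \<subseteq> {1..n}" "\<forall>T\<in>set B'. T \<subseteq> {1..n}"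
        using Cons.prems by simp_all
      then show ?thesis
        unfolding Cons list.map concat.simps block_append_eq_iff list.inject
        using vec Cons.IH by presburger
    qed
  qed
  have "replicate n True = replicate n' True \<longleftrightarrow> n = n'"
    by (metis length_replicate)
  then show ?thesis
    unfolding encode_instance_def block_append_eq_iff binary_inject
    using lists assms by metis
qed

context abel_semigroup
begin

lemma fold_move:
  assumes "finite A"
  shows "Finite_Set.fold (\<lambda>i. f (x i)) (f a b) A = f a (Finite_Set.fold (\<lambda>i. f (x i)) b A)"
proof -
  interpret comp_fun_commute "\<lambda>i. f (x i)"
    by standard (auto simp: fun_eq_iff left_commute)
  show ?thesis using assms
    by (induction A rule: finite_induct) (auto simp: left_commute)
qed

end

lemma big_op_Un:
  assumes f: "abel_semigroup f"
    and A: "finite A" "A \<noteq> {}" and B: "finite B" "B \<noteq> {}" and disj: "A \<inter> B = {}"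
  shows "big_op f x (A \<union> B) = f (big_op f x A) (big_op f x B)"
proof -
  interpret abel_semigroup f by (rule f)
  interpret F: comp_fun_commute "\<lambda>i. f (x i)"
    by standard (auto simp: fun_eq_iff left_commute)
  let ?F = "Finite_Set.fold (\<lambda>i. f (x i))"
  have any: "big_op f x S = ?F (x a) (S - {a})" if "finite S" "a \<in> S" for S a
  proof (cases "a = Min S")
    case True
    then show ?thesis by (simp add: big_op_def)
  next
    case False
    define m where "m = Min S"
    define R where "R = S - {a, m}"
    have m: "m \<in> S" "m \<noteq> a" using that False by (auto simp: m_def intro!: Min_in)
    have R: "finite R" "m \<notin> R" "a \<notin> R" "S - {a} = insert m R" "S - {m} = insert a R"
      using that m by (auto simp: R_def)
    show ?thesis
      using R by (simp add: big_op_def m_def[symmetric] fold_move[symmetric] commute)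
  qed
  obtain a where a: "a \<in> A" using A by blast
  have un: "?F z (A' \<union> B) = ?F (?F z B) A'" if "finite A'" "A' \<inter> B = {}" for z A'
    using that B by (induction A' rule: finite_induct) auto
  obtain m where m: "m \<in> B" using B by blast
  have "?F (x a) B = ?F (x a) (insert m (B - {m}))" using m by (simp add: insert_absorb)
  also have "\<dots> = f (x a) (?F (x m) (B - {m}))"
    using B by (simp add: fold_move[symmetric] commute del: insert_Diff_single)
  finally have B': "?F (x a) B = f (x a) (big_op f x B)" using any[OF B(1) m] by simp
  have "big_op f x (A \<union> B) = ?F (x a) ((A - {a}) \<union> B)"
  proof -
    have "A \<union> B - {a} = (A - {a}) \<union> B" using a disj by blast
    then show ?thesis using any[of "A \<union> B" a] a A B by simp
  qed
  also have "\<dots> = ?F (f (big_op f x B) (x a)) (A - {a})"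
  proof -
    have "(A - {a}) \<inter> B = {}" using disj by blast
    then have "?F (x a) ((A - {a}) \<union> B) = ?F (?F (x a) B) (A - {a})"
      using A by (intro un) simp_all
    then show ?thesis unfolding B' commute[of "x a"] .
  qed
  also have "\<dots> = f (big_op f x B) (big_op f x A)"
    unfolding any[OF A(1) a] by (rule fold_move) (use A in simp)
  finally show ?thesis by (simp only: commute)
qed

lemma circuit_computes:
  assumes f: "abel_semigroup f" and C: "is_circuit n C" and v: "v \<in> verts C"
  shows "vertex_computes f C v (var_set C v)"
proof -
  have fin: "finite (verts C)" "edges C \<subseteq> verts C \<times> verts C" "acyclic (edges C)"
    and part: "verts C = inputs C \<union> gates C"
    and inp: "\<And>v. v \<in> inputs C \<Longrightarrow> var_set C v = {input_var C v}"
    and gt: "\<And>v u w. v \<in> gates C \<Longrightarrow> preds C v = {u, w} \<Longrightarrow>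
        var_set C u \<inter> var_set C w = {} \<and> var_set C v = var_set C u \<union> var_set C w"
    using C by (auto simp: is_circuit_def)
  have "finite (edges C)" using fin by (meson finite_SigmaI finite_subset)
  then have "wf (edges C)" using fin by (simp add: finite_acyclic_wf)
  then have "v \<in> verts C \<longrightarrow> finite (var_set C v) \<and> var_set C v \<noteq> {} \<and>
      vertex_computes f C v (var_set C v)"
  proof (induction v rule: wf_induct_rule)
    case (less v)
    show ?case
    proof (intro impI)
      assume "v \<in> verts C"
      then consider "v \<in> inputs C" | "v \<in> gates C" using part by auto
      then show "finite (var_set C v) \<and> var_set C v \<noteq> {} \<and> vertex_computes f C v (var_set C v)"
      proof cases
        case 1
        then have "v \<notin> gates C" by (auto simp: inputs_def gates_def)
        then have "vertex_computes f C v {input_var C v}"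
          using 1 unfolding vertex_computes_def
          by (auto simp: big_op_def intro: evaluates.intros elim: evaluates.cases)
        then show ?thesis using inp[OF 1] by simp
      next
        case 2
        then have ni: "v \<notin> inputs C" by (auto simp: inputs_def gates_def)
        have IH: "finite (var_set C u) \<and> var_set C u \<noteq> {} \<and> vertex_computes f C u (var_set C u)"
          if "u \<in> preds C v" for u
          using less.IH[of u] that fin by (auto simp: preds_def)
        have val: "f (big_op f x (var_set C u)) (big_op f x (var_set C w)) =
            big_op f x (var_set C v)" if "preds C v = {u, w}" for x u w
          using big_op_Un[OF f, of "var_set C u" "var_set C w" x] IH[of u] IH[of w]
            gt[OF 2 that] that by simp
        obtain u w where uw: "preds C v = {u, w}"
          using 2 by (auto simp: gates_def card_2_iff)
        have "evaluates f C x v b \<longleftrightarrow> b = big_op f x (var_set C v)" for x b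
        proof
          assume "evaluates f C x v b"
          then show "b = big_op f x (var_set C v)"
          proof cases
            case input
            then show ?thesis using ni by simp
          next
            case (gate u w a b)
            then show ?thesis
              using val[of u w x] IH[of u] IH[of w] by (auto simp: vertex_computes_def)
          qed
        next
          assume b: "b = big_op f x (var_set C v)"
          have "evaluates f C x v (f (big_op f x (var_set C u)) (big_op f x (var_set C w)))"
            using IH[of u] IH[of w] uw by (intro evaluates.gate[OF 2 uw])
              (auto simp: vertex_computes_def)
          then show "evaluates f C x v b" using val[OF uw] b by simp
        qed
        then show ?thesis
          using IH[of u] IH[of w] gt[OF 2 uw] uw by (auto simp: vertex_computes_def)
      qed
    qed
  qed
  then show ?thesis using v by blast
qed

end

theory Submission
  imports Defs "HOL-Library.Nat_Bijection"
begin

text \<open>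
  Let \<open>M\<close> decide a language in NP within \<open>T\<close> steps. The space-time diagram of a run of \<open>M\<close> on \<open>x\<close> is cut
  into \<open>N\<close> cells, enumerated row by row with rows of length \<open>D\<close>. A tile records the current transition
  and, for every tape, a symbol together with the clipped distance to the head; then correctness of
  the diagram becomes a condition on single cells and on the pairs of cells \<open>c, c + 1\<close> and \<open>c, c + D\<close>.

  Take one vertex for each cell \<open>c\<close> and each of the \<open>g\<close> tiles \<open>a\<close>, and an edge (or a loop) for every
  forbidden combination, including two tiles in one cell. A vertex cover has at least \<open>N (g - 1)\<close>
  elements, and one of exactly this size omits one vertex per cell, that is, it is a tiling.

  For an extra variable \<open>1\<close> and the trees \<open>{1, u, v}\<close> of the edges \<open>{u, v}\<close>, every solution needs one gate
  per edge and, for each edge, a gate for \<open>{1, u}\<close>, \<open>{1, v}\<close> or \<open>{u, v}\<close>; replacing \<open>{u, v}\<close> by \<open>{1, u}\<close>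
  turns the gates on two variables into a vertex cover. So the optimum is the number of edges plus
  the minimum size of a vertex cover.

  The reduction is computed by a program in a small structured language over tapes, which is
  compiled to Turing machines with the running time preserved step by step.
\<close>
section \<open>Structured programs for multi-tape machines\<close>

text \<open>The tiles depend on the machine alone; the input enters only through the types of the
  cells. Hence every forbidden combination is an entry of a finite table built into the program, and
  at run time it remains to produce the word of types, to move through pairs of positions in it and
  to count. Numbers are tape lengths or head positions; only the bound is kept in binary, as the
  encoding asks for it.

  An edge constrains two tiles, but a step of a machine with several tapes reads symbols under heads
  that may be far apart. This is why a tile carries the whole transition of its row and its distance
  to every head: agreement along the row replaces a global constraint. A loop, that is, a tile
  excluded by the type of its cell, becomes a tree with two elements; it forces its vertex into the
  cover and adds nothing to the part of the bound that counts edges.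

  Since predecessors have disjoint variable sets, counting gates is a question about families of
  sets, the same for every operator.\<close>

datatype prog =
    Skip
  | Wr nat nat int
  | Mv nat int
  | Seq prog prog
  | Ift nat "nat set" prog prog
  | Whl nat "nat set" prog

type_synonym store = "nat \<Rightarrow> (int \<Rightarrow> nat) \<times> int"

definition rd :: "store \<Rightarrow> nat \<Rightarrow> nat" where
  "rd s j = fst (s j) (snd (s j))"

definition wr :: "nat \<Rightarrow> nat \<Rightarrow> int \<Rightarrow> store \<Rightarrow> store" where
  "wr j b d s = s(j := ((fst (s j))(snd (s j) := b), snd (s j) + d))"

definition mv :: "nat \<Rightarrow> int \<Rightarrow> store \<Rightarrow> store" where
  "mv j d s = s(j := (fst (s j), snd (s j) + d))"

text \<open>The step counts are those of the compiled code: a test costs one step, the then branch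
  one more for the jump over the else branch, and a loop body one more for the jump back to the
  test. Sequencing is free because the second program starts in the exit state of the first.\<close>

inductive run :: "prog \<Rightarrow> store \<Rightarrow> store \<Rightarrow> nat \<Rightarrow> bool" where
  run_Skip: "run Skip s s 0"
| run_Wr: "run (Wr j b d) s (wr j b d s) 1"
| run_Mv: "run (Mv j d) s (mv j d s) 1"
| run_Seq: "run p s t m \<Longrightarrow> run q t u m' \<Longrightarrow> run (Seq p q) s u (m + m')"
| run_IfT: "rd s j \<in> A \<Longrightarrow> run p s t m \<Longrightarrow> run (Ift j A p q) s t (m + 2)"
| run_IfF: "rd s j \<notin> A \<Longrightarrow> run q s t m \<Longrightarrow> run (Ift j A p q) s t (m + 1)"
| run_WhF: "rd s j \<notin> A \<Longrightarrow> run (Whl j A p) s s 1"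
| run_WhT: "rd s j \<in> A \<Longrightarrow> run p s t m \<Longrightarrow> run (Whl j A p) t u m' \<Longrightarrow> run (Whl j A p) s u (m + 2 + m')"

section \<open>Compilation to transition tables\<close>

fun prog_size :: "prog \<Rightarrow> nat" where
  "prog_size Skip = 0"
| "prog_size (Wr j b d) = 1"
| "prog_size (Mv j d) = 1"
| "prog_size (Seq p q) = prog_size p + prog_size q"
| "prog_size (Ift j A p q) = prog_size p + prog_size q + 2"
| "prog_size (Whl j A p) = prog_size p + 2"

fun wf_prog :: "nat \<Rightarrow> nat \<Rightarrow> prog \<Rightarrow> bool" where
  "wf_prog K G Skip \<longleftrightarrow> True"
| "wf_prog K G (Wr j b d) \<longleftrightarrow> j < K \<and> b < G \<and> d \<in> {-1, 0, 1}"
| "wf_prog K G (Mv j d) \<longleftrightarrow> j < K \<and> d \<in> {-1, 0, 1}"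
| "wf_prog K G (Seq p q) \<longleftrightarrow> wf_prog K G p \<and> wf_prog K G q"
| "wf_prog K G (Ift j A p q) \<longleftrightarrow> j < K \<and> wf_prog K G p \<and> wf_prog K G q"
| "wf_prog K G (Whl j A p) \<longleftrightarrow> j < K \<and> wf_prog K G p"

definition reads :: "nat \<Rightarrow> nat \<Rightarrow> nat list set" where
  "reads K G = {rs. length rs = K \<and> (\<forall>s\<in>set rs. s < G)}"

text \<open>A transition always writes on every tape, so a jump has to write back the symbols it has
  read.\<close>

definition keep :: "nat list \<Rightarrow> (nat \<times> int) list" where
  "keep rs = map (\<lambda>r. (r, 0)) rs"

type_synonym trans = "((nat \<times> nat list) \<times> (nat \<times> (nat \<times> int) list)) set"

definition instr :: "nat \<Rightarrow> nat \<Rightarrow> nat \<Rightarrow> (nat list \<Rightarrow> nat) \<Rightarrow> (nat list \<Rightarrow> (nat \<times> int) list) \<Rightarrow> trans" where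
  "instr K G a nxt act = (\<lambda>rs. ((a, rs), (nxt rs, act rs))) ` reads K G"

text \<open>The code of a program occupies the states \<open>a, \<dots>, a + prog_size p - 1\<close>; control leaves it in state
  \<open>a + prog_size p\<close>.\<close>

fun code :: "nat \<Rightarrow> nat \<Rightarrow> prog \<Rightarrow> nat \<Rightarrow> trans" where
  "code K G Skip a = {}"
| "code K G (Wr j b d) a = instr K G a (\<lambda>_. Suc a) (\<lambda>rs. (keep rs)[j := (b, d)])"
| "code K G (Mv j d) a = instr K G a (\<lambda>_. Suc a) (\<lambda>rs. (keep rs)[j := (rs ! j, d)])"
| "code K G (Seq p q) a = code K G p a \<union> code K G q (a + prog_size p)"
| "code K G (Ift j A p q) a =
     instr K G a (\<lambda>rs. if rs ! j \<in> A then Suc a else a + prog_size p + 2) keep \<union>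
     code K G p (Suc a) \<union>
     instr K G (Suc a + prog_size p) (\<lambda>_. a + prog_size p + prog_size q + 2) keep \<union>
     code K G q (a + prog_size p + 2)"
| "code K G (Whl j A p) a =
     instr K G a (\<lambda>rs. if rs ! j \<in> A then Suc a else a + prog_size p + 2) keep \<union>
     code K G p (Suc a) \<union>
     instr K G (Suc a + prog_size p) (\<lambda>_. a) keep"

definition valid_writes :: "nat \<Rightarrow> nat \<Rightarrow> (nat \<times> int) list \<Rightarrow> bool" where
  "valid_writes K G ws \<longleftrightarrow> length ws = K \<and> (\<forall>(s, d)\<in>set ws. s < G \<and> d \<in> {-1, 0, 1})"

lemma valid_writes_keep: "rs \<in> reads K G \<Longrightarrow> valid_writes K G (keep rs)"
  by (auto simp: valid_writes_def keep_def reads_def)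

lemma valid_writes_upd:
  assumes "valid_writes K G ws" "b < G" "d \<in> {-1, 0, 1}"
  shows "valid_writes K G (ws[j := (b, d)])"
  using assms set_update_subset_insert[of ws j "(b, d)"] unfolding valid_writes_def by (auto dest!: subsetD)

lemma instr_iff:
  "((q, rs), (q', ws)) \<in> instr K G a nxt act \<longleftrightarrow> rs \<in> reads K G \<and> q = a \<and> q' = nxt rs \<and> ws = act rs"
  by (auto simp: instr_def)

text \<open>Source states lie in a half-open interval: subprograms at consecutive addresses cannot
  interfere, which gives determinism, and the exit state \<open>a + prog_size p\<close> has no
  outgoing transition, so that it can serve as the halting state.\<close>

lemma code_wf:
  assumes "wf_prog K G p" "((q, rs), (q', ws)) \<in> code K G p a"
  shows "a \<le> q \<and> q < a + prog_size p \<and> q' \<le> a + prog_size p \<and> rs \<in> reads K G \<and> valid_writes K G ws"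
  using assms
proof (induction p arbitrary: a)
  case (Mv j d)
  then have "rs \<in> reads K G" by (simp add: instr_iff)
  moreover from this have "rs ! j < G" using Mv by (auto simp: reads_def)
  ultimately show ?case using Mv by (auto simp: instr_iff intro!: valid_writes_upd valid_writes_keep)
qed (fastforce simp: instr_iff valid_writes_keep split: if_splits intro!: valid_writes_upd valid_writes_keep)+

lemma code_deterministic: "wf_prog K G p \<Longrightarrow> single_valued (code K G p a)"
proof (induction p arbitrary: a)
  case (Seq p q)
  show ?case
  proof (rule single_valuedI, clarify)
    fix x rs y ws z ws'
    assume a: "((x, rs), (y, ws)) \<in> code K G (Seq p q) a" "((x, rs), (z, ws')) \<in> code K G (Seq p q) a"
    show "y = z \<and> ws = ws'"
      using a Seq code_wf[of K G p x rs _ _ a] code_wf[of K G q x rs _ _ "a + prog_size p"]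
      by (auto dest: single_valuedD) (meson leD)+
  qed
next
  case (Ift j A p q)
  show ?case
  proof (rule single_valuedI, clarify)
    fix x rs y ws z ws'
    assume a: "((x, rs), (y, ws)) \<in> code K G (Ift j A p q) a" "((x, rs), (z, ws')) \<in> code K G (Ift j A p q) a"
    show "y = z \<and> ws = ws'"
      using a Ift.prems Ift.IH(1)[of "Suc a"] Ift.IH(2)[of "a + prog_size p + 2"]
        code_wf[of K G p x rs _ _ "Suc a"] code_wf[of K G q x rs _ _ "a + prog_size p + 2"]
      by (fastforce simp: instr_iff dest: single_valuedD)
  qed
next
  case (Whl j A p)
  show ?case
  proof (rule single_valuedI, clarify)
    fix x rs y ws z ws'
    assume a: "((x, rs), (y, ws)) \<in> code K G (Whl j A p) a" "((x, rs), (z, ws')) \<in> code K G (Whl j A p) a"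
    show "y = z \<and> ws = ws'"
      using a Whl.prems Whl.IH[of "Suc a"] code_wf[of K G p x rs _ _ "Suc a"]
      by (fastforce simp: instr_iff dest: single_valuedD)
  qed
qed (auto simp: single_valued_def instr_iff)

definition conf_of :: "nat \<Rightarrow> store \<Rightarrow> conf" where
  "conf_of q s = \<lparr>conf_state = q, conf_tape = (\<lambda>i. fst (s i)), conf_head = (\<lambda>i. snd (s i))\<rparr>"

text \<open>Transitions exist only for read symbols below \<open>G\<close>, so the simulation has to
  carry this invariant along.\<close>

definition bounded_store :: "nat \<Rightarrow> store \<Rightarrow> bool" where
  "bounded_store G s \<longleftrightarrow> (\<forall>i z. fst (s i) z < G)"

definition symbols_read :: "nat \<Rightarrow> store \<Rightarrow> nat list" where
  "symbols_read K s = map (rd s) [0..<K]"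

lemma symbols_read_in_reads: "bounded_store G s \<Longrightarrow> symbols_read K s \<in> reads K G"
  by (auto simp: symbols_read_def reads_def bounded_store_def rd_def)

lemma tm_step_conf_of:
  assumes "((q, symbols_read (tm_tapes M) s), (q', ws)) \<in> tm_trans M"
    and "\<And>i. t i = (if i < tm_tapes M then ((fst (s i))(snd (s i) := fst (ws ! i)), snd (s i) + snd (ws ! i)) else s i)"
  shows "(conf_of q s, conf_of q' t) \<in> tm_step M"
proof -
  have "((q, map (\<lambda>i. fst (s i) (snd (s i))) [0..<tm_tapes M]), (q', ws)) \<in> tm_trans M"
    using assms(1) by (simp add: symbols_read_def rd_def[abs_def])
  then show ?thesis
    unfolding tm_step_def using assms(2) by (auto simp: conf_of_def fun_eq_iff intro!: exI[of _ ws])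
qed

lemma tm_step_keep:
  assumes "((q, symbols_read (tm_tapes M) s), (q', keep (symbols_read (tm_tapes M) s))) \<in> tm_trans M"
  shows "(conf_of q s, conf_of q' s) \<in> tm_step M"
  by (rule tm_step_conf_of[OF assms]) (auto simp: keep_def symbols_read_def rd_def)

text \<open>The number of steps is preserved exactly. The address \<open>a\<close> is generalised in
  the induction because subprograms are compiled at shifted addresses.\<close>

lemma run_simulated:
  assumes "run p s t m" "wf_prog K G p" "bounded_store G s" "tm_tapes M = K" "code K G p a \<subseteq> tm_trans M"
  shows "(conf_of a s, conf_of (a + prog_size p) t) \<in> tm_step M ^^ m \<and> bounded_store G t"
  using assms
proof (induction arbitrary: a rule: run.induct)
  case (run_Skip s)
  then show ?case by simp
next
  case (run_Wr j b d s)
  let ?ws = "(keep (symbols_read K s))[j := (b, d)]"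
  have "((a, symbols_read K s), (Suc a, ?ws)) \<in> tm_trans M"
    using run_Wr.prems symbols_read_in_reads[of G s K] by (auto simp: instr_def image_subset_iff)
  then have "(conf_of a s, conf_of (Suc a) (wr j b d s)) \<in> tm_step M"
    using run_Wr.prems by (intro tm_step_conf_of[where ws = ?ws])
      (auto simp: wr_def keep_def symbols_read_def rd_def nth_list_update)
  moreover have "bounded_store G (wr j b d s)"
    using run_Wr.prems by (auto simp: bounded_store_def wr_def)
  ultimately show ?case by simp
next
  case (run_Mv j d s)
  let ?ws = "(keep (symbols_read K s))[j := (symbols_read K s ! j, d)]"
  have "((a, symbols_read K s), (Suc a, ?ws)) \<in> tm_trans M"
    using run_Mv.prems symbols_read_in_reads[of G s K] by (auto simp: instr_def image_subset_iff)
  then have "(conf_of a s, conf_of (Suc a) (mv j d s)) \<in> tm_step M"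
    using run_Mv.prems by (intro tm_step_conf_of[where ws = ?ws])
      (auto simp: mv_def keep_def symbols_read_def rd_def nth_list_update)
  moreover have "bounded_store G (mv j d s)"
    using run_Mv.prems by (auto simp: bounded_store_def mv_def)
  ultimately show ?case by simp
next
  case (run_Seq p s t m q u m')
  then have "(conf_of a s, conf_of (a + prog_size p) t) \<in> tm_step M ^^ m" "bounded_store G t" by auto
  moreover from this have "(conf_of (a + prog_size p) t, conf_of (a + prog_size p + prog_size q) u) \<in> tm_step M ^^ m'" "bounded_store G u"
    using run_Seq by auto
  ultimately show ?case by (auto simp: relpow_add add.assoc)
next
  case (run_IfT s j A p t m q)
  then have j: "symbols_read K s ! j \<in> A" "j < K" by (auto simp: symbols_read_def)
  have 1: "(conf_of a s, conf_of (Suc a) s) \<in> tm_step M"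
    using run_IfT.prems j symbols_read_in_reads[of G s K] by (intro tm_step_keep) (auto simp: instr_def image_subset_iff)
  have 2: "(conf_of (Suc a) s, conf_of (Suc a + prog_size p) t) \<in> tm_step M ^^ m" "bounded_store G t"
    using run_IfT.IH[of "Suc a"] run_IfT.prems by auto
  have 3: "(conf_of (Suc a + prog_size p) t, conf_of (a + prog_size p + prog_size q + 2) t) \<in> tm_step M"
    using run_IfT.prems 2(2) symbols_read_in_reads[of G t K] by (intro tm_step_keep) (auto simp: instr_def image_subset_iff)
  have "(conf_of a s, conf_of (Suc a + prog_size p) t) \<in> tm_step M ^^ Suc m" by (rule relpow_Suc_I2[OF 1 2(1)])
  then have "(conf_of a s, conf_of (a + prog_size p + prog_size q + 2) t) \<in> tm_step M ^^ Suc (Suc m)" by (rule relpow_Suc_I[OF _ 3])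
  then show ?case using 2(2) by (simp add: add.assoc)
next
  case (run_IfF s j A q t m p)
  then have j: "symbols_read K s ! j \<notin> A" "j < K" by (auto simp: symbols_read_def)
  have 1: "(conf_of a s, conf_of (a + prog_size p + 2) s) \<in> tm_step M"
    using run_IfF.prems j symbols_read_in_reads[of G s K] by (intro tm_step_keep) (auto simp: instr_def image_subset_iff)
  have 2: "(conf_of (a + prog_size p + 2) s, conf_of (a + prog_size p + 2 + prog_size q) t) \<in> tm_step M ^^ m" "bounded_store G t"
    using run_IfF.IH[of "a + prog_size p + 2"] run_IfF.prems by auto
  have "(conf_of a s, conf_of (a + prog_size p + 2 + prog_size q) t) \<in> tm_step M ^^ Suc m" by (rule relpow_Suc_I2[OF 1 2(1)])
  then show ?case using 2(2) by (simp add: ac_simps)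
next
  case (run_WhF s j A p)
  then have j: "symbols_read K s ! j \<notin> A" "j < K" by (auto simp: symbols_read_def)
  have "(conf_of a s, conf_of (a + prog_size p + 2) s) \<in> tm_step M"
    using run_WhF.prems j symbols_read_in_reads[of G s K] by (intro tm_step_keep) (auto simp: instr_def image_subset_iff)
  then show ?case using run_WhF by simp
next
  case (run_WhT s j A p t m u m')
  then have j: "symbols_read K s ! j \<in> A" "j < K" by (auto simp: symbols_read_def)
  have 1: "(conf_of a s, conf_of (Suc a) s) \<in> tm_step M"
    using run_WhT.prems j symbols_read_in_reads[of G s K] by (intro tm_step_keep) (auto simp: instr_def image_subset_iff)
  have 2: "(conf_of (Suc a) s, conf_of (Suc a + prog_size p) t) \<in> tm_step M ^^ m" "bounded_store G t"
    using run_WhT.IH(1)[of "Suc a"] run_WhT.prems by auto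
  have 3: "(conf_of (Suc a + prog_size p) t, conf_of a t) \<in> tm_step M"
    using run_WhT.prems 2(2) symbols_read_in_reads[of G t K] by (intro tm_step_keep) (auto simp: instr_def image_subset_iff)
  have 4: "(conf_of a t, conf_of (a + prog_size (Whl j A p)) u) \<in> tm_step M ^^ m'" "bounded_store G u"
    using run_WhT.IH(2)[of a] run_WhT.prems 2(2) by auto
  have "(conf_of a s, conf_of (Suc a + prog_size p) t) \<in> tm_step M ^^ Suc m" by (rule relpow_Suc_I2[OF 1 2(1)])
  then have "(conf_of a s, conf_of a t) \<in> tm_step M ^^ Suc (Suc m)" by (rule relpow_Suc_I[OF _ 3])
  then have "(conf_of a s, conf_of (a + prog_size (Whl j A p)) u) \<in> tm_step M ^^ (Suc (Suc m) + m')"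
    using 4(1) unfolding relpow_add by blast
  then show ?case using 4(2) by simp
qed

definition init_store :: "bool list \<Rightarrow> store" where
  "init_store x = (\<lambda>i. (\<lambda>j. if i = 0 \<and> 0 \<le> j \<and> nat j < length x then bit_symbol (x ! nat j) else 0, 0))"

lemma poly_time_computable_by_prog:
  fixes P :: "nat poly"
  assumes wf: "wf_prog K G p" and K: "1 \<le> K" and G: "3 \<le> G"
    and run: "\<And>x. \<exists>t m. run p (init_store x) t m \<and> m \<le> poly P (length x) \<and>
      (\<forall>j<length (f x). fst (t (K - 1)) (int j) = bit_symbol (f x ! j)) \<and>
      fst (t (K - 1)) (int (length (f x))) = 0"
  shows "poly_time_computable f"
proof -
  \<comment> \<open>State 0 is the start and state 1 the accepting state, which may not have
    outgoing transitions. The code therefore begins in state 2, and one jump from 0 to 2 accounts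
    for the \<open>P + 1\<close> in the time bound.\<close>
  define M where "M = \<lparr>tm_tapes = K, tm_symbols = G, tm_states = prog_size p + 3,
    tm_trans = instr K G 0 (\<lambda>_. 2) keep \<union> code K G p 2\<rparr>"
  have src: "q \<noteq> 1 \<and> q < prog_size p + 2 \<and> q' < prog_size p + 3 \<and> rs \<in> reads K G \<and> valid_writes K G ws"
    if "((q, rs), (q', ws)) \<in> tm_trans M" for q rs q' ws
    using that code_wf[OF wf, of q rs q' ws 2] by (auto simp: M_def instr_iff valid_writes_keep)
  have "wf_tm M"
    unfolding wf_tm_def using K G src by (fastforce simp: M_def reads_def valid_writes_def)
  moreover have "single_valued (tm_trans M)"
  proof (rule single_valuedI, clarify)
    fix x rs y ws z ws'
    assume "((x, rs), (y, ws)) \<in> tm_trans M" "((x, rs), (z, ws')) \<in> tm_trans M"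
    then show "y = z \<and> ws = ws'"
      using single_valuedD[OF code_deterministic[OF wf, of 2]] code_wf[OF wf, of x rs _ _ 2]
      by (fastforce simp: M_def instr_iff)
  qed
  ultimately have det: "deterministic_tm M" by (simp add: deterministic_tm_def)
  have "\<exists>m c. m \<le> poly (P + 1) (length x) \<and> (init_conf x, c) \<in> tm_step M ^^ m \<and>
        c \<notin> Domain (tm_step M) \<and> has_output M c (f x)" for x
  proof -
    obtain t m where t: "run p (init_store x) t m" "m \<le> poly P (length x)"
      "\<forall>j<length (f x). fst (t (K - 1)) (int j) = bit_symbol (f x ! j)"
      "fst (t (K - 1)) (int (length (f x))) = 0" using run by blast
    have b: "bounded_store G (init_store x)"
      using G by (auto simp: bounded_store_def init_store_def bit_symbol_def)
    have i: "init_conf x = conf_of 0 (init_store x)"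
      by (auto simp: init_conf_def conf_of_def init_store_def fun_eq_iff)
    have 1: "(conf_of 0 (init_store x), conf_of 2 (init_store x)) \<in> tm_step M"
      using symbols_read_in_reads[OF b] by (intro tm_step_keep) (auto simp: M_def instr_iff)
    have 2: "(conf_of 2 (init_store x), conf_of (2 + prog_size p) t) \<in> tm_step M ^^ m"
      using run_simulated[OF t(1) wf b, of M 2] by (auto simp: M_def)
    have "(init_conf x, conf_of (2 + prog_size p) t) \<in> tm_step M ^^ Suc m"
      unfolding i by (rule relpow_Suc_I2[OF 1 2])
    moreover have "conf_of (2 + prog_size p) t \<notin> Domain (tm_step M)"
      using src by (fastforce simp: tm_step_def conf_of_def)
    moreover have "has_output M (conf_of (2 + prog_size p) t) (f x)"
      using t by (simp add: has_output_def M_def conf_of_def)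
    moreover have "Suc m \<le> poly (P + 1) (length x)" using t(2) by simp
    ultimately show ?thesis by blast
  qed
  then show ?thesis unfolding poly_time_computable_def using det by blast
qed

section \<open>Upper bounds on running times, contents of tapes\<close>

definition runs :: "prog \<Rightarrow> store \<Rightarrow> store \<Rightarrow> nat \<Rightarrow> bool" where
  "runs p s t B \<longleftrightarrow> (\<exists>m\<le>B. run p s t m)"

lemma runs_mono: "runs p s t B \<Longrightarrow> B \<le> B' \<Longrightarrow> runs p s t B'"
  unfolding runs_def by (meson le_trans)

lemma runs_Skip: "runs Skip s s 0"
  unfolding runs_def using run_Skip by blast

lemma runs_Wr: "t = wr j b d s \<Longrightarrow> 1 \<le> B \<Longrightarrow> runs (Wr j b d) s t B"
  unfolding runs_def using run_Wr by blast

lemma runs_Mv: "t = mv j d s \<Longrightarrow> 1 \<le> B \<Longrightarrow> runs (Mv j d) s t B"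
  unfolding runs_def using run_Mv by blast

lemma runs_Seq: "runs p s t B \<Longrightarrow> runs q t u B' \<Longrightarrow> runs (Seq p q) s u (B + B')"
  unfolding runs_def by (meson add_mono run_Seq)

text \<open>Both branches share the bound \<open>B\<close>; the overhead 2 is that of the then
  branch, the dearer one.\<close>

lemma runs_Ift:
  assumes "rd s j \<in> A \<Longrightarrow> runs p s t B" "rd s j \<notin> A \<Longrightarrow> runs q s t B"
  shows "runs (Ift j A p q) s t (B + 2)"
proof (cases "rd s j \<in> A")
  case True
  then obtain m where "m \<le> B" "run p s t m" using assms by (auto simp: runs_def)
  then show ?thesis using run_IfT[OF True] unfolding runs_def by (meson add_mono_thms_linordered_semiring(3))
next
  case False
  then obtain m where m: "m \<le> B" "run q s t m" using assms by (auto simp: runs_def)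
  then have "run (Ift j A p q) s t (m + 1)" using run_IfF[OF False] by blast
  then show ?thesis using m unfolding runs_def by (intro exI[of _ "m + 1"]) simp
qed

lemma runs_Whl:
  assumes "\<And>i. i < n \<Longrightarrow> rd (\<sigma> i) j \<in> A \<and> runs p (\<sigma> i) (\<sigma> (Suc i)) B" "rd (\<sigma> n) j \<notin> A"
  shows "runs (Whl j A p) (\<sigma> 0) (\<sigma> n) (n * (B + 2) + 1)"
proof -
  \<comment> \<open>Induction on the number \<open>i\<close> of remaining iterations, since
    \<open>run_WhT\<close> splits off the first one.\<close>
  have "i \<le> n \<Longrightarrow> runs (Whl j A p) (\<sigma> (n - i)) (\<sigma> n) (i * (B + 2) + 1)" for i
  proof (induction i)
    case 0
    then show ?case using run_WhF[OF assms(2)] by (auto simp: runs_def)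
  next
    case (Suc i)
    then have s: "Suc (n - Suc i) = n - i" by simp
    obtain m where m: "m \<le> i * (B + 2) + 1" "run (Whl j A p) (\<sigma> (n - i)) (\<sigma> n) m"
      using Suc by (auto simp: runs_def)
    have a: "rd (\<sigma> (n - Suc i)) j \<in> A" "runs p (\<sigma> (n - Suc i)) (\<sigma> (n - i)) B"
      using assms(1)[of "n - Suc i"] Suc.prems unfolding s by auto
    then obtain m' where m': "m' \<le> B" "run p (\<sigma> (n - Suc i)) (\<sigma> (n - i)) m'" by (auto simp: runs_def)
    show ?case unfolding runs_def
      by (rule exI[of _ "m' + 2 + m"]) (use m m' run_WhT[OF a(1) m'(2) m(2)] in auto)
  qed
  from this[of n] show ?thesis by simp
qed

definition tape_of :: "nat list \<Rightarrow> int \<Rightarrow> nat" where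
  "tape_of ys z = (if 0 \<le> z \<and> nat z < length ys then ys ! nat z else 0)"

lemma tape_of_nth [simp]: "i < length ys \<Longrightarrow> tape_of ys (int i) = ys ! i"
  by (simp add: tape_of_def)

lemma tape_of_out [simp]: "z < 0 \<Longrightarrow> tape_of ys z = 0" "int (length ys) \<le> z \<Longrightarrow> tape_of ys z = 0"
  by (auto simp: tape_of_def)

lemma tape_of_append [simp]: "(tape_of ys)(int (length ys) := b) = tape_of (ys @ [b])"
  by (auto simp: tape_of_def fun_eq_iff nth_append)

lemma tape_of_pos_iff:
  assumes "0 \<notin> set ys"
  shows "0 < tape_of ys z \<longleftrightarrow> 0 \<le> z \<and> z < int (length ys)"
  using assms by (auto simp: tape_of_def in_set_conv_nth nat_less_iff intro!: Nat.gr0I)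

lemma rd_upd [simp]: "rd (s(j := (f, h))) j = f h" "i \<noteq> j \<Longrightarrow> rd (s(j := v)) i = rd s i"
  by (simp_all add: rd_def)

lemma mv_upd [simp]: "mv j d (s(j := (f, h))) = s(j := (f, h + d))"
  "i \<noteq> j \<Longrightarrow> mv i d (s(j := v)) = (mv i d s)(j := v)"
  by (auto simp: mv_def)

lemma wr_upd [simp]: "wr j b d (s(j := (f, h))) = s(j := (f(h := b), h + d))"
  "i \<noteq> j \<Longrightarrow> wr i b d (s(j := v)) = (wr i b d s)(j := v)"
  by (auto simp: wr_def)

definition nonblank :: "nat set" where "nonblank = - {0}"

lemma nonblank_iff [simp]: "a \<in> nonblank \<longleftrightarrow> 0 < a" by (simp add: nonblank_def)

text \<open>The initial move to the left lets the program start on the blank behind the word as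
  well; the loop then stops on the blank in cell -1, also for an empty word.\<close>

definition rewind :: "nat \<Rightarrow> prog" where
  "rewind j = Seq (Mv j (-1)) (Seq (Whl j nonblank (Mv j (-1))) (Mv j 1))"

lemma runs_rewind:
  assumes "0 \<notin> set ys" "h \<le> length ys"
  shows "runs (rewind j) (s(j := (tape_of ys, int h))) (s(j := (tape_of ys, 0))) (3 * h + 3)"
proof -
  have "runs (Whl j nonblank (Mv j (-1))) (s(j := (tape_of ys, int h - 1 - int 0))) (s(j := (tape_of ys, int h - 1 - int h))) (h * (1 + 2) + 1)"
    by (rule runs_Whl[where \<sigma> = "\<lambda>i. s(j := (tape_of ys, int h - 1 - int i))"])
      (use assms in \<open>auto simp: tape_of_pos_iff intro!: runs_Mv\<close>)
  then have "runs (rewind j) (s(j := (tape_of ys, int h))) (s(j := (tape_of ys, 0))) (1 + ((h * (1 + 2) + 1) + 1))"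
    unfolding rewind_def by (intro runs_Seq) (auto intro!: runs_Mv)
  then show ?thesis by (rule runs_mono) simp
qed

fun seq_list :: "prog list \<Rightarrow> prog" where
  "seq_list [] = Skip"
| "seq_list (p # ps) = Seq p (seq_list ps)"

lemma wf_prog_seq_list [simp]: "wf_prog K G (seq_list ps) \<longleftrightarrow> (\<forall>p\<in>set ps. wf_prog K G p)"
  by (induction ps) auto

section \<open>Circuits and vertex covers\<close>

text \<open>Each set serves as its own vertex, numbered by \<open>set_encode\<close>, so that no
  variable set is computed twice. The graph is acyclic because both parts of a set are proper
  subsets of it, and the parts differ because they are disjoint and nonempty, which gives in-degree
  exactly 2.\<close>

lemma circuit_of_family:
  fixes F :: "nat set set" and l r :: "nat set \<Rightarrow> nat set"
  assumes fin: "finite F" "\<And>A. A \<in> F \<Longrightarrow> finite A"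
    and sing: "\<And>i. {i} \<in> F \<Longrightarrow> i \<in> {1..n}"
    and split: "\<And>A. A \<in> F \<Longrightarrow> \<not> is_singleton A \<Longrightarrow> l A \<in> F \<and> r A \<in> F \<and> l A \<noteq> {} \<and> r A \<noteq> {}
        \<and> l A \<inter> r A = {} \<and> A = l A \<union> r A"
  shows "\<exists>C. is_circuit n C \<and> var_set C ` verts C = F \<and>
    card (gates C) = card {A \<in> F. \<not> is_singleton A}"
proof -
  define C where "C = \<lparr>verts = set_encode ` F,
    edges = {(set_encode B, set_encode A) | A B. A \<in> F \<and> \<not> is_singleton A \<and> B \<in> {l A, r A}},
    input_var = (\<lambda>v. the_elem (set_decode v)), var_set = set_decode\<rparr>"
  have inj: "set_encode A = set_encode B \<longleftrightarrow> A = B" if "A \<in> F" "B \<in> F" for A B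
    using that fin by (metis set_encode_inverse)
  have dec: "set_decode (set_encode A) = A" if "A \<in> F" for A
    using that fin by simp
  have sp: "l A \<in> F" "r A \<in> F" "l A \<noteq> {}" "r A \<noteq> {}" "l A \<inter> r A = {}" "l A \<union> r A = A" "l A \<noteq> r A"
    if "A \<in> F" "\<not> is_singleton A" for A
    using split[OF that] by auto
  have preds: "preds C (set_encode A) = (if is_singleton A then {} else {set_encode (l A), set_encode (r A)})"
    if "A \<in> F" for A
    using that inj by (auto simp: preds_def C_def)
  have cardp: "card (preds C (set_encode A)) = (if is_singleton A then 0 else 2)" if "A \<in> F" for A
    using preds[OF that] sp[OF that] inj by auto
  have gts: "gates C = set_encode ` {A \<in> F. \<not> is_singleton A}"
    using cardp by (auto simp: gates_def C_def split: if_splits)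
  have ins: "inputs C = set_encode ` {A \<in> F. is_singleton A}"
    using cardp by (auto simp: inputs_def C_def split: if_splits)
  have "edges C \<subseteq> measure (\<lambda>v. card (set_decode v))"
  proof
    fix e assume "e \<in> edges C"
    then obtain A B where AB: "e = (set_encode B, set_encode A)" "A \<in> F" "\<not> is_singleton A" "B \<in> {l A, r A}"
      by (auto simp: C_def)
    then have "B \<in> F" "B \<subset> A" using sp[OF AB(2,3)] by auto
    then show "e \<in> measure (\<lambda>v. card (set_decode v))"
      using AB fin dec by (auto intro: psubset_card_mono)
  qed
  then have acyc: "acyclic (edges C)" by (meson wf_acyclic wf_measure wf_subset)
  have "is_circuit n C"
    unfolding is_circuit_def
  proof (intro conjI ballI allI impI)
    show "finite (verts C)" using fin by (simp add: C_def)
    show "edges C \<subseteq> verts C \<times> verts C" using sp by (auto simp: C_def)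
    show "verts C = inputs C \<union> gates C" unfolding gts ins by (auto simp: C_def)
    show "input_var C v \<in> {1..n}" "var_set C v = {input_var C v}" if v: "v \<in> inputs C" for v
    proof -
      obtain i where i: "v = set_encode {i}" "{i} \<in> F"
        using v unfolding ins by (auto simp: is_singleton_def simp del: set_encode_insert)
      then show "input_var C v \<in> {1..n}" "var_set C v = {input_var C v}"
        using sing dec[OF i(2)] unfolding i by (simp_all add: C_def del: set_encode_insert)
    qed
    fix v u w assume "v \<in> gates C" "preds C v = {u, w}"
    then obtain A where A: "A \<in> F" "\<not> is_singleton A" "v = set_encode A"
      "{set_encode (l A), set_encode (r A)} = {u, w}"
      unfolding gts using preds by auto
    then show "var_set C u \<inter> var_set C w = {}" "var_set C v = var_set C u \<union> var_set C w"
      using sp[OF A(1,2)] dec by (auto simp: C_def doubleton_eq_iff)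
  qed (rule acyc)
  moreover have "var_set C ` verts C = F" using dec by (force simp: C_def)
  moreover have "card (gates C) = card {A \<in> F. \<not> is_singleton A}"
    unfolding gts using inj by (intro card_image) (auto simp: inj_on_def)
  ultimately show ?thesis by blast
qed

text \<open>Nonemptiness ensures that a tree with three elements splits into parts with one and two
  elements, never into three and zero.\<close>

lemma circuit_var_set_nonempty:
  assumes C: "is_circuit n C" and v: "v \<in> verts C"
  shows "finite (var_set C v) \<and> var_set C v \<noteq> {}"
proof -
  have fin: "finite (verts C)" "edges C \<subseteq> verts C \<times> verts C" "acyclic (edges C)"
    using C by (auto simp: is_circuit_def)
  then have "finite (edges C)" by (meson finite_SigmaI finite_subset)
  then have "wf (edges C)" using fin by (simp add: finite_acyclic_wf)
  then show ?thesis using v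
  proof (induction v rule: wf_induct_rule)
    case (less v)
    consider "v \<in> inputs C" | "v \<in> gates C" using C less.prems by (auto simp: is_circuit_def)
    then show ?case
    proof cases
      case 1
      then show ?thesis using C by (simp add: is_circuit_def)
    next
      case 2
      then obtain u w where uw: "preds C v = {u, w}" by (auto simp: gates_def card_2_iff)
      then have "(u, v) \<in> edges C" "(w, v) \<in> edges C" by (auto simp: preds_def)
      then have "finite (var_set C u) \<and> var_set C u \<noteq> {}" "finite (var_set C w) \<and> var_set C w \<noteq> {}"
        using less.IH fin by blast+
      then show ?thesis using C 2 uw by (auto simp: is_circuit_def)
    qed
  qed
qed

text \<open>A predecessor is an input, with a singleton as variable set, or itself a gate. Hence a
  part with two elements belongs to a gate and is counted.\<close>

lemma gate_var_set_split:
  assumes C: "is_circuit n C" and v: "v \<in> gates C"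
  obtains A B where "var_set C v = A \<union> B" "A \<inter> B = {}" "finite A" "finite B" "A \<noteq> {}" "B \<noteq> {}"
    "is_singleton A \<or> A \<in> var_set C ` gates C" "is_singleton B \<or> B \<in> var_set C ` gates C"
proof -
  obtain u w where uw: "preds C v = {u, w}" using v by (auto simp: gates_def card_2_iff)
  then have "(u, v) \<in> edges C" "(w, v) \<in> edges C" by (auto simp: preds_def)
  then have m: "u \<in> verts C" "w \<in> verts C" using C by (auto simp: is_circuit_def)
  have "is_singleton (var_set C z) \<or> var_set C z \<in> var_set C ` gates C" if "z \<in> verts C" for z
    using that C by (auto simp: is_circuit_def is_singleton_def)
  then show ?thesis
    using that[of "var_set C u" "var_set C w"] m circuit_var_set_nonempty[OF C] C v uw
    by (auto simp: is_circuit_def)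
qed

lemma solution_iff_vertex_cover:
  fixes E :: "nat set set"
  assumes f: "abel_semigroup f"
    and E: "\<And>e. e \<in> E \<Longrightarrow> e \<subseteq> {2..n}" "\<And>e. e \<in> E \<Longrightarrow> card e = 1 \<or> card e = 2"
  shows "(\<exists>C. is_solution f n (insert 1 ` E) C \<and> card (gates C) \<le> m + card {e \<in> E. card e = 2}) \<longleftrightarrow>
    (\<exists>S. finite S \<and> card S \<le> m \<and> (\<forall>e\<in>E. S \<inter> e \<noteq> {}))" (is "?L \<longleftrightarrow> ?R")
proof -
  have finE: "finite E" by (rule finite_subset[of _ "Pow {2..n}"]) (use E(1) in auto)
  have fe: "finite e" if "e \<in> E" for e using E(1)[OF that] finite_subset by blast
  have n1: "1 \<notin> e" if "e \<in> E" for e using E(1)[OF that] by auto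
  have inj1: "inj_on (insert 1) E" using n1 unfolding inj_on_def by (metis insert_ident)
  define E2 where "E2 = {e \<in> E. card e = 2}"
  show ?thesis
  proof
    assume ?L
    then obtain C where C: "is_solution f n (insert 1 ` E) C" "card (gates C) \<le> m + card E2"
      by (auto simp: E2_def)
    then have circ: "is_circuit n C" by (simp add: is_solution_def)
    have fing: "finite (gates C)"
      using circ by (auto simp: is_circuit_def gates_def)
    define G where "G = var_set C ` gates C"
    have finG: "finite G" using fing by (simp add: G_def)
    have treeG: "insert 1 e \<in> G" if e: "e \<in> E" for e
    proof -
      obtain v where v: "v \<in> verts C" "var_set C v = insert 1 e"
        using C e by (auto simp: is_solution_def)
      have "card (insert 1 e) \<ge> 2" using E(2)[OF e] n1[OF e] fe[OF e] by auto
      moreover have "card (var_set C v) = 1" if "v \<in> inputs C"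
        using circ that by (simp add: is_circuit_def)
      ultimately have "v \<notin> inputs C" using v by auto
      then have "v \<in> gates C" using circ v unfolding is_circuit_def by blast
      then show ?thesis using v(2) unfolding G_def by (metis imageI)
    qed
    define G2 where "G2 = {A \<in> G. card A = 2}"
    \<comment> \<open>\<open>Min (A - {1})\<close> treats both kinds of two-element gates alike: it
      is \<open>v\<close> for \<open>{1, v}\<close> and the smaller endpoint for
      \<open>{u, v}\<close>.\<close>
    define S where "S = (\<lambda>A. Min (A - {1})) ` G2"
    have "card S \<le> card G2" unfolding S_def using finG by (intro card_image_le) (simp add: G2_def)
    \<comment> \<open>Trees of proper edges have three elements, so they are disjoint from
      \<open>G2\<close>; both together occupy distinct gates.\<close>
    moreover have "card G2 + card E2 \<le> card G"
    proof -
      have "card (insert 1 e) = 3" if "e \<in> E2" for e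
        using that fe n1 by (auto simp: E2_def)
      then have "G2 \<inter> insert 1 ` E2 = {}" by (fastforce simp: G2_def)
      moreover have "card (insert 1 ` E2) = card E2"
        by (rule card_image) (use inj1 in \<open>auto simp: E2_def inj_on_def\<close>)
      moreover have "G2 \<union> insert 1 ` E2 \<subseteq> G" using treeG by (auto simp: G2_def E2_def)
      moreover have "finite G2" "finite (insert 1 ` E2)" using finG finE by (auto simp: G2_def E2_def)
      ultimately show ?thesis
        using card_mono[OF finG, of "G2 \<union> insert 1 ` E2"] by (simp add: card_Un_disjoint)
    qed
    moreover have "card G \<le> card (gates C)" unfolding G_def using fing by (rule card_image_le)
    ultimately have "card S \<le> m" using C(2) by linarith
    moreover have "S \<inter> e \<noteq> {}" if e: "e \<in> E" for e
    proof -
      \<comment> \<open>For a loop the tree itself has two elements. For a proper edge the gate of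
        the tree splits 3 as 1 + 2, and the part of size 2 is a gate.\<close>
      have "\<exists>A\<in>G2. A \<subseteq> insert 1 e"
      proof (cases "card e = 2")
        case False
        then have "card (insert 1 e) = 2" using E(2)[OF e] n1[OF e] fe[OF e] by auto
        then show ?thesis using treeG[OF e] by (auto simp: G2_def)
      next
        case True
        then have c3: "card (insert 1 e) = 3" using n1[OF e] fe[OF e] by auto
        obtain v where v: "v \<in> gates C" "var_set C v = insert 1 e"
          using treeG[OF e] by (auto simp: G_def)
        obtain A B where AB: "insert 1 e = A \<union> B" "A \<inter> B = {}" "finite A" "finite B" "A \<noteq> {}" "B \<noteq> {}"
          "is_singleton A \<or> A \<in> G" "is_singleton B \<or> B \<in> G"
          using gate_var_set_split[OF circ v(1)] v(2) unfolding G_def by metis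
        have "card A + card B = 3" using AB c3 by (metis card_Un_disjoint)
        moreover have "card A \<ge> 1" "card B \<ge> 1" using AB by (simp_all add: Suc_le_eq card_gt_0_iff)
        ultimately have "card A = 2 \<or> card B = 2" by linarith
        then show ?thesis
        proof
          assume "card A = 2"
          then have "A \<in> G2" using AB(7) by (auto simp: G2_def is_singleton_altdef)
          then show ?thesis using AB(1) by blast
        next
          assume "card B = 2"
          then have "B \<in> G2" using AB(8) by (auto simp: G2_def is_singleton_altdef)
          then show ?thesis using AB(1) by blast
        qed
      qed
      then obtain A where A: "A \<in> G2" "A \<subseteq> insert 1 e" by blast
      have fA: "finite A" "card A = 2" using A by (auto simp: G2_def intro: card_ge_0_finite)
      have "A - {1} \<noteq> {}"
      proof
        assume "A - {1} = {}"
        then have "card A \<le> card {1 :: nat}" by (intro card_mono) auto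
        then show False using fA by simp
      qed
      then have "Min (A - {1}) \<in> A - {1}" using fA by (intro Min_in) auto
      then have "Min (A - {1}) \<in> S \<inter> e" using A by (auto simp: S_def)
      then show ?thesis by blast
    qed
    moreover have "finite S" using finG by (simp add: S_def G2_def)
    ultimately show ?R by blast
  next
    assume ?R
    then obtain S0 where S0: "finite S0" "card S0 \<le> m" "\<forall>e\<in>E. S0 \<inter> e \<noteq> {}" by blast
    define S where "S = S0 \<inter> {2..n}"
    have S: "finite S" "card S \<le> m" "S \<subseteq> {2..n}"
      using S0 card_mono[of S0 S] by (auto simp: S_def)
    have cov: "S \<inter> e \<noteq> {}" if "e \<in> E" for e using S0 E(1)[OF that] that by (auto simp: S_def)
    \<comment> \<open>For the tree \<open>insert 1 e\<close> the chosen element lies in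
      \<open>e\<close>, because \<open>S\<close> does not contain 1. The tree is then built from
      \<open>{1, v}\<close> and the other endpoint.\<close>
    define pr where "pr A = {1, SOME v. v \<in> S \<and> v \<in> A}" for A :: "nat set"
    define F1 where "F1 = (\<lambda>i. {i}) ` {1..n}"
    define F2 where "F2 = (\<lambda>v. {1, v}) ` S"
    define F3 where "F3 = insert 1 ` E2"
    define l where "l A = (if card A = 2 then {1} else pr A)" for A :: "nat set"
    have c1: "is_singleton A" if "A \<in> F1" for A using that by (auto simp: F1_def)
    have c2: "card A = 2" if "A \<in> F2" for A using that S by (auto simp: F2_def)
    have c3: "card A = 3" if "A \<in> F3" for A using that fe n1 by (auto simp: F3_def E2_def)
    have ns: "\<not> is_singleton A" if "A \<in> F2 \<union> F3" for A
      using that c2 c3 by (auto simp: is_singleton_altdef)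
    have one: "{v} \<in> F1" if "v \<in> {1..n}" for v using that by (auto simp: F1_def)
    have "\<exists>C. is_circuit n C \<and> var_set C ` verts C = F1 \<union> F2 \<union> F3 \<and>
      card (gates C) = card {A \<in> F1 \<union> F2 \<union> F3. \<not> is_singleton A}"
    proof (rule circuit_of_family[where l = l and r = "\<lambda>A. A - l A"])
      show "finite (F1 \<union> F2 \<union> F3)" using S finE by (simp add: F1_def F2_def F3_def E2_def)
      show "finite A" if "A \<in> F1 \<union> F2 \<union> F3" for A
        using that fe by (auto simp: F1_def F2_def F3_def E2_def)
      show "i \<in> {1..n}" if "{i} \<in> F1 \<union> F2 \<union> F3" for i
        using that ns by (auto simp: F1_def)
      fix A assume A: "A \<in> F1 \<union> F2 \<union> F3" "\<not> is_singleton A"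
      then consider "A \<in> F2" | "A \<in> F3" using c1 by blast
      then show "l A \<in> F1 \<union> F2 \<union> F3 \<and> A - l A \<in> F1 \<union> F2 \<union> F3 \<and> l A \<noteq> {} \<and> A - l A \<noteq> {} \<and>
        l A \<inter> (A - l A) = {} \<and> A = l A \<union> (A - l A)"
      proof cases
        case 1
        then obtain v where v: "A = {1, v}" "v \<in> {2..n}" "v \<noteq> 1" using S by (auto simp: F2_def)
        then have "l A = {1}" "A - l A = {v}" using c2[OF 1] by (auto simp: l_def)
        then show ?thesis using v one[of v] one[of 1] by auto
      next
        case 2
        then obtain e where e: "e \<in> E" "card e = 2" "A = insert 1 e" by (auto simp: F3_def E2_def)
        define v where "v = (SOME v. v \<in> S \<and> v \<in> A)"
        have "\<exists>v. v \<in> S \<and> v \<in> A" using cov[OF e(1)] e by auto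
        then have v: "v \<in> S" "v \<in> A" unfolding v_def by (metis (mono_tags, lifting) someI_ex)+
        then have ve: "v \<in> e" using S e by auto
        have lA: "l A = {1, v}" using c3[OF 2] by (simp add: l_def pr_def v_def)
        obtain u where u: "e = {u, v}" "u \<noteq> v" using e(2) ve unfolding card_2_iff by auto
        then have "A - l A = {u}" using lA e n1[OF e(1)] by auto
        moreover have "u \<in> {1..n}" using E(1)[OF e(1)] u by auto
        moreover have "l A \<in> F2" using lA v by (auto simp: F2_def)
        ultimately show ?thesis using one[of u] lA v e by auto
      qed
    qed
    then obtain C where C: "is_circuit n C" "var_set C ` verts C = F1 \<union> F2 \<union> F3"
      "card (gates C) = card {A \<in> F1 \<union> F2 \<union> F3. \<not> is_singleton A}" by blast
    have "{A \<in> F1 \<union> F2 \<union> F3. \<not> is_singleton A} = F2 \<union> F3" using c1 ns by auto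
    then have "card (gates C) \<le> card F2 + card F3" using C card_Un_le by metis
    also have "\<dots> \<le> m + card E2"
    proof (rule add_mono)
      show "card F2 \<le> m" using card_image_le[OF S(1), of "\<lambda>v. {1, v}"] S unfolding F2_def by linarith
      show "card F3 \<le> card E2" unfolding F3_def by (rule card_image_le) (simp add: E2_def finE)
    qed
    finally have "card (gates C) \<le> m + card E2" .
    moreover have "insert 1 e \<in> F2 \<union> F3" if e: "e \<in> E" for e
    proof (cases "card e = 2")
      case False
      then obtain v where "e = {v}" using E(2)[OF e] by (auto simp: card_1_singleton_iff)
      then show ?thesis using cov[OF e] by (auto simp: F2_def)
    qed (use e in \<open>auto simp: F3_def E2_def\<close>)
    then have "\<exists>v\<in>verts C. var_set C v = T \<and> vertex_computes f C v T" if "T \<in> insert 1 ` E" for T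
    proof -
      assume a: "\<And>e. e \<in> E \<Longrightarrow> insert 1 e \<in> F2 \<union> F3"
      have "T \<in> var_set C ` verts C" using that a unfolding C(2) by auto
      then show ?thesis using circuit_computes[OF f C(1)] by blast
    qed
    then have "is_solution f n (insert 1 ` E) C" using C(1) by (simp add: is_solution_def)
    ultimately show ?L unfolding E2_def by blast
  qed
qed

section \<open>Vertex covers and tilings\<close>

text \<open>Numbering starts at 2 because 1 is the variable common to all trees; the tiles of one
  cell are consecutive, as they are in the printed incidence vectors.\<close>

definition vertex :: "nat \<Rightarrow> nat \<Rightarrow> nat \<Rightarrow> nat" where
  "vertex g c a = 2 + c * g + a"

lemma vertex_eq_iff:
  assumes "a < g" "b < g"
  shows "vertex g c a = vertex g d b \<longleftrightarrow> c = d \<and> a = b"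
proof
  assume "vertex g c a = vertex g d b"
  then have *: "a + c * g = b + d * g" by (simp add: vertex_def)
  then have "(a + c * g) div g = (b + d * g) div g" "(a + c * g) mod g = (b + d * g) mod g" by simp_all
  then show "c = d \<and> a = b" using assms by simp
qed simp

lemma vertex_less:
  assumes "a < g" "c < d"
  shows "vertex g c a < vertex g d b"
proof -
  have "c * g + a < Suc c * g" using assms by simp
  also have "\<dots> \<le> d * g" using assms by (intro mult_le_mono1) simp
  finally show ?thesis by (simp add: vertex_def)
qed

text \<open>The index \<open>r < 3\<close> selects the kind of constraint: on one cell, on horizontal neighbours, and on
  vertical neighbours.\<close>

definition offset :: "nat \<Rightarrow> nat \<Rightarrow> nat" where
  "offset D r = (if r = 0 then 0 else if r = 1 then 1 else D)"

text \<open>With rows of length at least 2 the three kinds of constraints differ in the distance of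
  their cells, so no edge arises from two kinds.\<close>

lemma offset_inj: "2 \<le> D \<Longrightarrow> r < 3 \<Longrightarrow> r' < 3 \<Longrightarrow> offset D r = offset D r' \<longleftrightarrow> r = r'"
  by (auto simp: offset_def)

text \<open>A list and not a set, in the order in which the program runs through kinds, cells and
  pairs of tiles; its length is what the program counts.\<close>

definition quads :: "nat \<Rightarrow> nat \<Rightarrow> nat \<Rightarrow> (nat \<Rightarrow> nat \<Rightarrow> nat \<Rightarrow> nat \<Rightarrow> bool) \<Rightarrow> (nat \<times> nat \<times> nat \<times> nat) list" where
  "quads N g D Q = concat (map (\<lambda>r. concat (map (\<lambda>c.
     map (\<lambda>(a, b). (r, c, a, b)) (filter (\<lambda>(a, b). Q r c a b) (List.product [0..<g] [0..<g])))
     [0..<N - offset D r])) [0, 1, 2])"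

lemma set_quads:
  "set (quads N g D Q) = {(r, c, a, b). r < 3 \<and> c + offset D r < N \<and> a < g \<and> b < g \<and> Q r c a b}"
proof -
  have *: "r < 3 \<longleftrightarrow> r = 0 \<or> r = 1 \<or> r = (2::nat)" for r by auto
  show ?thesis unfolding quads_def * by (auto simp: less_diff_conv)
qed

lemma distinct_quads: "distinct (quads N g D Q)"
proof -
  define P where "P r c = map (\<lambda>(a, b). (r, c, a, b)) (filter (\<lambda>(a, b). Q r c a b) (List.product [0..<g] [0..<g]))"
    for r c
  define R where "R r = concat (map (P r) [0..<N - offset D r])" for r
  have P: "distinct (P r c)" for r c
    unfolding P_def distinct_map by (auto intro!: inj_onI distinct_filter distinct_product)
  have Pd: "x \<in> set (P r c) \<Longrightarrow> fst x = r \<and> fst (snd x) = c" for x r c by (auto simp: P_def)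
  \<comment> \<open>Several blocks may be empty, whereas \<open>distinct_concat\<close> wants the
    blocks pairwise different; dropping the empty ones does not change the concatenation.\<close>
  have R': "distinct (concat (map (P r) (filter (\<lambda>c. P r c \<noteq> []) [0..<m])))" for r m
  proof (rule distinct_concat)
    show "distinct (map (P r) (filter (\<lambda>c. P r c \<noteq> []) [0..<m]))"
      unfolding distinct_map
    proof (intro conjI inj_onI)
      fix c c' assume *: "c \<in> set (filter (\<lambda>c. P r c \<noteq> []) [0..<m])" "P r c = P r c'"
      then have "hd (P r c) \<in> set (P r c)" "hd (P r c) \<in> set (P r c')" by auto
      then show "c = c'" using Pd by metis
    qed simp
  qed (use P Pd in \<open>auto, metis+\<close>)
  have e: "concat (map p xs) = concat (map p (filter (\<lambda>c. p c \<noteq> []) xs))" for p :: "nat \<Rightarrow> 'a list" and xs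
    by (induction xs) auto
  have R: "distinct (R r)" for r using R' e[of "P r"] unfolding R_def by metis
  have Rd: "x \<in> set (R r) \<Longrightarrow> fst x = r" for x r by (auto simp: R_def dest: Pd)
  have "distinct (R 0 @ R 1 @ R 2)" using R Rd by (fastforce dest: Rd)
  then show ?thesis unfolding quads_def R_def P_def by simp
qed

text \<open>For \<open>r = 0\<close> the pairs \<open>a < b\<close> make all vertices of a cell
  adjacent, and \<open>a = b\<close> is a loop at a tile that the type \<open>y\<close>
  excludes.\<close>

definition conflict :: "(nat \<Rightarrow> nat \<Rightarrow> bool) \<Rightarrow> (nat \<Rightarrow> nat \<Rightarrow> bool) \<Rightarrow> (nat \<Rightarrow> nat \<Rightarrow> bool) \<Rightarrow> nat \<Rightarrow> nat \<Rightarrow> nat \<Rightarrow> nat \<Rightarrow> bool" where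
  "conflict U H V y r a b \<longleftrightarrow> (if r = 0 then a < b \<or> a = b \<and> \<not> U y a else if r = 1 then \<not> H a b else \<not> V a b)"

text \<open>The pairs with \<open>a = b\<close> contribute \<open>g - 1\<close> per cell, the size of the vertex cover.\<close>

definition counted :: "(nat \<Rightarrow> nat \<Rightarrow> bool) \<Rightarrow> (nat \<Rightarrow> nat \<Rightarrow> bool) \<Rightarrow> nat \<Rightarrow> nat \<Rightarrow> nat \<Rightarrow> bool" where
  "counted H V r a b \<longleftrightarrow> (if r = 0 then a < b \<or> a = b \<and> a \<noteq> 0 else if r = 1 then \<not> H a b else \<not> V a b)"

definition tree_of :: "nat \<Rightarrow> nat \<Rightarrow> nat \<times> nat \<times> nat \<times> nat \<Rightarrow> nat set" where
  "tree_of g D = (\<lambda>(r, c, a, b). {1, vertex g c a, vertex g (c + offset D r) b})"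

text \<open>The type is taken at the second cell of the pair because the head of tape 3 stands
  there; \<open>conflict\<close> consults it only for \<open>r = 0\<close>, where both cells
  coincide.\<close>

definition tiling_trees where
  "tiling_trees U H V g D w =
     map (tree_of g D) (quads (length w) g D (\<lambda>r c. conflict U H V (w ! (c + offset D r)) r))"

definition tiling_bound where
  "tiling_bound H V N g D = length (quads N g D (\<lambda>r c. counted H V r))"

definition tileable where
  "tileable U H V g D w \<longleftrightarrow> (\<exists>s. \<forall>c<length w. s c < g \<and> U (w ! c) (s c) \<and>
     (c + 1 < length w \<longrightarrow> H (s c) (s (c + 1))) \<and> (c + D < length w \<longrightarrow> V (s c) (s (c + D))))"

text \<open>The variables are 1 and the \<open>length w * g\<close> vertices from 2 on, whence the
  value of \<open>n\<close>.\<close>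

lemma tiling_trees_iff:
  assumes f: "abel_semigroup f" and g: "0 < g" and D: "2 \<le> D" and n: "n = Suc (length w * g)"
  shows "(\<exists>C. is_solution f n (set (tiling_trees U H V g D w)) C \<and>
      card (gates C) \<le> tiling_bound H V (length w) g D) \<longleftrightarrow> tileable U H V g D w"
proof -
  define N where "N = length w"
  define J where "J = set (quads N g D (\<lambda>r c. conflict U H V (w ! (c + offset D r)) r))"
  define J2 where "J2 = {(r, c, a, b) \<in> J. \<not> (r = 0 \<and> a = b)}"
  define ed where "ed = (\<lambda>(r, c, a, b). {vertex g c a, vertex g (c + offset D r) b})"
  define E where "E = ed ` J"
  have J: "r < 3 \<and> c + offset D r < N \<and> a < g \<and> b < g \<and> conflict U H V (w ! (c + offset D r)) r a b"
    if "(r, c, a, b) \<in> J" for r c a b using that by (auto simp: J_def set_quads)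
  \<comment> \<open>Proper edges have increasing endpoints, so the unordered pair determines the
    quadruple. This gives injectivity of \<open>ed\<close> on \<open>J2\<close>.\<close>
  have le: "vertex g c a < vertex g (c + offset D r) b" if "(r, c, a, b) \<in> J2" for r c a b
  proof (cases "r = 0")
    case True
    then show ?thesis using that J[of r c a b] by (auto simp: J2_def conflict_def offset_def vertex_def)
  next
    case False
    then show ?thesis using that J[of r c a b] D by (intro vertex_less) (auto simp: J2_def offset_def)
  qed
  have vrange: "vertex g c a \<in> {2..n}" if "c < N" "a < g" for c a
    using vertex_less[of a g c N 0] that n by (auto simp: vertex_def N_def)
  have trees: "set (tiling_trees U H V g D w) = insert 1 ` E"
  proof -
    have "tree_of g D j = insert 1 (ed j)" for j by (cases j) (simp add: tree_of_def ed_def)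
    then show ?thesis by (simp add: tiling_trees_def E_def J_def N_def image_image)
  qed
  have E1: "e \<subseteq> {2..n}" if "e \<in> E" for e
    using that vrange by (auto simp: E_def ed_def dest!: J)
  have E2: "card e = 1 \<or> card e = 2" if "e \<in> E" for e
    using that by (auto simp: E_def ed_def card_insert_if split: if_splits)
  have card2: "card (ed j) = 2 \<longleftrightarrow> j \<in> J2" if "j \<in> J" for j
  proof -
    obtain r c a b where j: "j = (r, c, a, b)" by (cases j)
    show ?thesis using that le[of r c a b] by (auto simp: j ed_def J2_def offset_def card_insert_if vertex_def)
  qed
  have inj: "inj_on ed J2"
  proof (rule inj_onI)
    fix j j' assume jj: "j \<in> J2" "j' \<in> J2" "ed j = ed j'"
    obtain r c a b r' c' a' b' where s: "j = (r, c, a, b)" "j' = (r', c', a', b')" by (metis surj_pair)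
    have j: "(r, c, a, b) \<in> J2" "(r', c', a', b') \<in> J2"
      and eq: "ed (r, c, a, b) = ed (r', c', a', b')" using jj s by auto
    have "vertex g c a = vertex g c' a' \<and> vertex g (c + offset D r) b = vertex g (c' + offset D r') b'"
      using eq le[OF j(1)] le[OF j(2)] by (auto simp: ed_def doubleton_eq_iff)
    then show "j = j'"
      using s j J[of r c a b] J[of r' c' a' b'] D by (auto simp: J2_def vertex_eq_iff offset_inj)
  qed
  have cE2: "card {e \<in> E. card e = 2} = card J2"
  proof -
    have "{e \<in> E. card e = 2} = ed ` J2" using card2 by (auto simp: E_def J2_def)
    then show ?thesis using card_image[OF inj] by simp
  qed
  have bound: "tiling_bound H V (length w) g D = N * (g - 1) + card J2"
  proof -
    define K where "K = (\<lambda>(c, a). (0 :: nat, c, a, a)) ` ({..<N} \<times> {1..<g})"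
    have "set (quads N g D (\<lambda>r c. counted H V r)) = K \<union> J2"
      by (auto simp: K_def set_quads J2_def J_def conflict_def counted_def offset_def image_iff split: if_splits)
    moreover have "K \<inter> J2 = {}" by (auto simp: K_def J2_def)
    moreover have "card K = N * (g - 1)"
      unfolding K_def by (subst card_image) (auto simp: inj_on_def)
    moreover have "finite K" "finite J2"
      by (auto simp: K_def J2_def J_def intro: finite_subset[of _ "set _"])
    ultimately show ?thesis
      unfolding tiling_bound_def N_def[symmetric]
      using distinct_card[OF distinct_quads, of N g D "\<lambda>r c. counted H V r"] by (simp add: card_Un_disjoint)
  qed
  have "(\<exists>S. finite S \<and> card S \<le> N * (g - 1) \<and> (\<forall>e\<in>E. S \<inter> e \<noteq> {})) \<longleftrightarrow> tileable U H V g D w" (is "?L \<longleftrightarrow> _")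
  proof
    assume ?L
    then obtain S where S: "finite S" "card S \<le> N * (g - 1)" "\<And>e. e \<in> E \<Longrightarrow> S \<inter> e \<noteq> {}" by blast
    have cov: "vertex g c a \<in> S \<or> vertex g (c + offset D r) b \<in> S"
      if "r < 3" "c + offset D r < N" "a < g" "b < g" "conflict U H V (w ! (c + offset D r)) r a b" for r c a b
    proof -
      have "ed (r, c, a, b) \<in> E" using that by (auto simp: E_def J_def set_quads)
      then show ?thesis using S(3) by (force simp: ed_def)
    qed
    define Sc where "Sc c = {a. a < g \<and> vertex g c a \<in> S}" for c
    have fSc: "finite (Sc c)" "Sc c \<subseteq> {..<g}" for c by (auto simp: Sc_def)
    \<comment> \<open>Two omitted tiles of one cell would leave the edge between them
      uncovered.\<close>
    have ge: "g - 1 \<le> card (Sc c)" if "c < N" for c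
    proof (cases "Sc c = {..<g}")
      case False
      then obtain a where a: "a < g" "a \<notin> Sc c" using fSc by blast
      have "b \<in> Sc c" if b: "b < g" "b \<noteq> a" for b
        using cov[of 0 c a b] cov[of 0 c b a] a b \<open>c < N\<close>
        by (cases "a < b") (auto simp: conflict_def Sc_def offset_def)
      then have "{..<g} - {a} \<subseteq> Sc c" by auto
      then show ?thesis using card_mono[OF fSc(1), of "{..<g} - {a}" c] a by simp
    qed simp
    have le': "(\<Sum>c<N. card (Sc c)) \<le> N * (g - 1)"
    proof -
      have "(\<Sum>c<N. card (Sc c)) = card (SIGMA c:{..<N}. Sc c)"
        by (simp add: fSc)
      also have "\<dots> = card ((\<lambda>(c, a). vertex g c a) ` (SIGMA c:{..<N}. Sc c))"
        by (rule card_image[symmetric]) (auto simp: inj_on_def Sc_def vertex_eq_iff)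
      also have "\<dots> \<le> card S" by (rule card_mono) (auto simp: S Sc_def)
      finally show ?thesis using S(2) by linarith
    qed
    \<comment> \<open>Every cell contributes at least \<open>g - 1\<close>; a cell with all its
      vertices in \<open>S\<close> would push the sum strictly above the budget.\<close>
    have ex: "\<exists>a<g. vertex g c a \<notin> S" if c: "c < N" for c
    proof (rule ccontr)
      assume "\<not> (\<exists>a<g. vertex g c a \<notin> S)"
      then have "Sc c = {..<g}" by (auto simp: Sc_def)
      then have "g - 1 < card (Sc c)" using g by simp
      then have "(\<Sum>c<N. g - 1) < (\<Sum>c<N. card (Sc c))"
        using ge c by (intro sum_strict_mono_ex1) auto
      then show False using le' by simp
    qed
    define s where "s c = (SOME a. a < g \<and> vertex g c a \<notin> S)" for c
    have s: "s c < g" "vertex g c (s c) \<notin> S" if "c < N" for c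
      using someI_ex[OF ex[OF that, unfolded Bex_def]] by (auto simp: s_def)
    have "s c < g \<and> U (w ! c) (s c) \<and> (c + 1 < N \<longrightarrow> H (s c) (s (c + 1))) \<and> (c + D < N \<longrightarrow> V (s c) (s (c + D)))"
      if c: "c < N" for c
      using s[OF c] s[of "c + 1"] s[of "c + D"] cov[of 0 c "s c" "s c"] cov[of 1 c "s c" "s (c + 1)"]
        cov[of 2 c "s c" "s (c + D)"] c by (auto simp: conflict_def offset_def)
    then show "tileable U H V g D w" unfolding tileable_def N_def by blast
  next
    assume "tileable U H V g D w"
    then obtain s where s: "\<And>c. c < N \<Longrightarrow> s c < g \<and> U (w ! c) (s c) \<and>
      (c + 1 < N \<longrightarrow> H (s c) (s (c + 1))) \<and> (c + D < N \<longrightarrow> V (s c) (s (c + D)))"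
      unfolding tileable_def N_def by blast
    define S where "S = (\<lambda>(c, a). vertex g c a) ` (SIGMA c:{..<N}. {..<g} - {s c})"
    have "card S \<le> card (SIGMA c:{..<N}. {..<g} - {s c})" unfolding S_def by (rule card_image_le) simp
    also have "\<dots> = (\<Sum>c<N. card ({..<g} - {s c}))" by simp
    also have "\<dots> = (\<Sum>c<N. g - 1)" using s by (intro sum.cong) auto
    finally have "card S \<le> N * (g - 1)" by simp
    moreover have "finite S" by (simp add: S_def)
    moreover have "S \<inter> e \<noteq> {}" if e: "e \<in> E" for e
    proof -
      obtain r c a b where j: "(r, c, a, b) \<in> J" "e = {vertex g c a, vertex g (c + offset D r) b}"
        using e by (auto simp: E_def ed_def)
      have inS: "vertex g c a \<in> S" if "c < N" "a < g" "a \<noteq> s c" for c a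
        using that by (force simp: S_def)
      have "a \<noteq> s c \<or> b \<noteq> s (c + offset D r)"
        using J[OF j(1)] s[of c] by (auto simp: conflict_def offset_def split: if_splits)
      then show ?thesis using J[OF j(1)] j(2) inS[of c a] inS[of "c + offset D r" b] by auto
    qed
    ultimately show ?L by blast
  qed
  then show ?thesis
    unfolding trees bound cE2[symmetric] using solution_iff_vertex_cover[OF f E1 E2] by simp
qed

section \<open>Writing out an instance\<close>

lemma runs_conv: "runs p s t B \<Longrightarrow> t = t' \<Longrightarrow> B \<le> B' \<Longrightarrow> runs p s t' B'"
  using runs_mono by blast

text \<open>
  Tapes 2 and 3 hold the word \<open>w\<close> of cell types, tape 6 a binary counter (least significant bit
  first), tape \<open>ou\<close> the output. Tapes 4 and 5 carry a single mark at position 0 and serve as pointers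
  into \<open>w\<close>: if the head of tape 2 is at \<open>j\<close>, their heads are at \<open>j - c\<close> and \<open>j - d\<close>, so that the mark of
  tape 4 is seen exactly if \<open>j = c\<close>, and the pointer is advanced by moving one head to the left.
\<close>

definition main_store :: "nat \<Rightarrow> store \<Rightarrow> nat list \<Rightarrow> int \<Rightarrow> nat \<Rightarrow> nat \<Rightarrow> nat \<Rightarrow> nat \<Rightarrow> nat \<Rightarrow> bool list \<Rightarrow> store" where
  "main_store ou s w j c d y k i os = s(2 := (tape_of w, j), 3 := (tape_of w, int y), 4 := (tape_of [1], j - int c),
     5 := (tape_of [1], j - int d), 6 := (tape_of (map bit_symbol (binary k)), int i),
     ou := (tape_of (map bit_symbol os), int (length os)))"

definition emit :: "nat \<Rightarrow> bool \<Rightarrow> prog" where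
  "emit ou b = Wr ou (bit_symbol b) 1"

definition emits :: "nat \<Rightarrow> bool list \<Rightarrow> prog" where
  "emits ou bs = seq_list (map (emit ou) bs)"

lemma tape_of_map_append: "(tape_of (map h os))(int (length os) := h b) = tape_of (map h (os @ [b]))"
  using tape_of_append[of "map h os" "h b"] by simp

lemma runs_emit: "runs (emit ou b) (main_store ou s w j c d y k i os) (main_store ou s w j c d y k i (os @ [b])) 1"
  unfolding emit_def main_store_def by (rule runs_Wr) (simp_all add: tape_of_map_append add.commute del: map_append)

lemma runs_emits:
  "runs (emits ou bs) (main_store ou s w j c d y k i os) (main_store ou s w j c d y k i (os @ bs)) (length bs)"
proof (induction bs arbitrary: os)
  case Nil
  then show ?case by (simp add: emits_def runs_Skip)
next
  case (Cons b bs)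
  have "runs (emits ou (b # bs)) (main_store ou s w j c d y k i os) (main_store ou s w j c d y k i ((os @ [b]) @ bs)) (1 + length bs)"
    unfolding emits_def list.map seq_list.simps by (rule runs_Seq[OF runs_emit Cons.IH[unfolded emits_def]])
  then show ?case by simp
qed

definition step_heads :: "int \<Rightarrow> prog" where
  "step_heads e = Seq (Mv 2 e) (Seq (Mv 4 e) (Mv 5 e))"

lemma runs_step_heads:
  assumes "6 < ou" "j' = j + e"
  shows "runs (step_heads e) (main_store ou s w j c d y k i os) (main_store ou s w j' c d y k i os) 3"
proof -
  have "runs (step_heads e) (main_store ou s w j c d y k i os) (main_store ou s w j' c d y k i os) (1 + (1 + 1))"
    unfolding step_heads_def using assms
    by (intro runs_Seq) (rule runs_Mv[OF refl], simp, rule runs_Mv[OF refl], simp, rule runs_Mv,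
      auto simp: main_store_def fun_eq_iff mv_def)
  then show ?thesis by (simp add: eval_nat_numeral)
qed

lemma rd_main_store:
  assumes "6 < ou"
  shows "rd (main_store ou s w j c d y k i os) 2 = tape_of w j" "rd (main_store ou s w j c d y k i os) 3 = tape_of w (int y)"
    "rd (main_store ou s w j c d y k i os) 4 = (if j = int c then 1 else 0)"
    "rd (main_store ou s w j c d y k i os) 5 = (if j = int d then 1 else 0)"
    "rd (main_store ou s w j c d y k i os) 6 = tape_of (map bit_symbol (binary k)) (int i)"
  using assms by (auto simp: main_store_def rd_def tape_of_def)

section \<open>Printing incidence vectors by sweeping over the word\<close>

definition sweep :: "prog \<Rightarrow> prog" where
  "sweep p = Whl 2 nonblank (Seq p (step_heads 1))"

lemma runs_sweep:
  assumes ou: "6 < ou" and w: "0 \<notin> set w"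
    and p: "\<And>j os. j < length w \<Longrightarrow>
      runs p (main_store ou s w (int j) c d y k i os) (main_store ou s w (int j) c d y k i (os @ \<phi> j)) B"
  shows "runs (sweep p) (main_store ou s w 0 c d y k i os)
    (main_store ou s w (int (length w)) c d y k i (os @ concat (map \<phi> [0..<length w]))) (length w * (B + 5) + 1)"
proof -
  let ?\<sigma> = "\<lambda>j. main_store ou s w (int j) c d y k i (os @ concat (map \<phi> [0..<j]))"
  have "runs (sweep p) (?\<sigma> 0) (?\<sigma> (length w)) (length w * (B + 3 + 2) + 1)"
    unfolding sweep_def
  proof (rule runs_Whl[where \<sigma> = ?\<sigma>], intro conjI)
    fix j assume j: "j < length w"
    show "rd (?\<sigma> j) 2 \<in> nonblank" using w j by (simp add: rd_main_store[OF ou] tape_of_pos_iff del: tape_of_nth)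
    show "runs (Seq p (step_heads 1)) (?\<sigma> j) (?\<sigma> (Suc j)) (B + 3)"
      by (rule runs_conv[OF runs_Seq[OF p[OF j] runs_step_heads[OF ou refl]]]) (simp_all add: add.commute)
  qed (simp add: rd_main_store[OF ou])
  then show ?thesis by (simp add: ac_simps)
qed

definition return_heads :: prog where
  "return_heads = Seq (step_heads (-1)) (Seq (Whl 2 nonblank (step_heads (-1))) (step_heads 1))"

lemma runs_return_heads:
  assumes ou: "6 < ou" and w: "0 \<notin> set w"
  shows "runs return_heads (main_store ou s w (int (length w)) c d y k i os) (main_store ou s w 0 c d y k i os) (length w * 5 + 7)"
proof -
  let ?\<sigma> = "\<lambda>j. main_store ou s w (int (length w) - 1 - int j) c d y k i os"
  have W: "runs (Whl 2 nonblank (step_heads (-1))) (?\<sigma> 0) (?\<sigma> (length w)) (length w * (3 + 2) + 1)"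
  proof (rule runs_Whl[where \<sigma> = ?\<sigma>], intro conjI)
    fix j assume j: "j < length w"
    then show "rd (?\<sigma> j) 2 \<in> nonblank" using w by (simp add: rd_main_store[OF ou] tape_of_pos_iff)
    show "runs (step_heads (-1)) (?\<sigma> j) (?\<sigma> (Suc j)) 3" by (rule runs_step_heads[OF ou]) simp
  qed (simp add: rd_main_store[OF ou])
  have "runs return_heads (main_store ou s w (int (length w)) c d y k i os) (main_store ou s w 0 c d y k i os)
      (3 + ((length w * (3 + 2) + 1) + 3))"
    unfolding return_heads_def
    by (rule runs_Seq[OF runs_step_heads[OF ou] runs_Seq[OF W runs_step_heads[OF ou]]]) simp_all
  then show ?thesis by (rule runs_mono) simp
qed

text \<open>In the encoding by \<open>block\<close> every bit is preceded by \<open>True\<close>: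
  the first two symbols are the entry of variable 1, which belongs to every tree, and the final
  \<open>False\<close> closes the block.\<close>

definition scan :: "nat \<Rightarrow> prog \<Rightarrow> prog" where
  "scan ou p = Seq (emits ou [True, True]) (Seq (sweep p) (Seq (emit ou False) return_heads))"

lemma runs_scan:
  assumes ou: "6 < ou" and w: "0 \<notin> set w"
    and p: "\<And>j os. j < length w \<Longrightarrow>
      runs p (main_store ou s w (int j) c d y k i os) (main_store ou s w (int j) c d y k i (os @ \<phi> j)) B"
  shows "runs (scan ou p) (main_store ou s w 0 c d y k i os)
    (main_store ou s w 0 c d y k i (os @ [True, True] @ concat (map \<phi> [0..<length w]) @ [False])) (length w * (B + 10) + 11)"
proof -
  have "runs (scan ou p) (main_store ou s w 0 c d y k i os)
    (main_store ou s w 0 c d y k i (((os @ [True, True]) @ concat (map \<phi> [0..<length w])) @ [False]))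
    (length [True, True] + ((length w * (B + 5) + 1) + (1 + (length w * 5 + 7))))"
    unfolding scan_def
    by (rule runs_Seq[OF runs_emits runs_Seq[OF runs_sweep[OF ou w p] runs_Seq[OF runs_emit runs_return_heads[OF ou w]]]])
  then show ?thesis by (rule runs_conv) (simp_all add: algebra_simps)
qed

text \<open>The tiles \<open>a\<close>, \<open>b\<close> and \<open>e\<close> are constants of the
  program, so \<open>e = a\<close> and \<open>e = b\<close> are decided when it is built, the empty
  set disabling the test. Only the cells are compared at run time, through the marks on tapes 4 and
  5.\<close>

definition bit_prog :: "nat \<Rightarrow> nat \<Rightarrow> nat \<Rightarrow> nat \<Rightarrow> prog" where
  "bit_prog ou a b e = Seq (emit ou True) (Ift 4 (if e = a then {1} else {}) (emit ou True)
     (Ift 5 (if e = b then {1} else {}) (emit ou True) (emit ou False)))"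

lemma runs_bit_prog:
  assumes ou: "6 < ou"
  shows "runs (bit_prog ou a b e) (main_store ou s w (int j) c d y k i os)
    (main_store ou s w (int j) c d y k i (os @ [True, (j = c \<and> e = a) \<or> (j = d \<and> e = b)])) 6"
proof -
  have e: "runs (emit ou v) (main_store ou s w (int j) c d y k i (os @ [True]))
    (main_store ou s w (int j) c d y k i (os @ [True, v])) B" if "1 \<le> B" for v B
    using runs_mono[OF runs_emit that, of ou v s w "int j" c d y k i "os @ [True]"] by simp
  let ?v = "(j = c \<and> e = a) \<or> (j = d \<and> e = b)"
  have e': "runs (emit ou v) (main_store ou s w (int j) c d y k i (os @ [True]))
    (main_store ou s w (int j) c d y k i (os @ [True, ?v])) B" if "1 \<le> B" "v = ?v" for v B
    unfolding that(2)[symmetric] by (rule e[OF that(1)])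
  have "runs (bit_prog ou a b e) (main_store ou s w (int j) c d y k i os)
    (main_store ou s w (int j) c d y k i (os @ [True, ?v])) (1 + ((1 + 2) + 2))"
    unfolding bit_prog_def
    by (intro runs_Seq[OF runs_emit] runs_Ift e') (auto simp: rd_main_store[OF ou] split: if_splits)
  then show ?thesis by (rule runs_conv) simp_all
qed

definition row_prog :: "nat \<Rightarrow> nat \<Rightarrow> nat \<Rightarrow> nat \<Rightarrow> prog" where
  "row_prog ou g a b = scan ou (seq_list (map (bit_prog ou a b) [0..<g]))"

lemma runs_seq_list_out:
  assumes "\<And>e os. e \<in> set es \<Longrightarrow> runs (p e) (main_store ou s w j c d y k i os) (main_store ou s w j c d y k i (os @ \<phi> e)) B"
  shows "runs (seq_list (map p es)) (main_store ou s w j c d y k i os)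
    (main_store ou s w j c d y k i (os @ concat (map \<phi> es))) (length es * B)"
  using assms
proof (induction es arbitrary: os)
  case Nil
  then show ?case by (simp add: runs_Skip)
next
  case (Cons e es)
  have "runs (p e) (main_store ou s w j c d y k i os) (main_store ou s w j c d y k i (os @ \<phi> e)) B" using Cons.prems by simp
  from runs_Seq[OF this Cons.IH] Cons.prems show ?case by simp
qed

lemma map_upt_shift: "map F [m..<m + g] = map (\<lambda>e. F (m + e)) [0..<g]"
  by (rule nth_equalityI) auto

lemma map_upt_grid:
  "map F [2..<2 + N * g] = concat (map (\<lambda>j. map (\<lambda>e. F (vertex g j e)) [0..<g]) [0..<N])"
proof (induction N)
  case (Suc N)
  have s: "2 + Suc N * g = (2 + N * g) + g" by simp
  have "[2..<2 + Suc N * g] = [2..<2 + N * g] @ [2 + N * g..<(2 + N * g) + g]"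
    unfolding s by (rule upt_add_eq_append) simp
  moreover have "map F [2 + N * g..<(2 + N * g) + g] = map (\<lambda>e. F (vertex g N e)) [0..<g]"
    unfolding map_upt_shift vertex_def ..
  ultimately show ?case using Suc.IH by (simp only: map_append upt_Suc_append list.map concat_append concat.simps) simp
qed simp

text \<open>Variables in increasing order are variable 1 and then, cell by cell, the
  \<open>g\<close> tiles, which is the order of a sweep. \<open>F\<close> is arbitrary so that the
  lemma covers the trees as well as the unary header.\<close>

lemma block_grid:
  "block (map F [1..<Suc (Suc (N * g))]) =
    [True, F 1] @ concat (map (\<lambda>j. concat (map (\<lambda>e. [True, F (vertex g j e)]) [0..<g])) [0..<N]) @ [False]"
proof -
  have c: "concat (map h (concat xss)) = concat (map (\<lambda>xs. concat (map h xs)) xss)"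
    for h :: "bool \<Rightarrow> bool list" and xss by (induction xss) auto
  have "[1..<Suc (Suc (N * g))] = 1 # [2..<2 + N * g]" by (simp add: upt_rec numeral_2_eq_2)
  then have "map F [1..<Suc (Suc (N * g))] = F 1 # concat (map (\<lambda>j. map (\<lambda>e. F (vertex g j e)) [0..<g]) [0..<N])"
    by (simp only: list.map map_upt_grid)
  then show ?thesis by (simp add: block_def c comp_def del: upt_Suc)
qed

definition tree_bits :: "nat \<Rightarrow> nat \<Rightarrow> nat set \<Rightarrow> bool list" where
  "tree_bits N g T = block (map (\<lambda>i. i \<in> T) [1..<Suc (Suc (N * g))])"

lemma runs_row_prog:
  assumes ou: "6 < ou" and w: "0 \<notin> set w" and ab: "a < g" "b < g"
  shows "runs (row_prog ou g a b) (main_store ou s w 0 c d y k i os)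
    (main_store ou s w 0 c d y k i (os @ tree_bits (length w) g {1, vertex g c a, vertex g d b})) (length w * (g * 6 + 10) + 11)"
proof -
  let ?T = "{1, vertex g c a, vertex g d b}"
  let ?\<phi> = "\<lambda>j. concat (map (\<lambda>e. [True, (j = c \<and> e = a) \<or> (j = d \<and> e = b)]) [0..<g])"
  have "vertex g j e \<in> ?T \<longleftrightarrow> (j = c \<and> e = a) \<or> (j = d \<and> e = b)" if "e < g" for j e
    using that ab by (auto simp: vertex_eq_iff) (simp_all add: vertex_def)
  then have "concat (map (\<lambda>e. [True, vertex g j e \<in> ?T]) [0..<g]) = ?\<phi> j" for j
    by (intro arg_cong[where f = concat] map_cong) auto
  then have "tree_bits (length w) g ?T = [True, True] @ concat (map ?\<phi> [0..<length w]) @ [False]"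
    unfolding tree_bits_def block_grid by simp
  moreover have "runs (seq_list (map (bit_prog ou a b) [0..<g])) (main_store ou s w (int j) c d y k i os)
    (main_store ou s w (int j) c d y k i (os @ ?\<phi> j)) (g * 6)" for j os
    by (rule runs_conv[OF runs_seq_list_out[OF runs_bit_prog[OF ou]]]) simp_all
  ultimately show ?thesis
    unfolding row_prog_def by (simp only:) (rule runs_scan[OF ou w])
qed

definition header_prog :: "nat \<Rightarrow> nat \<Rightarrow> prog" where
  "header_prog ou g = scan ou (seq_list (map (\<lambda>_. emits ou [True, True]) [0..<g]))"

lemma runs_header_prog:
  assumes ou: "6 < ou" and w: "0 \<notin> set w"
  shows "runs (header_prog ou g) (main_store ou s w 0 c d y k i os)
    (main_store ou s w 0 c d y k i (os @ block (replicate (Suc (length w * g)) True))) (length w * (g * 2 + 10) + 11)"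
proof -
  let ?\<phi> = "\<lambda>j :: nat. concat (map (\<lambda>e. [True, True]) [0..<g])"
  have "block (replicate (Suc (length w * g)) True) = block (map (\<lambda>_. True) [1..<Suc (Suc (length w * g))])"
    by (simp only: map_replicate_const length_upt diff_Suc_1)
  also have "\<dots> = [True, True] @ concat (map ?\<phi> [0..<length w]) @ [False]"
    by (rule block_grid)
  finally have 1: "block (replicate (Suc (length w * g)) True) = [True, True] @ concat (map ?\<phi> [0..<length w]) @ [False]" .
  have e: "runs (emits ou [True, True]) (main_store ou s w (int j) c d y k i os)
    (main_store ou s w (int j) c d y k i (os @ [True, True])) 2" for j os
    by (rule runs_conv[OF runs_emits]) simp_all
  have "runs (seq_list (map (\<lambda>_. emits ou [True, True]) [0..<g])) (main_store ou s w (int j) c d y k i os)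
    (main_store ou s w (int j) c d y k i (os @ ?\<phi> j)) (g * 2)" for j os
    by (rule runs_conv[OF runs_seq_list_out[where \<phi> = "\<lambda>_. [True, True]", OF e]]) simp_all
  then show ?thesis
    unfolding header_prog_def 1 by (intro runs_scan[OF ou w])
qed


section \<open>The binary counter\<close>

lemma binary_Suc:
  "\<exists>m r r'. binary k = replicate m True @ r \<and> binary (Suc k) = replicate m False @ True # r' \<and>
    (r = [] \<and> r' = [] \<or> r = False # r')"
proof (induction k rule: less_induct)
  case (less k)
  show ?case
  proof (cases "odd k")
    case False
    then have "binary (Suc k) = True # binary (k div 2)" by (simp add: binary_pos)
    moreover have "binary k = [] \<and> k div 2 = 0 \<or> binary k = False # binary (k div 2)"
      using False by (cases "k = 0") (auto simp: binary_pos)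
    ultimately show ?thesis by (intro exI[of _ 0] exI[of _ "binary k"] exI[of _ "binary (k div 2)"]) auto
  next
    case True
    then have "k div 2 < k" by (simp add: odd_pos)
    then obtain m r r' where IH: "binary (k div 2) = replicate m True @ r"
      "binary (Suc (k div 2)) = replicate m False @ True # r'" "r = [] \<and> r' = [] \<or> r = False # r'"
      using less by blast
    have "binary k = True # binary (k div 2)" using True by (simp add: binary_pos odd_pos)
    moreover have "binary (Suc k) = False # binary (Suc (k div 2))"
      using True by (simp add: binary_pos odd_Suc_div_two)
    ultimately show ?thesis using IH
      by (intro exI[of _ "Suc m"] exI[of _ r] exI[of _ r']) simp
  qed
qed

lemma length_binary: "length (binary k) \<le> k"
proof (induction k rule: less_induct)
  case (less k)
  show ?case
  proof (cases "k = 0")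
    case False
    then have "length (binary (k div 2)) \<le> k div 2" by (intro less) simp
    then show ?thesis using False by (simp add: binary_pos)
  qed simp
qed

lemma bit_symbol_nonzero [simp]: "0 < bit_symbol b" "0 \<notin> set (map bit_symbol bs)" "0 \<notin> bit_symbol ` A"
  by (auto simp: bit_symbol_def split: if_splits)

lemma tape_of_update: "i < length ys \<Longrightarrow> (tape_of ys)(int i := b) = tape_of (ys[i := b])"
  by (auto simp: tape_of_def fun_eq_iff nth_list_update)

text \<open>Symbol 2 is the bit one and symbol 1 the bit zero. The low ones form the carry chain and
  are cleared; the cell behind them, a zero or the blank after the last digit, becomes one.\<close>

definition incr :: prog where
  "incr = Seq (Whl 6 {2} (Wr 6 1 1)) (Seq (Wr 6 2 0) (rewind 6))"

lemma runs_incr: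
  "runs incr (s(6 := (tape_of (map bit_symbol (binary k)), 0))) (s(6 := (tape_of (map bit_symbol (binary (Suc k))), 0))) (6 * k + 5)"
proof -
  obtain m r r' where m: "binary k = replicate m True @ r" "binary (Suc k) = replicate m False @ True # r'"
    "r = [] \<and> r' = [] \<or> r = False # r'" using binary_Suc by blast
  let ?b = "map bit_symbol"
  let ?ys = "\<lambda>i. replicate i 1 @ replicate (m - i) 2 @ ?b r"
  let ?\<sigma> = "\<lambda>i. s(6 := (tape_of (?ys i), int i))"
  have 1: "runs (Whl 6 {2} (Wr 6 1 1)) (?\<sigma> 0) (?\<sigma> m) (m * (1 + 2) + 1)"
  proof (rule runs_Whl[where \<sigma> = ?\<sigma>], intro conjI)
    fix i assume i: "i < m"
    then have mi: "m - i = Suc (m - Suc i)" by simp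
    show "rd (?\<sigma> i) 6 \<in> {2}" using i by (simp add: nth_append)
    have "(?ys i)[i := 1] = ?ys (Suc i)"
      unfolding mi by (simp add: list_update_append replicate_app_Cons_same)
    moreover have "(tape_of (?ys i))(int i := 1) = tape_of ((?ys i)[i := 1])" using i by (intro tape_of_update) simp
    ultimately show "runs (Wr 6 1 1) (?\<sigma> i) (?\<sigma> (Suc i)) 1"
      by (intro runs_Wr) (simp_all add: add.commute)
  next
    show "rd (?\<sigma> m) 6 \<notin> {2}" using m(3) by (auto simp: tape_of_def nth_append bit_symbol_def)
  qed
  have 2: "runs (Wr 6 2 0) (?\<sigma> m) (s(6 := (tape_of (?b (binary (Suc k))), int m))) 1"
  proof (rule runs_Wr)
    have "(tape_of (?ys m))(int m := 2) = tape_of (?b (binary (Suc k)))"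
    \<comment> \<open>If all digits were ones, the number gains a digit and the blank is
      overwritten; otherwise a zero is.\<close>
    proof (cases "r = []")
      case True
      then show ?thesis using m(3) tape_of_append[of "replicate m 1" 2] by (simp add: m(2) bit_symbol_def)
    next
      case False
      then show ?thesis using m(3) tape_of_update[of m "?ys m" 2] by (simp add: m(2) bit_symbol_def list_update_append)
    qed
    then show "s(6 := (tape_of (?b (binary (Suc k))), int m)) = wr 6 2 0 (?\<sigma> m)" by simp
  qed simp
  have 3: "runs (rewind 6) (s(6 := (tape_of (?b (binary (Suc k))), int m))) (s(6 := (tape_of (?b (binary (Suc k))), 0))) (3 * m + 3)"
    by (rule runs_rewind) (simp_all add: m(2))
  have "tape_of (?ys 0) = tape_of (?b (binary k))" using m(1) by (simp add: bit_symbol_def)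
  moreover have "m \<le> k" using length_binary[of k] m(1) by simp
  moreover have "runs incr (?\<sigma> 0) (s(6 := (tape_of (?b (binary (Suc k))), 0))) (m * (1 + 2) + 1 + (1 + (3 * m + 3)))"
    unfolding incr_def by (rule runs_Seq[OF 1 runs_Seq[OF 2 3]])
  ultimately show ?thesis by (simp add: runs_mono)
qed

lemma main_store_upd6:
  assumes "6 < ou"
  shows "main_store ou s w j c d y k i os = (main_store ou s w j c d y 0 0 os)(6 := (tape_of (map bit_symbol (binary k)), int i))"
  using assms by (auto simp: main_store_def fun_eq_iff)

lemma runs_incr_main_store:
  assumes "6 < ou"
  shows "runs incr (main_store ou s w j c d y k 0 os) (main_store ou s w j c d y (Suc k) 0 os) (6 * k + 5)"
  unfolding main_store_upd6[OF assms, of s w j c d y k] main_store_upd6[OF assms, of s w j c d y "Suc k"]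
  using runs_incr by simp

definition print_counter :: "nat \<Rightarrow> prog" where
  "print_counter ou = Seq (Whl 6 nonblank (Seq (emit ou True)
     (Seq (Ift 6 {2} (emit ou True) (emit ou False)) (Mv 6 1)))) (Seq (emit ou False) (rewind 6))"

lemma runs_print_counter:
  assumes ou: "6 < ou"
  shows "runs (print_counter ou) (main_store ou s w j c d y k 0 os) (main_store ou s w j c d y k 0 (os @ block (binary k))) (10 * k + 5)"
proof -
  let ?n = "length (binary k)"
  let ?\<sigma> = "\<lambda>i. main_store ou s w j c d y k i (os @ concat (map (\<lambda>b. [True, b]) (take i (binary k))))"
  have 1: "runs (Whl 6 nonblank (Seq (emit ou True) (Seq (Ift 6 {2} (emit ou True) (emit ou False)) (Mv 6 1))))
    (?\<sigma> 0) (?\<sigma> ?n) (?n * ((1 + ((1 + 2) + 1)) + 2) + 1)"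
  proof (rule runs_Whl[where \<sigma> = ?\<sigma>], intro conjI)
    fix i assume i: "i < ?n"
    then show "rd (?\<sigma> i) 6 \<in> nonblank" by (simp add: rd_main_store[OF ou])
    let ?o = "(os @ concat (map (\<lambda>b. [True, b]) (take i (binary k)))) @ [True]"
    let ?t = "main_store ou s w j c d y k i (?o @ [binary k ! i])"
    have bit: "runs (Ift 6 {2} (emit ou True) (emit ou False)) (main_store ou s w j c d y k i ?o) ?t (1 + 2)"
    proof (rule runs_Ift)
      have r: "rd (main_store ou s w j c d y k i ?o) 6 = bit_symbol (binary k ! i)" using i by (simp add: rd_main_store[OF ou])
      show "runs (emit ou True) (main_store ou s w j c d y k i ?o) ?t 1" if "rd (main_store ou s w j c d y k i ?o) 6 \<in> {2}"
      proof -
        have "binary k ! i = True" using that unfolding r by (simp add: bit_symbol_def split: if_splits)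
        then show ?thesis by (simp only: runs_emit)
      qed
      show "runs (emit ou False) (main_store ou s w j c d y k i ?o) ?t 1" if "rd (main_store ou s w j c d y k i ?o) 6 \<notin> {2}"
      proof -
        have "binary k ! i = False" using that unfolding r by (simp add: bit_symbol_def split: if_splits)
        then show ?thesis by (simp only: runs_emit)
      qed
    qed
    have mv: "runs (Mv 6 1) ?t (?\<sigma> (Suc i)) 1"
      using ou i by (intro runs_Mv) (auto simp: main_store_def fun_eq_iff mv_def take_Suc_conv_app_nth)
    show "runs (Seq (emit ou True) (Seq (Ift 6 {2} (emit ou True) (emit ou False)) (Mv 6 1)))
      (?\<sigma> i) (?\<sigma> (Suc i)) (1 + ((1 + 2) + 1))"
      by (rule runs_Seq[OF runs_emit runs_Seq[OF bit mv]])
  qed (simp add: rd_main_store[OF ou])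
  let ?o = "(os @ concat (map (\<lambda>b. [True, b]) (take ?n (binary k)))) @ [False]"
  have 2: "runs (rewind 6) (main_store ou s w j c d y k ?n ?o) (main_store ou s w j c d y k 0 ?o) (3 * ?n + 3)"
    unfolding main_store_upd6[OF ou, of s w j c d y k ?n ?o] main_store_upd6[OF ou, of s w j c d y k 0 ?o] of_nat_0
    by (rule runs_rewind) simp_all
  have "runs (print_counter ou) (?\<sigma> 0) (main_store ou s w j c d y k 0 ?o) (?n * ((1 + ((1 + 2) + 1)) + 2) + 1 + (1 + (3 * ?n + 3)))"
    unfolding print_counter_def by (rule runs_Seq[OF 1 runs_Seq[OF runs_emit 2]])
  then have "runs (print_counter ou) (main_store ou s w j c d y k 0 os) (main_store ou s w j c d y k 0 ?o) (10 * ?n + 5)"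
    by (simp add: runs_mono)
  then show ?thesis using length_binary[of k] by (simp add: block_def runs_mono)
qed

section \<open>Moving through the pairs of cells at a given distance\<close>

definition advance :: prog where "advance = Seq (Mv 3 1) (Seq (Mv 4 (-1)) (Mv 5 (-1)))"
definition retreat :: prog where "retreat = Seq (Mv 3 (-1)) (Seq (Mv 4 1) (Mv 5 1))"
text \<open>In contrast to \<open>advance\<close>, only the second pointer moves, together with the
  head of tape 3 that accompanies it: the distance of the two cells grows by one.\<close>

definition shift :: prog where "shift = Seq (Mv 3 1) (Mv 5 (-1))"
definition unshift :: prog where "unshift = Seq (Mv 3 (-1)) (Mv 5 1)"

lemma runs_Seq_Mv: "runs q (mv j e s) t B \<Longrightarrow> runs (Seq (Mv j e) q) s t (Suc B)"
  using runs_Seq[OF runs_Mv[OF refl order_refl], of q j e s t B] by simp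

lemma runs_moves:
  assumes "6 < ou"
  shows "runs advance (main_store ou s w j c d y k i os) (main_store ou s w j (Suc c) (Suc d) (Suc y) k i os) 3"
    "runs retreat (main_store ou s w j (Suc c) (Suc d) (Suc y) k i os) (main_store ou s w j c d y k i os) 3"
    "runs shift (main_store ou s w j c d y k i os) (main_store ou s w j c (Suc d) (Suc y) k i os) 2"
    "runs unshift (main_store ou s w j c (Suc d) (Suc y) k i os) (main_store ou s w j c d y k i os) 2"
  unfolding advance_def retreat_def shift_def unshift_def eval_nat_numeral
  by (intro runs_Seq_Mv runs_Mv; use assms in \<open>auto simp: main_store_def fun_eq_iff mv_def\<close>)+

text \<open>The first loop ends when the second cell leaves the word. The way back ends when tape 4
  shows its mark, that is, when the first cell is again cell 0, and it preserves the
  distance.\<close>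

definition phase :: "prog \<Rightarrow> prog" where
  "phase p = Seq (Whl 3 nonblank (Seq p advance)) (Whl 4 {0} retreat)"

text \<open>Stated for counting and printing at once: at cell \<open>c\<close> the body adds
  \<open>\<kappa> c\<close> to the counter and appends \<open>\<phi> c\<close> to the output.
  \<open>Kmax\<close> bounds the counter during the whole phase, so that one time bound
  \<open>B\<close> fits every increment.\<close>

lemma runs_phase:
  assumes ou: "6 < ou" and w: "0 \<notin> set w" and d: "d \<le> length w"
    and p: "\<And>c k os. c + d < length w \<Longrightarrow> k + \<kappa> c \<le> Kmax \<Longrightarrow>
      runs p (main_store ou s w 0 c (c + d) (c + d) k 0 os) (main_store ou s w 0 c (c + d) (c + d) (k + \<kappa> c) 0 (os @ \<phi> c)) B"
    and k: "k + (\<Sum>c<length w - d. \<kappa> c) \<le> Kmax"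
  shows "runs (phase p) (main_store ou s w 0 0 d d k 0 os)
    (main_store ou s w 0 0 d d (k + (\<Sum>c<length w - d. \<kappa> c)) 0 (os @ concat (map \<phi> [0..<length w - d])))
    (length w * (B + 10) + 2)"
proof -
  let ?n = "length w - d"
  let ?\<sigma> = "\<lambda>c. main_store ou s w 0 c (c + d) (c + d) (k + (\<Sum>i<c. \<kappa> i)) 0 (os @ concat (map \<phi> [0..<c]))"
  have 1: "runs (Whl 3 nonblank (Seq p advance)) (?\<sigma> 0) (?\<sigma> ?n) (?n * ((B + 3) + 2) + 1)"
  proof (rule runs_Whl[where \<sigma> = ?\<sigma>], intro conjI)
    fix c assume c: "c < ?n"
    show "rd (?\<sigma> c) 3 \<in> nonblank" using w c by (simp add: rd_main_store[OF ou] tape_of_pos_iff del: tape_of_nth)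
    have le: "k + (\<Sum>i<c. \<kappa> i) + \<kappa> c \<le> Kmax"
    proof -
      have "(\<Sum>i<Suc c. \<kappa> i) \<le> (\<Sum>i<?n. \<kappa> i)" by (rule sum_mono2) (use c in auto)
      then show ?thesis using k by simp
    qed
    have "c + d < length w" using c by simp
    then show "runs (Seq p advance) (?\<sigma> c) (?\<sigma> (Suc c)) (B + 3)"
      by (intro runs_conv[OF runs_Seq[OF p[OF _ le] runs_moves(1)[OF ou]]]) (simp_all add: add.assoc)
  next
    show "rd (?\<sigma> ?n) 3 \<notin> nonblank" using w d by (simp add: rd_main_store[OF ou] tape_of_pos_iff del: tape_of_nth)
  qed
  let ?k = "k + (\<Sum>i<?n. \<kappa> i)" and ?o = "os @ concat (map \<phi> [0..<?n])"
  let ?\<tau> = "\<lambda>i. main_store ou s w 0 (?n - i) (?n - i + d) (?n - i + d) ?k 0 ?o"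
  have 2: "runs (Whl 4 {0} retreat) (?\<tau> 0) (?\<tau> ?n) (?n * (3 + 2) + 1)"
  proof (rule runs_Whl[where \<sigma> = ?\<tau>], intro conjI)
    fix i assume i: "i < ?n"
    then have "?n - i = Suc (?n - Suc i)" by simp
    then show "rd (?\<tau> i) 4 \<in> {0}" "runs retreat (?\<tau> i) (?\<tau> (Suc i)) 3"
      using runs_moves(2)[OF ou] by (simp_all add: rd_main_store[OF ou])
  qed (simp add: rd_main_store[OF ou])
  have "runs (phase p) (?\<sigma> 0) (?\<tau> ?n) ((?n * ((B + 3) + 2) + 1) + (?n * (3 + 2) + 1))"
    unfolding phase_def using 2 by (intro runs_Seq[OF 1]) simp
  moreover have "(?n * ((B + 3) + 2) + 1) + (?n * (3 + 2) + 1) = ?n * (B + 10) + 2" by (simp add: algebra_simps)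
  moreover have "?n * (B + 10) + 2 \<le> length w * (B + 10) + 2" by simp
  ultimately show ?thesis by (auto elim: runs_mono)
qed

text \<open>The three phases run through the pairs of cells at distance 0, 1 and \<open>D\<close>. The distance \<open>D\<close> is
  found as the position of the second cell type that starts a row, which is 8 or 10.\<close>

definition pass :: "(nat \<Rightarrow> prog) \<Rightarrow> prog" where
  "pass p = Seq (phase (p 0)) (Seq shift (Seq (phase (p 1)) (Seq (Whl 3 (- {8, 10}) shift)
     (Seq (phase (p 2)) (Whl 5 {0} unshift)))))"

lemma runs_pass:
  assumes ou: "6 < ou" and w: "0 \<notin> set w" and D: "1 \<le> D" "D < length w"
    and sep: "\<And>i. 1 \<le> i \<Longrightarrow> i < D \<Longrightarrow> w ! i \<notin> {8, 10}" "w ! D \<in> {8, 10}"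
    and p: "\<And>r c k os. r < 3 \<Longrightarrow> c + offset D r < length w \<Longrightarrow> k + \<kappa> r c \<le> Kmax \<Longrightarrow>
      runs (p r) (main_store ou s w 0 c (c + offset D r) (c + offset D r) k 0 os)
        (main_store ou s w 0 c (c + offset D r) (c + offset D r) (k + \<kappa> r c) 0 (os @ \<phi> r c)) B"
    and S: "\<And>r. S r = (\<Sum>c<length w - offset D r. \<kappa> r c)"
    and \<Phi>: "\<And>r. \<Phi> r = concat (map (\<phi> r) [0..<length w - offset D r])"
    and k: "k + S 0 + S 1 + S 2 \<le> Kmax"
  shows "runs (pass p) (main_store ou s w 0 0 0 0 k 0 os)
    (main_store ou s w 0 0 0 0 (k + S 0 + S 1 + S 2) 0 (os @ \<Phi> 0 @ \<Phi> 1 @ \<Phi> 2)) (length w * (3 * B + 38) + 10)"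
proof -
  have ph: "runs (phase (p r)) (main_store ou s w 0 0 (offset D r) (offset D r) k 0 os)
    (main_store ou s w 0 0 (offset D r) (offset D r) (k + S r) 0 (os @ \<Phi> r)) (length w * (B + 10) + 2)"
    if "r < 3" "k + S r \<le> Kmax" for r k os
    unfolding S \<Phi> using p[OF that(1)] that D by (intro runs_phase[OF ou w]) (auto simp: S offset_def)
  have ofs: "offset D 0 = 0" "offset D 1 = Suc 0" "offset D 2 = D" by (simp_all add: offset_def)
  have p0: "runs (phase (p 0)) (main_store ou s w 0 0 0 0 k 0 os) (main_store ou s w 0 0 0 0 (k + S 0) 0 (os @ \<Phi> 0)) (length w * (B + 10) + 2)"
    using ph[of 0 k os] k unfolding ofs by simp
  have p1: "runs (phase (p 1)) (main_store ou s w 0 0 (Suc 0) (Suc 0) (k + S 0) 0 (os @ \<Phi> 0))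
      (main_store ou s w 0 0 (Suc 0) (Suc 0) (k + S 0 + S 1) 0 ((os @ \<Phi> 0) @ \<Phi> 1)) (length w * (B + 10) + 2)"
    using ph[of 1 "k + S 0" "os @ \<Phi> 0"] k unfolding ofs by simp
  have p2: "runs (phase (p 2)) (main_store ou s w 0 0 D D (k + S 0 + S 1) 0 ((os @ \<Phi> 0) @ \<Phi> 1))
      (main_store ou s w 0 0 D D (k + S 0 + S 1 + S 2) 0 (((os @ \<Phi> 0) @ \<Phi> 1) @ \<Phi> 2)) (length w * (B + 10) + 2)"
    using ph[of 2 "k + S 0 + S 1" "(os @ \<Phi> 0) @ \<Phi> 1"] k unfolding ofs by simp
  let ?\<sigma> = "\<lambda>i. main_store ou s w 0 0 (Suc i) (Suc i) (k + S 0 + S 1) 0 ((os @ \<Phi> 0) @ \<Phi> 1)"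
  have l1: "runs (Whl 3 (- {8, 10}) shift) (?\<sigma> 0) (?\<sigma> (D - 1)) ((D - 1) * (2 + 2) + 1)"
  proof (rule runs_Whl[where \<sigma> = ?\<sigma>], intro conjI)
    fix i assume i: "i < D - 1"
    then have "tape_of w (int (Suc i)) = w ! Suc i" using D by (intro tape_of_nth) simp
    then show "rd (?\<sigma> i) 3 \<in> - {8, 10}" using sep(1)[of "Suc i"] i by (simp add: rd_main_store[OF ou] del: of_nat_Suc)
    show "runs shift (?\<sigma> i) (?\<sigma> (Suc i)) 2" by (rule runs_moves(3)[OF ou])
  next
    show "rd (?\<sigma> (D - 1)) 3 \<notin> - {8, 10}" using sep(2) D by (simp add: rd_main_store[OF ou] del: of_nat_Suc)
  qed
  let ?\<tau> = "\<lambda>i. main_store ou s w 0 0 (D - i) (D - i) (k + S 0 + S 1 + S 2) 0 (((os @ \<Phi> 0) @ \<Phi> 1) @ \<Phi> 2)"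
  have l2: "runs (Whl 5 {0} unshift) (?\<tau> 0) (?\<tau> D) (D * (2 + 2) + 1)"
  proof (rule runs_Whl[where \<sigma> = ?\<tau>], intro conjI)
    fix i assume i: "i < D"
    then have "D - i = Suc (D - Suc i)" by simp
    then show "rd (?\<tau> i) 5 \<in> {0}" "runs unshift (?\<tau> i) (?\<tau> (Suc i)) 2"
      using runs_moves(4)[OF ou] by (simp_all add: rd_main_store[OF ou])
  qed (simp add: rd_main_store[OF ou])
  have "?\<sigma> (D - 1) = main_store ou s w 0 0 D D (k + S 0 + S 1) 0 ((os @ \<Phi> 0) @ \<Phi> 1)" using D by simp
  note l1 = l1[unfolded this]
  note l2 = l2[unfolded diff_zero diff_self_eq_0]
  note chain = runs_Seq[OF p0 runs_Seq[OF runs_moves(3)[OF ou] runs_Seq[OF p1 runs_Seq[OF l1 runs_Seq[OF p2 l2]]]]]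
  have "(D - 1) * (2 + 2) + 1 \<le> length w * 4" using D by simp
  moreover have "D * (2 + 2) + 1 \<le> length w * 4 + 1" using D by simp
  ultimately show ?thesis unfolding pass_def
    by (intro runs_conv[OF chain]) (simp_all add: algebra_simps)
qed

definition pairs :: "nat \<Rightarrow> (nat \<times> nat) list" where
  "pairs g = List.product [0..<g] [0..<g]"

lemma length_pairs [simp]: "length (pairs g) = g * g"
  by (simp add: pairs_def)

text \<open>Which combinations are counted depends neither on the cell nor on its type, so
  \<open>Q r a b\<close> is decided when the program is built and only increments are left.\<close>

definition count_prog :: "(nat \<Rightarrow> nat \<Rightarrow> nat \<Rightarrow> bool) \<Rightarrow> nat \<Rightarrow> nat \<Rightarrow> prog" where
  "count_prog Q g r = seq_list (map (\<lambda>(a, b). if Q r a b then incr else Skip) (pairs g))"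

lemma runs_count_prog:
  assumes ou: "6 < ou" and k: "k + length (filter (\<lambda>(a, b). Q r a b) (pairs g)) \<le> Kmax"
  shows "runs (count_prog Q g r) (main_store ou s w j c d y k 0 os)
    (main_store ou s w j c d y (k + length (filter (\<lambda>(a, b). Q r a b) (pairs g))) 0 os) (g * g * (6 * Kmax + 5))"
proof -
  have "runs (seq_list (map (\<lambda>(a, b). if Q r a b then incr else Skip) ps)) (main_store ou s w j c d y k 0 os)
    (main_store ou s w j c d y (k + length (filter (\<lambda>(a, b). Q r a b) ps)) 0 os) (length ps * (6 * Kmax + 5))"
    if "k + length (filter (\<lambda>(a, b). Q r a b) ps) \<le> Kmax" for ps k
    using that
  proof (induction ps arbitrary: k)
    case Nil
    then show ?case by (simp add: runs_Skip)
  next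
    case (Cons ab ps)
    obtain a b where ab: "ab = (a, b)" by (cases ab)
    show ?case
    proof (cases "Q r a b")
      case True
      have 1: "runs incr (main_store ou s w j c d y k 0 os) (main_store ou s w j c d y (Suc k) 0 os) (6 * Kmax + 5)"
        by (rule runs_mono[OF runs_incr_main_store[OF ou]]) (use Cons.prems True ab in simp)
      show ?thesis using runs_Seq[OF 1 Cons.IH] Cons.prems True ab by simp
    next
      case False
      have 1: "runs Skip (main_store ou s w j c d y k 0 os) (main_store ou s w j c d y k 0 os) (6 * Kmax + 5)"
        by (rule runs_mono[OF runs_Skip]) simp
      show ?thesis using runs_Seq[OF 1 Cons.IH] Cons.prems False ab by simp
    qed
  qed
  from this[OF k] show ?thesis by (simp add: count_prog_def)
qed

text \<open>The type of the cell, read from tape 3, is the only run-time information on which the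
  choice of a tree at the current pair of cells depends.\<close>

definition trees_prog where
  "trees_prog ou U H V g r = seq_list (map (\<lambda>(a, b). Ift 3 {y. conflict U H V y r a b} (row_prog ou g a b) Skip) (pairs g))"

lemma concat_map_filter: "concat (map (\<lambda>x. if P x then f x else []) xs) = concat (map f (filter P xs))"
  by (induction xs) auto

lemma runs_trees_prog:
  assumes ou: "6 < ou" and w: "0 \<notin> set w" and c: "c + offset D r < length w"
  shows "runs (trees_prog ou U H V g r) (main_store ou s w 0 c (c + offset D r) (c + offset D r) k 0 os)
    (main_store ou s w 0 c (c + offset D r) (c + offset D r) k 0 (os @
      concat (map (\<lambda>(a, b). tree_bits (length w) g (tree_of g D (r, c, a, b)))
       (filter (\<lambda>(a, b). conflict U H V (w ! (c + offset D r)) r a b) (pairs g)))))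
    (g * g * (length w * (g * 6 + 10) + 13))"
proof -
  let ?P = "\<lambda>(a, b). conflict U H V (w ! (c + offset D r)) r a b"
  let ?F = "\<lambda>(a, b). tree_bits (length w) g (tree_of g D (r, c, a, b))"
  have rdw: "rd (main_store ou s w 0 c (c + offset D r) (c + offset D r) k 0 os) 3 = w ! (c + offset D r)" for os
    unfolding rd_main_store[OF ou] using c by (rule tape_of_nth)
  have "runs (trees_prog ou U H V g r) (main_store ou s w 0 c (c + offset D r) (c + offset D r) k 0 os)
    (main_store ou s w 0 c (c + offset D r) (c + offset D r) k 0 (os @
      concat (map (\<lambda>e. if ?P e then ?F e else []) (pairs g))))
    (length (pairs g) * (length w * (g * 6 + 10) + 11 + 2))"
    unfolding trees_prog_def
  proof (rule runs_seq_list_out)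
    fix ab os assume "ab \<in> set (pairs g)"
    then obtain a b where ab: "ab = (a, b)" "a < g" "b < g" unfolding pairs_def set_product by auto
    have "runs (Ift 3 {y. conflict U H V y r a b} (row_prog ou g a b) Skip) (main_store ou s w 0 c (c + offset D r) (c + offset D r) k 0 os)
      (main_store ou s w 0 c (c + offset D r) (c + offset D r) k 0 (os @ (if ?P (a, b) then ?F (a, b) else [])))
      (length w * (g * 6 + 10) + 11 + 2)"
    proof (rule runs_Ift)
      show "runs (row_prog ou g a b) (main_store ou s w 0 c (c + offset D r) (c + offset D r) k 0 os)
        (main_store ou s w 0 c (c + offset D r) (c + offset D r) k 0 (os @ (if ?P (a, b) then ?F (a, b) else [])))
        (length w * (g * 6 + 10) + 11)"
        if "rd (main_store ou s w 0 c (c + offset D r) (c + offset D r) k 0 os) 3 \<in> {y. conflict U H V y r a b}"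
        using that runs_row_prog[OF ou w ab(2,3)] by (simp add: rdw tree_of_def)
      show "runs Skip (main_store ou s w 0 c (c + offset D r) (c + offset D r) k 0 os)
        (main_store ou s w 0 c (c + offset D r) (c + offset D r) k 0 (os @ (if ?P (a, b) then ?F (a, b) else [])))
        (length w * (g * 6 + 10) + 11)"
        if "rd (main_store ou s w 0 c (c + offset D r) (c + offset D r) k 0 os) 3 \<notin> {y. conflict U H V y r a b}"
        using that by (simp add: rdw runs_mono[OF runs_Skip])
    qed
    then show "runs (case ab of (a, b) \<Rightarrow> Ift 3 {y. conflict U H V y r a b} (row_prog ou g a b) Skip)
      (main_store ou s w 0 c (c + offset D r) (c + offset D r) k 0 os)
      (main_store ou s w 0 c (c + offset D r) (c + offset D r) k 0 (os @ (if ?P ab then ?F ab else [])))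
      (length w * (g * 6 + 10) + 11 + 2)" by (simp only: ab(1) prod.case)
  qed
  then show ?thesis unfolding concat_map_filter by (rule runs_conv) (simp_all add: case_prod_unfold)
qed

text \<open>The encoding places the bound before the trees; this is why the pairs are traversed
  twice, for counting and for printing.\<close>

definition instance_prog where
  "instance_prog ou U H V g = Seq (pass (count_prog (counted H V) g)) (Seq (header_prog ou g)
     (Seq (print_counter ou) (pass (trees_prog ou U H V g))))"

text \<open>The recurring \<open>N * 3 * (g * g)\<close> bounds the counter: three kinds of
  constraints, at most \<open>N\<close> first cells for each, and \<open>g * g\<close> pairs of
  tiles.\<close>

definition instance_time :: "nat \<Rightarrow> nat \<Rightarrow> nat" where
  "instance_time g N = N * (3 * (g * g * (6 * (N * 3 * (g * g)) + 5)) + 38) + 10 +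
     (N * (g * 2 + 10) + 11 + (10 * (N * 3 * (g * g)) + 5 +
     (N * (3 * (g * g * (N * (g * 6 + 10) + 13)) + 38) + 10)))"

lemma runs_instance_prog:
  assumes ou: "6 < ou" and w: "0 \<notin> set w" and D: "1 \<le> D" "D < length w"
    and sep: "\<And>i. 1 \<le> i \<Longrightarrow> i < D \<Longrightarrow> w ! i \<notin> {8, 10}" "w ! D \<in> {8, 10}"
  shows "runs (instance_prog ou U H V g) (main_store ou s w 0 0 0 0 0 0 [])
    (main_store ou s w 0 0 0 0 (tiling_bound H V (length w) g D) 0
      (encode_instance (Suc (length w * g)) (tiling_trees U H V g D w) (tiling_bound H V (length w) g D)))
    (instance_time g (length w))"
proof -
  let ?N = "length w"
  define Z where "Z = tiling_bound H V ?N g D"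
  define \<kappa> where "\<kappa> r c = length (filter (\<lambda>(a, b). counted H V r a b) (pairs g))" for r c :: nat
  define S where "S r = (\<Sum>c<?N - offset D r. \<kappa> r c)" for r
  have Z: "Z = S 0 + S 1 + S 2"
    by (simp add: Z_def tiling_bound_def quads_def S_def \<kappa>_def length_concat comp_def
      pairs_def[symmetric] sum_list_triv)
  have Zle: "Z \<le> ?N * 3 * (g * g)"
  proof -
    have "S r \<le> ?N * (g * g)" for r
    proof -
      have "S r \<le> (\<Sum>c<?N - offset D r. g * g)"
        unfolding S_def \<kappa>_def by (rule sum_mono) (metis length_filter_le length_pairs)
      also have "\<dots> \<le> ?N * (g * g)" by simp
      finally show ?thesis .
    qed
    from this[of 0] this[of 1] this[of 2] show ?thesis unfolding Z by simp
  qed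
  \<comment> \<open>The counting pass prints nothing; its output blocks are empty.\<close>
  have 1: "runs (pass (count_prog (counted H V) g)) (main_store ou s w 0 0 0 0 0 0 [])
    (main_store ou s w 0 0 0 0 (0 + S 0 + S 1 + S 2) 0 ([] @ concat (map (\<lambda>c. []) [0..<?N - offset D 0]) @
       concat (map (\<lambda>c. []) [0..<?N - offset D 1]) @ concat (map (\<lambda>c. []) [0..<?N - offset D 2])))
    (?N * (3 * (g * g * (6 * Z + 5)) + 38) + 10)"
    by (rule runs_pass[OF ou w D sep, where \<kappa> = \<kappa> and Kmax = Z])
      (use runs_count_prog[OF ou, where Kmax = Z] in \<open>simp_all add: \<kappa>_def S_def Z\<close>)
  define \<phi> where "\<phi> r c = concat (map (\<lambda>(a, b). tree_bits ?N g (tree_of g D (r, c, a, b)))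
       (filter (\<lambda>(a, b). conflict U H V (w ! (c + offset D r)) r a b) (pairs g)))" for r c
  define \<Phi> where "\<Phi> r = concat (map (\<phi> r) [0..<?N - offset D r])" for r
  let ?o = "([] @ block (replicate (Suc (?N * g)) True)) @ block (binary Z)"
  have 2: "runs (pass (trees_prog ou U H V g)) (main_store ou s w 0 0 0 0 Z 0 ?o)
    (main_store ou s w 0 0 0 0 (Z + 0 + 0 + 0) 0 (?o @ \<Phi> 0 @ \<Phi> 1 @ \<Phi> 2))
    (?N * (3 * (g * g * (?N * (g * 6 + 10) + 13)) + 38) + 10)"
    by (rule runs_pass[OF ou w D sep, where \<kappa> = "\<lambda>_ _. 0" and Kmax = Z and \<phi> = \<phi> and S = "\<lambda>_. 0" and \<Phi> = \<Phi>])
      (use runs_trees_prog[OF ou w] in \<open>simp_all add: \<phi>_def \<Phi>_def\<close>)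
  have 3: "concat (map (\<lambda>T. block (map (\<lambda>i. i \<in> T) [1..<Suc (Suc (?N * g))])) (tiling_trees U H V g D w))
      = \<Phi> 0 @ \<Phi> 1 @ \<Phi> 2"
  proof -
    have c: "concat (map h (concat xss)) = concat (map (\<lambda>xs. concat (map h xs)) xss)"
      for h :: "nat \<times> nat \<times> nat \<times> nat \<Rightarrow> bool list" and xss by (induction xss) auto
    show ?thesis
      by (simp add: tiling_trees_def quads_def tree_bits_def \<Phi>_def \<phi>_def[abs_def] c comp_def case_prod_unfold
        pairs_def[symmetric] del: upt_Suc)
  qed
  have 4: "encode_instance (Suc (?N * g)) (tiling_trees U H V g D w) Z = ?o @ \<Phi> 0 @ \<Phi> 1 @ \<Phi> 2"
    unfolding encode_instance_def 3 by simp
  have nil: "concat (map (\<lambda>c. []) xs) = []" for xs :: "nat list" by simp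
  have cnt: "runs (pass (count_prog (counted H V) g)) (main_store ou s w 0 0 0 0 0 0 []) (main_store ou s w 0 0 0 0 Z 0 [])
    (?N * (3 * (g * g * (6 * (?N * 3 * (g * g)) + 5)) + 38) + 10)"
    by (rule runs_conv[OF 1]) (use Zle in \<open>auto simp: nil Z intro!: mult_le_mono add_mono\<close>)
  have 5: "runs (print_counter ou) (main_store ou s w 0 0 0 0 Z 0 ([] @ block (replicate (Suc (?N * g)) True)))
    (main_store ou s w 0 0 0 0 Z 0 ?o) (10 * (?N * 3 * (g * g)) + 5)"
    by (rule runs_mono[OF runs_print_counter[OF ou]]) (use Zle in linarith)
  show ?thesis
    unfolding instance_prog_def Z_def[symmetric] 4 instance_time_def
    using 2 by (intro runs_Seq[OF cnt runs_Seq[OF runs_header_prog[OF ou w] runs_Seq[OF 5]]]) simp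
qed

section \<open>Preparing the word of cell types\<close>

abbreviation ruler :: "nat \<Rightarrow> int \<Rightarrow> nat" where "ruler n \<equiv> tape_of (replicate n (Suc 0))"

lemma ruler_pos_iff: "0 < ruler n z \<longleftrightarrow> 0 \<le> z \<and> z < int n"
  using tape_of_pos_iff[of "replicate n (Suc 0)"] by simp

lemma ruler_append: "(ruler n)(int n := 1) = ruler (Suc n)"
  using tape_of_append[of "replicate n (Suc 0)" 1] by (simp add: replicate_append_same)

lemma runs_rewind':
  assumes "s j = (tape_of ys, int h)" "0 \<notin> set ys" "h \<le> length ys" "3 * h + 3 \<le> B"
  shows "runs (rewind j) s (s(j := (tape_of ys, 0))) B"
proof -
  have "s = s(j := (tape_of ys, int h))" using assms(1) by auto
  then show ?thesis using runs_mono[OF runs_rewind[OF assms(2,3)] assms(4)] by metis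
qed

text \<open>A loop with as many iterations as the ruler on tape \<open>b\<close> is long. The head
  of tape \<open>b\<close> is the loop variable, and rewinding it makes the ruler available for
  further loops.\<close>

definition over :: "nat \<Rightarrow> prog \<Rightarrow> prog" where
  "over b p = Seq (Whl b nonblank (Seq p (Mv b 1))) (rewind b)"

lemma runs_over:
  assumes b: "\<And>i. \<tau> i b = (ruler n, 0)"
    and p: "\<And>i. i < n \<Longrightarrow> runs p ((\<tau> i)(b := (ruler n, int i))) ((\<tau> (Suc i))(b := (ruler n, int i))) B"
  shows "runs (over b p) (\<tau> 0) (\<tau> n) (n * (B + 6) + 4)"
proof -
  let ?\<sigma> = "\<lambda>i. (\<tau> i)(b := (ruler n, int i))"
  have "runs (Whl b nonblank (Seq p (Mv b 1))) (?\<sigma> 0) (?\<sigma> n) (n * ((B + 1) + 2) + 1)"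
  proof (rule runs_Whl[where \<sigma> = ?\<sigma>], intro conjI)
    fix i assume i: "i < n"
    show "rd (?\<sigma> i) b \<in> nonblank" using i by (simp add: ruler_pos_iff del: tape_of_nth)
    show "runs (Seq p (Mv b 1)) (?\<sigma> i) (?\<sigma> (Suc i)) (B + 1)"
      by (rule runs_Seq[OF p[OF i] runs_Mv]) (simp_all add: add.commute)
  qed (simp add: ruler_pos_iff)
  moreover have "runs (rewind b) (?\<sigma> n) (\<tau> n) (3 * n + 3)"
    by (rule runs_conv[OF runs_rewind'[where h = n and ys = "replicate n (Suc 0)"]]) (auto simp: b[symmetric])
  moreover have "?\<sigma> 0 = \<tau> 0" using b[of 0] by auto
  ultimately have "runs (over b p) (\<tau> 0) (\<tau> n) ((n * ((B + 1) + 2) + 1) + (3 * n + 3))"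
    unfolding over_def by (metis runs_Seq)
  then show ?thesis by (rule runs_mono) (simp add: algebra_simps)
qed

definition mult_prog :: "nat \<Rightarrow> nat \<Rightarrow> prog" where
  "mult_prog a b = Seq (over a (over 1 (Wr b 1 1))) (rewind b)"

lemma runs_mult_prog:
  assumes "s 1 = (ruler m, 0)" "s a = (ruler l, 0)" "s b = (tape_of [], 0)" "a \<noteq> b" "a \<noteq> 1" "b \<noteq> 1"
  shows "runs (mult_prog a b) s (s(b := (ruler (l * m), 0))) (l * (m * 10 + 10) + 7)"
proof -
  let ?\<tau> = "\<lambda>i. s(b := (ruler (i * m), int (i * m)))"
  have inner: "runs (over 1 (Wr b 1 1)) ((?\<tau> i)(a := (ruler l, int i))) ((?\<tau> (Suc i))(a := (ruler l, int i))) (m * (1 + 6) + 4)" for i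
  proof -
    let ?\<rho> = "\<lambda>z. s(a := (ruler l, int i), b := (ruler (i * m + z), int (i * m + z)))"
    have "runs (over 1 (Wr b 1 1)) (?\<rho> 0) (?\<rho> m) (m * (1 + 6) + 4)"
    proof (rule runs_over)
      show "?\<rho> z 1 = (ruler m, 0)" for z using assms by auto
      show "runs (Wr b 1 1) ((?\<rho> z)(1 := (ruler m, int z))) ((?\<rho> (Suc z))(1 := (ruler m, int z))) 1" for z
        by (rule runs_Wr) (use assms ruler_append[of "i * m + z"] in \<open>auto simp: fun_eq_iff wr_def\<close>)
    qed
    moreover have "?\<rho> 0 = (?\<tau> i)(a := (ruler l, int i))" "?\<rho> m = (?\<tau> (Suc i))(a := (ruler l, int i))"
      using assms by (auto simp: fun_eq_iff add.commute)
    ultimately show ?thesis by simp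
  qed
  have 1: "runs (over a (over 1 (Wr b 1 1))) (?\<tau> 0) (?\<tau> l) (l * ((m * (1 + 6) + 4) + 6) + 4)"
    by (rule runs_over[where \<tau> = ?\<tau>]) (use assms inner in auto)
  have 2: "runs (rewind b) (?\<tau> l) (s(b := (ruler (l * m), 0))) (3 * (l * m) + 3)"
    by (rule runs_conv[OF runs_rewind'[where h = "l * m" and ys = "replicate (l * m) (Suc 0)"]]) auto
  have "?\<tau> 0 = s" using assms by (auto simp: fun_eq_iff)
  then show ?thesis using runs_Seq[OF 1 2] unfolding mult_prog_def
    by (auto elim!: runs_mono simp: algebra_simps)
qed

text \<open>Tape \<open>i + 7\<close> receives a unary ruler of length \<open>m ^ i\<close>, where \<open>m\<close> is the length of the ruler on
  tape 1.\<close>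

fun powers_prog :: "nat \<Rightarrow> prog" where
  "powers_prog 0 = Wr 7 1 0"
| "powers_prog (Suc k) = Seq (powers_prog k) (mult_prog (k + 7) (k + 8))"

fun powers_time :: "nat \<Rightarrow> nat \<Rightarrow> nat" where
  "powers_time m 0 = 1"
| "powers_time m (Suc k) = powers_time m k + (m ^ k * (m * 10 + 10) + 7)"

lemma tape_of_single: "(tape_of [])(0 := 1) = tape_of [1]"
  by (auto simp: tape_of_def fun_eq_iff)

lemma runs_powers_prog:
  assumes "s 1 = (ruler m, 0)" "\<And>i. i \<le> k \<Longrightarrow> s (i + 7) = (tape_of [], 0)"
  shows "runs (powers_prog k) s (\<lambda>j. if 7 \<le> j \<and> j \<le> k + 7 then (ruler (m ^ (j - 7)), 0) else s j) (powers_time m k)"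
  using assms(2)
proof (induction k)
  case 0
  show ?case unfolding powers_prog.simps powers_time.simps
    by (rule runs_Wr) (use 0[of 0] tape_of_single in \<open>auto simp: fun_eq_iff wr_def\<close>)
next
  case (Suc k)
  let ?t = "\<lambda>k j. if 7 \<le> j \<and> j \<le> k + 7 then (ruler (m ^ (j - 7)), 0) else s j"
  have 1: "runs (powers_prog k) s (?t k) (powers_time m k)" using Suc by simp
  have 2: "runs (mult_prog (k + 7) (k + 8)) (?t k) ((?t k)(k + 8 := (ruler (m ^ k * m), 0))) (m ^ k * (m * 10 + 10) + 7)"
    using Suc.prems[of "Suc k"] assms(1) by (intro runs_mult_prog) (auto simp: add.commute)
  have "(?t k)(k + 8 := (ruler (m ^ k * m), 0)) = ?t (Suc k)"
    by (auto simp: fun_eq_iff le_Suc_eq ac_simps)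
  then show ?case using runs_Seq[OF 1 2] by simp
qed

section \<open>Writing the word of cell types\<close>

definition word_store :: "store \<Rightarrow> nat list \<Rightarrow> store" where
  "word_store s u = s(2 := (tape_of u, int (length u)), 3 := (tape_of u, int (length u)))"

lemma word_store_upd: "b \<noteq> 2 \<Longrightarrow> b \<noteq> 3 \<Longrightarrow> (word_store s u)(b := v) = word_store (s(b := v)) u"
  by (auto simp: word_store_def)

text \<open>The word is written in duplicate: tape 2 is swept once for every printed tree, while the
  head of tape 3 has to remain at the second cell of the current pair.\<close>

definition put :: "nat \<Rightarrow> prog" where "put a = Seq (Wr 2 a 1) (Wr 3 a 1)"

lemma runs_put: "runs (put a) (word_store s u) (word_store s (u @ [a])) 2"
proof -
  have "runs (put a) (word_store s u) (word_store s (u @ [a])) (1 + 1)"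
    unfolding put_def
    by (rule runs_Seq[OF runs_Wr[OF refl order_refl] runs_Wr]) (simp_all add: word_store_def wr_def fun_upd_twist add.commute)
  then show ?thesis by (rule runs_mono) simp
qed

text \<open>The types are laid out so that the symbol 0, 1 or 2 under the input head is added to a
  base \<open>a\<close>. The head may run past the input, where it reads the blank.\<close>

definition putx :: "nat \<Rightarrow> prog" where
  "putx a = Seq (Ift 0 {0} (put a) (Ift 0 {1} (put (a + 1)) (put (a + 2)))) (Mv 0 1)"

lemma runs_putx:
  assumes "s 0 = (tape_of xs, i)" "set xs \<subseteq> {0, 1, 2}"
  shows "runs (putx a) (word_store s u) (word_store (s(0 := (tape_of xs, i + 1))) (u @ [a + tape_of xs i])) 7"
proof -
  have r: "rd (word_store s u) 0 = tape_of xs i" using assms by (simp add: rd_def word_store_def)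
  have "tape_of xs i \<in> {0, 1, 2}" using assms(2) by (auto simp: tape_of_def dest!: nth_mem)
  then have 1: "runs (Ift 0 {0} (put a) (Ift 0 {1} (put (a + 1)) (put (a + 2)))) (word_store s u) (word_store s (u @ [a + tape_of xs i])) (2 + 2 + 2)"
    by (intro runs_Ift) (auto simp: r runs_put intro: runs_mono[OF runs_put])
  have 2: "runs (Mv 0 1) (word_store s (u @ [a + tape_of xs i])) (word_store (s(0 := (tape_of xs, i + 1))) (u @ [a + tape_of xs i])) 1"
    by (rule runs_Mv) (use assms in \<open>auto simp: word_store_def mv_def fun_eq_iff\<close>)
  show ?thesis using runs_Seq[OF 1 2] unfolding putx_def by (auto elim: runs_mono)
qed

lemma runs_over_put:
  assumes "s b = (ruler n, 0)" "3 < b"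
  shows "runs (over b (put a)) (word_store s u) (word_store s (u @ replicate n a)) (n * 8 + 4)"
proof -
  have "runs (over b (put a)) (word_store s (u @ replicate 0 a)) (word_store s (u @ replicate n a)) (n * (2 + 6) + 4)"
  proof (rule runs_over[where \<tau> = "\<lambda>i. word_store s (u @ replicate i a)"])
    show "word_store s (u @ replicate i a) b = (ruler n, 0)" for i using assms by (simp add: word_store_def)
    show "runs (put a) ((word_store s (u @ replicate i a))(b := (ruler n, int i))) ((word_store s (u @ replicate (Suc i) a))(b := (ruler n, int i))) 2"
      for i using assms runs_put[of a "s(b := (ruler n, int i))" "u @ replicate i a"]
      by (simp add: word_store_upd replicate_append_same)
  qed
  then show ?thesis by simp
qed

text \<open>
  Cell types: 1 is the first cell of the diagram, \<open>2 + a\<close> a cell of the initial row with symbol \<open>a\<close>,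
  \<open>5 + a\<close> the cell of the initial row under the heads, 8 the first cell of a later row, 9 any other
  cell, 10 the final cell, which must show the accepting state.
\<close>

definition row0_prog :: "nat \<Rightarrow> prog" where
  "row0_prog b = Seq (put 1) (Seq (over b (put 2)) (Seq (putx 5) (over b (putx 2))))"

text \<open>Position \<open>i\<close> stands for tape cell \<open>i - (W + 1)\<close>. The input
  begins in cell 0, so everything to the left of it is blank.\<close>

definition row0 :: "nat list \<Rightarrow> nat \<Rightarrow> nat list" where
  "row0 xs W = 1 # replicate W 2 @ (5 + tape_of xs 0) # map (\<lambda>i. 2 + tape_of xs (int (Suc i))) [0..<W]"

lemma runs_row0_prog:
  assumes "s b = (ruler W, 0)" "3 < b" "s 0 = (tape_of xs, 0)" "set xs \<subseteq> {0, 1, 2}"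
  shows "runs (row0_prog b) (word_store s []) (word_store (s(0 := (tape_of xs, int (Suc W)))) (row0 xs W)) (W * 21 + 17)"
proof -
  let ?u = "([] @ [1]) @ replicate W 2"
  let ?u' = "?u @ [5 + tape_of xs 0]"
  let ?\<tau> = "\<lambda>i. word_store (s(0 := (tape_of xs, int (Suc i)))) (?u' @ map (\<lambda>i. 2 + tape_of xs (int (Suc i))) [0..<i])"
  have 1: "runs (over b (put 2)) (word_store s ([] @ [1])) (word_store s ?u) (W * 8 + 4)"
    by (rule runs_over_put) (use assms in auto)
  have 2: "runs (putx 5) (word_store s ?u) (word_store (s(0 := (tape_of xs, 0 + 1))) ?u') 7"
    by (rule runs_putx) (use assms in auto)
  have 3: "runs (over b (putx 2)) (?\<tau> 0) (?\<tau> W) (W * (7 + 6) + 4)"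
  proof (rule runs_over[where \<tau> = ?\<tau>])
    show "?\<tau> i b = (ruler W, 0)" for i using assms by (simp add: word_store_def)
    fix i
    let ?v = "?u' @ map (\<lambda>i. 2 + tape_of xs (int (Suc i))) [0..<i]"
    have "runs (putx 2) (word_store (s(0 := (tape_of xs, int (Suc i)), b := (ruler W, int i))) ?v)
      (word_store (s(0 := (tape_of xs, int (Suc i)), b := (ruler W, int i), 0 := (tape_of xs, int (Suc i) + 1))) (?v @ [2 + tape_of xs (int (Suc i))])) 7"
      by (rule runs_putx) (use assms in auto)
    moreover have "s(0 := (tape_of xs, int (Suc i)), b := (ruler W, int i), 0 := (tape_of xs, int (Suc i) + 1)) =
      s(0 := (tape_of xs, int (Suc (Suc i))), b := (ruler W, int i))" using assms by (auto simp: fun_eq_iff)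
    ultimately show "runs (putx 2) ((?\<tau> i)(b := (ruler W, int i))) ((?\<tau> (Suc i))(b := (ruler W, int i))) 7"
      using assms by (simp add: word_store_upd)
  qed
  have "word_store (s(0 := (tape_of xs, 0 + 1))) ?u' = ?\<tau> 0" by simp
  note chain = runs_Seq[OF runs_put runs_Seq[OF 1 runs_Seq[OF 2[unfolded this] 3]]]
  show ?thesis unfolding row0_prog_def by (rule runs_conv[OF chain]) (simp_all add: row0_def)
qed

definition row_word :: "nat \<Rightarrow> nat list" where
  "row_word W = 8 # replicate W 9 @ 9 # replicate W 9"

definition rows_prog :: "nat \<Rightarrow> prog" where
  "rows_prog b = Seq (put 8) (Seq (over b (put 9)) (Seq (put 9) (over b (put 9))))"

lemma runs_rows_prog:
  assumes "s b = (ruler W, 0)" "3 < b"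
  shows "runs (rows_prog b) (word_store s u) (word_store s (u @ row_word W)) (W * 16 + 12)"
  unfolding rows_prog_def
proof -
  have p: "runs (over b (put 9)) (word_store s v) (word_store s (v @ replicate W 9)) (W * 8 + 4)" for v
    by (rule runs_over_put) (use assms in auto)
  show "runs (Seq (put 8) (Seq (over b (put 9)) (Seq (put 9) (over b (put 9))))) (word_store s u)
    (word_store s (u @ row_word W)) (W * 16 + 12)"
    by (rule runs_conv[OF runs_Seq[OF runs_put runs_Seq[OF p runs_Seq[OF runs_put p]]]])
      (simp_all add: row_word_def)
qed

text \<open>After the rows 0 to \<open>T\<close> a single cell follows. It is the beginning of a
  further row and suffices to inspect the state reached, because every tile carries the transition
  and hence the state.\<close>

definition type_word :: "bool list \<Rightarrow> nat \<Rightarrow> nat \<Rightarrow> nat list" where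
  "type_word x W T = row0 (map bit_symbol x) W @ concat (replicate T (row_word W)) @ [10]"

definition word_prog :: "nat \<Rightarrow> nat \<Rightarrow> prog" where
  "word_prog a b = Seq (row0_prog b) (Seq (over a (rows_prog b)) (Seq (put 10) (Seq (rewind 2) (rewind 3))))"

lemma concat_replicate_Suc: "concat (replicate (Suc i) r) = concat (replicate i r) @ r"
  by (induction i) auto

text \<open>The loops over the word stop at the blank 0.\<close>

lemma type_word_nonzero: "0 \<notin> set (type_word x W T)"
  by (auto simp: type_word_def row0_def row_word_def)

lemma length_type_word: "length (type_word x W T) = (2 * W + 2) * Suc T + 1"
proof -
  have "length (concat (replicate T (row_word W))) = (2 * W + 2) * T"
    by (induction T) (auto simp: row_word_def)
  then show ?thesis by (simp add: type_word_def row0_def)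
qed

lemma runs_word_prog:
  assumes "s a = (ruler T, 0)" "s b = (ruler W, 0)" "3 < a" "3 < b" "a \<noteq> b" "s 0 = (tape_of (map bit_symbol x), 0)"
    "s 2 = (tape_of [], 0)" "s 3 = (tape_of [], 0)"
  shows "runs (word_prog a b) s (s(0 := (tape_of (map bit_symbol x), int (Suc W)),
     2 := (tape_of (type_word x W T), 0), 3 := (tape_of (type_word x W T), 0)))
    (W * 21 + 17 + (T * (W * 16 + 18) + 4) + 2 + 2 * (3 * length (type_word x W T) + 3))"
proof -
  let ?xs = "map bit_symbol x" and ?w = "type_word x W T"
  let ?s = "s(0 := (tape_of ?xs, int (Suc W)))"
  have s: "word_store s [] = s" using assms by (auto simp: word_store_def fun_eq_iff)
  have 1: "runs (row0_prog b) s (word_store ?s (row0 ?xs W)) (W * 21 + 17)"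
  proof -
    have "set ?xs \<subseteq> {0, 1, 2}" by (auto simp: bit_symbol_def)
    then show ?thesis using runs_row0_prog[of s b W ?xs] assms unfolding s by blast
  qed
  let ?\<tau> = "\<lambda>i. word_store ?s (row0 ?xs W @ concat (replicate i (row_word W)))"
  have 2: "runs (over a (rows_prog b)) (?\<tau> 0) (?\<tau> T) (T * ((W * 16 + 12) + 6) + 4)"
  proof (rule runs_over[where \<tau> = ?\<tau>])
    show "?\<tau> i a = (ruler T, 0)" for i using assms by (simp add: word_store_def)
    show "runs (rows_prog b) ((?\<tau> i)(a := (ruler T, int i))) ((?\<tau> (Suc i))(a := (ruler T, int i))) (W * 16 + 12)" for i
      using runs_rows_prog[of "?s(a := (ruler T, int i))" b W "row0 ?xs W @ concat (replicate i (row_word W))"] assms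
      unfolding concat_replicate_Suc by (simp add: word_store_upd)
  qed
  have 3: "runs (put 10) (?\<tau> T) (word_store ?s ?w) 2"
    by (rule runs_conv[OF runs_put]) (simp_all add: type_word_def)
  let ?n = "length ?w"
  have 4: "runs (rewind 2) (word_store ?s ?w) (?s(2 := (tape_of ?w, 0), 3 := (tape_of ?w, int ?n))) (3 * ?n + 3)"
    by (rule runs_conv[OF runs_rewind'[where h = ?n and ys = ?w]])
      (auto simp: word_store_def type_word_nonzero fun_eq_iff)
  have 5: "runs (rewind 3) (?s(2 := (tape_of ?w, 0), 3 := (tape_of ?w, int ?n))) (?s(2 := (tape_of ?w, 0), 3 := (tape_of ?w, 0))) (3 * ?n + 3)"
    by (rule runs_conv[OF runs_rewind'[where h = ?n and ys = ?w]])
      (auto simp: type_word_nonzero fun_eq_iff)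
  have "word_store ?s (row0 ?xs W) = ?\<tau> 0" by simp
  note chain = runs_Seq[OF 1[unfolded this] runs_Seq[OF 2 runs_Seq[OF 3 runs_Seq[OF 4 5]]]]
  show ?thesis unfolding word_prog_def by (rule runs_conv[OF chain]) simp_all
qed

text \<open>The two extra marks give a ruler of length at least 2 even for the empty input; powers
  of such a base dominate every polynomial.\<close>

definition ruler_prog :: prog where
  "ruler_prog = Seq (Whl 0 nonblank (Seq (Mv 0 1) (Wr 1 1 1)))
     (Seq (Wr 1 1 1) (Seq (Wr 1 1 1) (Seq (rewind 0) (rewind 1))))"

lemma runs_ruler_prog:
  assumes "s 0 = (tape_of xs, 0)" "0 \<notin> set xs" "s 1 = (tape_of [], 0)"
  shows "runs ruler_prog s (s(1 := (ruler (length xs + 2), 0))) (length xs * 10 + 15)"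
proof -
  let ?n = "length xs"
  let ?\<sigma> = "\<lambda>i. s(0 := (tape_of xs, int i), 1 := (ruler i, int i))"
  have 1: "runs (Whl 0 nonblank (Seq (Mv 0 1) (Wr 1 1 1))) (?\<sigma> 0) (?\<sigma> ?n) (?n * ((1 + 1) + 2) + 1)"
  proof (rule runs_Whl[where \<sigma> = ?\<sigma>], intro conjI)
    fix i assume i: "i < ?n"
    then show "rd (?\<sigma> i) 0 \<in> nonblank" using assms by (simp add: tape_of_pos_iff del: tape_of_nth)
    show "runs (Seq (Mv 0 1) (Wr 1 1 1)) (?\<sigma> i) (?\<sigma> (Suc i)) (1 + 1)"
      by (rule runs_Seq[OF runs_Mv[OF refl order_refl] runs_Wr])
        (use ruler_append[of i] in \<open>auto simp: fun_eq_iff wr_def mv_def\<close>)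
  qed (use assms in simp)
  have w: "runs (Wr 1 1 1) (s(0 := (tape_of xs, int ?n), 1 := (ruler m, int m))) (s(0 := (tape_of xs, int ?n), 1 := (ruler (Suc m), int (Suc m)))) 1" for m
    by (rule runs_Wr) (use ruler_append[of m] in \<open>auto simp: fun_eq_iff wr_def\<close>)
  let ?m = "Suc (Suc ?n)"
  have 2: "runs (rewind 0) (s(0 := (tape_of xs, int ?n), 1 := (ruler ?m, int ?m))) (s(1 := (ruler ?m, int ?m))) (3 * ?n + 3)"
    by (rule runs_conv[OF runs_rewind'[where h = ?n and ys = xs]]) (use assms in \<open>auto simp: fun_eq_iff\<close>)
  have 3: "runs (rewind 1) (s(1 := (ruler ?m, int ?m))) (s(1 := (ruler ?m, 0))) (3 * ?m + 3)"
    by (rule runs_conv[OF runs_rewind'[where h = ?m and ys = "replicate ?m (Suc 0)"]]) (auto simp: fun_eq_iff)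
  have "?\<sigma> 0 = s" using assms by (auto simp: fun_eq_iff)
  note chain = runs_Seq[OF 1[unfolded this] runs_Seq[OF w runs_Seq[OF w runs_Seq[OF 2 3]]]]
  show ?thesis unfolding ruler_prog_def by (rule runs_conv[OF chain]) simp_all
qed

text \<open>The last two rulers, on tapes \<open>e + 7\<close> and \<open>e + 8\<close>, have
  lengths \<open>(n + 2) ^ e\<close> and \<open>(n + 2) ^ Suc e\<close>; they give the height and
  the half width of the diagram. The two final writes set the marks of the pointers.\<close>

definition prepare_prog :: "nat \<Rightarrow> prog" where
  "prepare_prog e = Seq ruler_prog (Seq (powers_prog (Suc e)) (Seq (word_prog (e + 7) (e + 8))
     (Seq (Wr 4 1 0) (Wr 5 1 0))))"

definition prepare_time :: "nat \<Rightarrow> nat \<Rightarrow> nat" where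
  "prepare_time e n = n * 10 + 17 + powers_time (n + 2) (Suc e) +
    ((n + 2) ^ Suc e * 21 + 17 + ((n + 2) ^ e * ((n + 2) ^ Suc e * 16 + 18) + 4) + 2 +
     2 * (3 * ((2 * (n + 2) ^ Suc e + 2) * Suc ((n + 2) ^ e) + 1) + 3))"

lemma init_store_tape_of: "init_store x = (\<lambda>i. (tape_of [], 0))(0 := (tape_of (map bit_symbol x), 0))"
  by (auto simp: init_store_def tape_of_def fun_eq_iff)

lemma runs_prepare_prog:
  assumes n: "n = length x"
  obtains s where "runs (prepare_prog e) (init_store x)
    (main_store (e + 9) s (type_word x ((n + 2) ^ Suc e) ((n + 2) ^ e)) 0 0 0 0 0 0 []) (prepare_time e n)"
proof -
  let ?W = "(n + 2) ^ Suc e" and ?T = "(n + 2) ^ e"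
  let ?w = "type_word x ?W ?T"
  let ?s1 = "(init_store x)(1 := (ruler (n + 2), 0))"
  have 1: "runs ruler_prog (init_store x) ?s1 (n * 10 + 15)"
    using runs_ruler_prog[of "init_store x" "map bit_symbol x"] by (simp add: init_store_tape_of n)
  define s2 where "s2 = (\<lambda>j. if 7 \<le> j \<and> j \<le> Suc e + 7 then (ruler ((n + 2) ^ (j - 7)), 0) else ?s1 j)"
  have 2: "runs (powers_prog (Suc e)) ?s1 s2 (powers_time (n + 2) (Suc e))"
    unfolding s2_def by (rule runs_powers_prog) (auto simp: init_store_tape_of)
  let ?s3 = "s2(0 := (tape_of (map bit_symbol x), int (Suc ?W)), 2 := (tape_of ?w, 0), 3 := (tape_of ?w, 0))"
  have 3: "runs (word_prog (e + 7) (e + 8)) s2 ?s3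
    (?W * 21 + 17 + (?T * (?W * 16 + 18) + 4) + 2 + 2 * (3 * length ?w + 3))"
    by (rule runs_word_prog) (auto simp: s2_def init_store_tape_of)
  have 4: "runs (Wr 4 1 0) ?s3 (?s3(4 := (tape_of [1], 0))) 1"
    by (rule runs_Wr) (use tape_of_single in \<open>auto simp: s2_def init_store_tape_of wr_def fun_eq_iff\<close>)
  have 5: "runs (Wr 5 1 0) (?s3(4 := (tape_of [1], 0))) (?s3(4 := (tape_of [1], 0), 5 := (tape_of [1], 0))) 1"
    by (rule runs_Wr) (use tape_of_single in \<open>auto simp: s2_def init_store_tape_of wr_def fun_eq_iff\<close>)
  have "?s3(4 := (tape_of [1], 0), 5 := (tape_of [1], 0)) = main_store (e + 9) ?s3 ?w 0 0 0 0 0 0 []"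
    by (auto simp: main_store_def s2_def init_store_tape_of fun_eq_iff)
  note chain = runs_Seq[OF 1 runs_Seq[OF 2 runs_Seq[OF 3 runs_Seq[OF 4 5[unfolded this]]]]]
  have "runs (prepare_prog e) (init_store x) (main_store (e + 9) ?s3 ?w 0 0 0 0 0 0 []) (prepare_time e n)"
    unfolding prepare_prog_def
    by (rule runs_conv[OF chain]) (simp_all add: prepare_time_def length_type_word)
  then show ?thesis by (rule that)
qed

section \<open>Tilings and computations\<close>

type_synonym transition = "(nat \<times> nat list) \<times> (nat \<times> (nat \<times> int) list)"
type_synonym tile = "bool \<times> transition \<times> (nat \<times> int) list"

text \<open>The bound is 2 and not 1 since the values -1 and 1 have to be exact: after a step the
  new head position is described by its distance from the old column. The values -2 and 2 only tell
  on which side the head lies.\<close>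

definition clip :: "int \<Rightarrow> int" where "clip z = max (-2) (min 2 z)"

text \<open>The accepting state may idle, so that runs can be prolonged to the height of the diagram.\<close>

definition tm_moves :: "tm \<Rightarrow> transition set" where
  "tm_moves M = tm_trans M \<union> (\<lambda>rs. ((1, rs), (1, keep rs))) ` reads (tm_tapes M) (tm_symbols M)"

text \<open>The heads of the tapes stand in different columns, so no single tile sees all symbols
  read. The last condition has each tape checked separately, in the column of its own head, against
  the transition shared by the row.\<close>

definition tiles :: "tm \<Rightarrow> tile set" where
  "tiles M = {(fl, tr, cs). tr \<in> tm_moves M \<and> length cs = tm_tapes M \<and>
     (\<forall>(s, d)\<in>set cs. s < tm_symbols M \<and> d \<in> {-2..2}) \<and>
     (\<forall>j<tm_tapes M. snd (cs ! j) = 0 \<longrightarrow> fst (cs ! j) = snd (fst tr) ! j)}"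

text \<open>The first component of a tile marks the start of a row, where the horizontal constraint is void.\<close>

fun hcompat :: "nat \<Rightarrow> tile \<Rightarrow> tile \<Rightarrow> bool" where
  "hcompat K (fl, tr, cs) (fl', tr', cs') \<longleftrightarrow> fl' \<or> (tr = tr' \<and>
     (\<forall>j<K. \<exists>e. snd (cs ! j) = clip e \<and> snd (cs' ! j) = clip (e - 1)))"

text \<open>Under a head the transition prescribes symbol and displacement, and the displacement is
  exactly the distance of the moved head from this column. Elsewhere only the symbol is copied; the
  distances there follow from the horizontal constraint.\<close>

fun vcompat :: "nat \<Rightarrow> tile \<Rightarrow> tile \<Rightarrow> bool" where
  "vcompat K (fl, tr, cs) (fl', tr', cs') \<longleftrightarrow> fst (fst tr') = fst (snd tr) \<and>
     (\<forall>j<K. if snd (cs ! j) = 0 then cs' ! j = snd (snd tr) ! j else fst (cs' ! j) = fst (cs ! j))"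

text \<open>For type 1 the truncated subtraction yields 0, as it should: the first cell of the
  initial row is blank.\<close>

definition init_symbol :: "nat \<Rightarrow> nat" where
  "init_symbol y = (if 5 \<le> y then y - 5 else y - 2)"

text \<open>The heads are fixed in one column of the initial row only, that of tape cell 0;
  \<open>hcompat\<close> determines the distances in the rest of the row.\<close>

fun ucompat :: "nat \<Rightarrow> nat \<Rightarrow> tile \<Rightarrow> bool" where
  "ucompat K y (fl, tr, cs) \<longleftrightarrow> (fl \<longleftrightarrow> y \<in> {1, 8, 10}) \<and>
     (y \<le> 7 \<longrightarrow> fst (fst tr) = 0 \<and> (\<forall>j<K. fst (cs ! j) = (if j = 0 then init_symbol y else 0))) \<and>
     (y \<in> {5, 6, 7} \<longrightarrow> (\<forall>j<K. snd (cs ! j) = 0)) \<and>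
     (y = 10 \<longrightarrow> fst (fst tr) = 1)"

lemma clip_eq_0_iff [simp]: "clip z = 0 \<longleftrightarrow> z = 0" by (auto simp: clip_def)

text \<open>The values -1, 0 and 1 are exact, so next to the head the neighbouring values are
  forced. To the right of the anchor the distance only falls and to the left it only grows, so once
  -2 or 2 is reached the value stays there.\<close>

lemma clip_propagate:
  fixes d :: "nat \<Rightarrow> int"
  assumes adj: "\<And>i. Suc i < D \<Longrightarrow> \<exists>e. d i = clip e \<and> d (Suc i) = clip (e - 1)"
    and i0: "i0 < D" "d i0 = clip (h - int i0)" "\<bar>h - int i0\<bar> \<le> 1"
    and i: "i < D"
  shows "d i = clip (h - int i)"
proof (cases "i0 \<le> i")
  case True
  then show ?thesis using i
  proof (induction i rule: dec_induct)
    case (step i)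
    obtain e where "d i = clip e" "d (Suc i) = clip (e - 1)" using adj[of i] step by auto
    moreover have "d i = clip (h - int i)" "h - int i \<le> 1" using step i0 by auto
    ultimately show ?case by (auto simp: clip_def)
  qed (rule i0)
next
  case False
  then have "i \<le> i0" by simp
  then show ?thesis using i0(1)
  proof (induction i rule: inc_induct)
    case (step i)
    obtain e where "d i = clip e" "d (Suc i) = clip (e - 1)" using adj[of i] step by auto
    moreover have "d (Suc i) = clip (h - int (Suc i))" "h - int (Suc i) \<ge> -1" using step i0 by auto
    ultimately show ?case by (auto simp: clip_def)
  qed (rule i0)
qed

section \<open>Finiteness of the set of tiles\<close>

lemma finite_reads: "finite (reads K G)"
proof -
  have "reads K G = {rs. set rs \<subseteq> {..<G} \<and> length rs = K}" by (auto simp: reads_def)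
  then show ?thesis by (simp add: finite_lists_length_eq)
qed

lemma finite_valid_writes: "finite {ws. valid_writes K G ws}"
proof (rule finite_subset)
  show "{ws. valid_writes K G ws} \<subseteq> {ws. set ws \<subseteq> {..<G} \<times> {-1, 0, 1} \<and> length ws = K}"
    by (auto simp: valid_writes_def)
qed (simp add: finite_lists_length_eq)

lemma wf_tm_trans:
  assumes "wf_tm M" "((q, rs), (q', ws)) \<in> tm_trans M"
  shows "q < tm_states M" "q \<noteq> 1" "q' < tm_states M" "rs \<in> reads (tm_tapes M) (tm_symbols M)"
    "valid_writes (tm_tapes M) (tm_symbols M) ws"
  using assms by (auto simp: wf_tm_def reads_def valid_writes_def)

lemma tm_moves_ok:
  assumes "wf_tm M" "((q, rs), (q', ws)) \<in> tm_moves M"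
  shows "rs \<in> reads (tm_tapes M) (tm_symbols M)" "valid_writes (tm_tapes M) (tm_symbols M) ws"
  using assms wf_tm_trans[OF assms(1)] by (auto simp: tm_moves_def valid_writes_keep)

lemma finite_tiles:
  assumes M: "wf_tm M"
  shows "finite (tiles M)"
proof -
  let ?K = "tm_tapes M" and ?G = "tm_symbols M"
  have "tm_trans M \<subseteq> ({..<tm_states M} \<times> reads ?K ?G) \<times> ({..<tm_states M} \<times> {ws. valid_writes ?K ?G ws})"
    using wf_tm_trans[OF M] by auto
  then have "finite (tm_moves M)"
    unfolding tm_moves_def using finite_reads finite_valid_writes by (auto intro: finite_subset)
  moreover have "finite {cs. set cs \<subseteq> {..<?G} \<times> {-2..2::int} \<and> length cs = ?K}"
    by (simp add: finite_lists_length_eq)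
  moreover have "tiles M \<subseteq> UNIV \<times> tm_moves M \<times> {cs. set cs \<subseteq> {..<?G} \<times> {-2..2::int} \<and> length cs = ?K}"
    by (fastforce simp: tiles_def)
  ultimately show ?thesis by (meson finite_SigmaI finite_subset finite_UNIV)
qed

text \<open>The witness idles in the accepting state, with all heads in its cell and all tapes blank
  there.\<close>

lemma tiles_nonempty:
  assumes "wf_tm M"
  shows "tiles M \<noteq> {}"
proof -
  let ?K = "tm_tapes M"
  have "(True, ((1, replicate ?K 0), (1, keep (replicate ?K 0))), replicate ?K (0, 0)) \<in> tiles M"
    using assms by (auto simp: tiles_def tm_moves_def reads_def wf_tm_def intro!: imageI)
  then show ?thesis by blast
qed

definition tiling :: "tm \<Rightarrow> nat \<Rightarrow> nat list \<Rightarrow> (nat \<Rightarrow> tile) \<Rightarrow> bool" where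
  "tiling M D w S \<longleftrightarrow> (\<forall>c<length w. S c \<in> tiles M \<and> ucompat (tm_tapes M) (w ! c) (S c) \<and>
     (c + 1 < length w \<longrightarrow> hcompat (tm_tapes M) (S c) (S (c + 1))) \<and>
     (c + D < length w \<longrightarrow> vcompat (tm_tapes M) (S c) (S (c + D))))"

text \<open>The vertices name a tile by its position in a list. A tile may occur there several
  times, since each direction uses only that some position holds it.\<close>

lemma tileable_iff_tiling:
  assumes "set ts = tiles M"
  shows "tileable (\<lambda>y a. ucompat (tm_tapes M) y (ts ! a)) (\<lambda>a b. hcompat (tm_tapes M) (ts ! a) (ts ! b))
    (\<lambda>a b. vcompat (tm_tapes M) (ts ! a) (ts ! b)) (length ts) D w \<longleftrightarrow> (\<exists>S. tiling M D w S)" (is "?L \<longleftrightarrow> ?R")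
proof
  assume ?L
  then obtain s where s: "\<forall>c<length w. s c < length ts \<and> ucompat (tm_tapes M) (w ! c) (ts ! s c) \<and>
     (c + 1 < length w \<longrightarrow> hcompat (tm_tapes M) (ts ! s c) (ts ! s (c + 1))) \<and>
     (c + D < length w \<longrightarrow> vcompat (tm_tapes M) (ts ! s c) (ts ! s (c + D)))"
    unfolding tileable_def by blast
  then have "tiling M D w (\<lambda>c. ts ! s c)" unfolding tiling_def assms[symmetric] by simp
  then show ?R by blast
next
  assume ?R
  then obtain S where S: "tiling M D w S" by blast
  then have "\<forall>c. \<exists>a. c < length w \<longrightarrow> a < length ts \<and> ts ! a = S c"
    unfolding tiling_def assms[symmetric] by (metis in_set_conv_nth)
  then obtain s where s: "\<And>c. c < length w \<Longrightarrow> s c < length ts \<and> ts ! s c = S c" by metis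
  show ?L unfolding tileable_def using S s by (intro exI[of _ s]) (simp add: tiling_def)
qed

lemma nth_concat_replicate:
  assumes "t < T" "i < length r"
  shows "concat (replicate T r) ! (t * length r + i) = r ! i"
  using assms
proof (induction t arbitrary: T)
  case 0
  then show ?case by (cases T) (auto simp: nth_append)
next
  case (Suc t)
  then show ?case by (cases T) (auto simp: nth_append)
qed

lemma type_word_nth:
  assumes "D = 2 * W + 2" "i < D"
  shows "type_word x W T ! i = (if i = 0 then 1 else if i = W + 1 then 5 + tape_of (map bit_symbol x) 0
      else 2 + tape_of (map bit_symbol x) (int i - int (W + 1)))"
    "t < T \<Longrightarrow> type_word x W T ! (Suc t * D + i) = (if i = 0 then 8 else 9)"
    "type_word x W T ! (Suc T * D) = 10"
proof -
  let ?xs = "map bit_symbol x"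
  have l0: "length (row0 ?xs W) = D" and l1: "length (row_word W) = D"
    using assms by (simp_all add: row0_def row_word_def)
  have lc: "length (concat (replicate T (row_word W))) = T * D"
    using l1 by (induction T) auto
  have "row0 ?xs W ! i = (if i = 0 then 1 else if i = W + 1 then 5 + tape_of ?xs 0 else 2 + tape_of ?xs (int i - int (W + 1)))"
  proof -
    consider "i = 0" | "0 < i" "i \<le> W" | "i = W + 1" | "W + 1 < i" by linarith
    then show ?thesis
    proof cases
      case 4
      then have "i - Suc (Suc W) < W" "int (Suc (i - Suc (Suc W))) = int i - int (W + 1)" using assms by auto
      then show ?thesis using 4 by (simp add: row0_def nth_append nth_Cons' del: of_nat_Suc of_nat_add)
    qed (simp_all add: row0_def nth_append nth_Cons')
  qed
  then show "type_word x W T ! i = (if i = 0 then 1 else if i = W + 1 then 5 + tape_of (map bit_symbol x) 0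
      else 2 + tape_of (map bit_symbol x) (int i - int (W + 1)))"
    using assms(2) l0 by (simp add: type_word_def nth_append)
  show "type_word x W T ! (Suc T * D) = 10"
    using l0 lc by (simp add: type_word_def nth_append)
  show "type_word x W T ! (Suc t * D + i) = (if i = 0 then 8 else 9)" if t: "t < T"
  proof -
    have "t * D + i < T * D"
    proof -
      have "t * D + i < Suc t * D" using assms(2) by simp
      also have "\<dots> \<le> T * D" using t by (intro mult_le_mono1) simp
      finally show ?thesis .
    qed
    then have "type_word x W T ! (Suc t * D + i) = row_word W ! i"
      using l0 lc l1 nth_concat_replicate[OF t, of i "row_word W"] assms(2)
      by (simp add: type_word_def nth_append)
    also have "\<dots> = (if i = 0 then 8 else 9)"
      using assms by (auto simp: row_word_def nth_append nth_Cons')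
    finally show ?thesis .
  qed
qed

lemma tape_of_bits_le: "tape_of (map bit_symbol x) z \<le> 2"
  by (auto simp: tape_of_def bit_symbol_def)

lemma init_conf_tape: "conf_tape (init_conf x) j z = (if j = 0 then tape_of (map bit_symbol x) z else 0)"
  by (auto simp: init_conf_def tape_of_def)

section \<open>From tilings to accepting computations\<close>

definition apply_move :: "nat \<Rightarrow> nat \<Rightarrow> (nat \<times> int) list \<Rightarrow> conf \<Rightarrow> conf" where
  "apply_move K q ws c = \<lparr>conf_state = q,
     conf_tape = (\<lambda>j. if j < K then (conf_tape c j)(conf_head c j := fst (ws ! j)) else conf_tape c j),
     conf_head = (\<lambda>j. if j < K then conf_head c j + snd (ws ! j) else conf_head c j)\<rparr>"

definition conf_reads :: "nat \<Rightarrow> conf \<Rightarrow> nat list" where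
  "conf_reads K c = map (\<lambda>j. conf_tape c j (conf_head c j)) [0..<K]"

lemma tm_step_iff: "(c, c') \<in> tm_step M \<longleftrightarrow> (\<exists>q' ws. ((conf_state c, conf_reads (tm_tapes M) c), (q', ws)) \<in> tm_trans M \<and>
    c' = apply_move (tm_tapes M) q' ws c)"
  by (simp add: tm_step_def apply_move_def conf_reads_def)

lemma apply_move_keep:
  "apply_move K (conf_state c) (keep (conf_reads K c)) c = c"
  by (cases c) (auto simp: apply_move_def keep_def conf_reads_def fun_eq_iff)

text \<open>Idling leaves the configuration unchanged and thus corresponds to no step at all, whence
  the reflexive closure.\<close>

lemma tm_moves_step:
  assumes "((conf_state c, conf_reads (tm_tapes M) c), (q', ws)) \<in> tm_moves M"
  shows "(c, apply_move (tm_tapes M) q' ws c) \<in> (tm_step M)\<^sup>*"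
  using assms unfolding tm_moves_def
proof
  assume "((conf_state c, conf_reads (tm_tapes M) c), (q', ws)) \<in> tm_trans M"
  then show ?thesis by (intro r_into_rtrancl) (auto simp: tm_step_iff)
next
  assume "((conf_state c, conf_reads (tm_tapes M) c), (q', ws))
    \<in> (\<lambda>rs. ((1, rs), (1, keep rs))) ` reads (tm_tapes M) (tm_symbols M)"
  then have "q' = conf_state c" "ws = keep (conf_reads (tm_tapes M) c)" by auto
  then show ?thesis by (simp add: apply_move_keep)
qed

text \<open>The configurations are obtained by following the transitions of the rows, and each row
  is shown to display its configuration. \<open>T \<le> W\<close> keeps the heads inside the
  displayed window, as they move by at most one cell per row.\<close>

lemma tiling_sound:
  assumes M: "wf_tm M" and D: "D = 2 * W + 2" and TW: "T \<le> W" and w: "w = type_word x W T"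
    and S: "tiling M D w S"
  shows "\<exists>c. (init_conf x, c) \<in> (tm_step M)\<^sup>* \<and> conf_state c = 1"
proof -
  let ?K = "tm_tapes M"
  have N: "length w = Suc T * D + 1" using w D by (simp add: length_type_word)
  have idx: "t * D + i + 1 < length w" if "t \<le> T" "i < D" for t i
  proof -
    have "t * D + i < Suc t * D" using that by simp
    also have "\<dots> \<le> Suc T * D" using that by (intro mult_le_mono1) simp
    finally show ?thesis using N by simp
  qed
  define tr where "tr t = fst (snd (S (t * D)))" for t
  define cs where "cs t i = snd (snd (S (t * D + i)))" for t i
  have tile: "S c \<in> tiles M" "ucompat ?K (w ! c) (S c)" if "c < length w" for c
    using S that by (auto simp: tiling_def)
  have noflag: "\<not> fst (S (t * D + i))" if "t \<le> T" "0 < i" "i < D" for t i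
  proof -
    have "w ! (t * D + i) \<notin> {1, 8, 10}"
    proof (cases t)
      case 0
      then show ?thesis using that type_word_nth(1)[OF D, of i x T] tape_of_bits_le[of x 0]
          tape_of_bits_le[of x "int i - int (W + 1)"] by (auto simp: w)
    next
      case (Suc t')
      then show ?thesis using that type_word_nth(2)[OF D, of i t' T x] by (simp add: w)
    qed
    then show ?thesis using tile(2)[of "t * D + i"] idx[OF that(1,3)]
      by (cases "S (t * D + i)") auto
  qed
  have hc: "fst (snd (S (t * D + i))) = fst (snd (S (t * D + Suc i)))"
    "j < ?K \<Longrightarrow> \<exists>e. snd (cs t i ! j) = clip e \<and> snd (cs t (Suc i) ! j) = clip (e - 1)"
    if "t \<le> T" "Suc i < D" for t i j
  proof -
    have "hcompat ?K (S (t * D + i)) (S (t * D + i + 1))"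
      using S idx[of t i] that by (simp add: tiling_def)
    then have *: "hcompat ?K (S (t * D + i)) (S (t * D + Suc i))" by simp
    have "\<not> fst (S (t * D + Suc i))" using noflag[of t "Suc i"] that by simp
    then show "fst (snd (S (t * D + i))) = fst (snd (S (t * D + Suc i)))"
      "j < ?K \<Longrightarrow> \<exists>e. snd (cs t i ! j) = clip e \<and> snd (cs t (Suc i) ! j) = clip (e - 1)"
      using * unfolding cs_def by (cases "S (t * D + i)"; cases "S (t * D + Suc i)"; auto)+
  qed
  \<comment> \<open>Horizontal agreement spreads the transition of the first tile over the row: all
    tapes follow the same nondeterministic choice.\<close>
  have tr: "fst (snd (S (t * D + i))) = tr t" if "t \<le> T" "i < D" for t i
    using that(2) by (induction i) (use hc(1)[OF that(1)] in \<open>auto simp: tr_def\<close>)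
  have Srep: "S (t * D + i) = (fst (S (t * D + i)), tr t, cs t i)" if "t \<le> T" "i < D" for t i
    using tr[OF that] by (simp add: cs_def prod_eq_iff)
  \<comment> \<open>The part about tiles is guarded by \<open>t \<le> T\<close>, since row
    \<open>T + 1\<close> has a single cell; reachability is still wanted for
    \<open>t = T + 1\<close>.\<close>
  define ok where "ok t c \<longleftrightarrow> (init_conf x, c) \<in> (tm_step M)\<^sup>* \<and> (\<forall>j<?K. \<bar>conf_head c j\<bar> \<le> int t) \<and>
    (t \<le> T \<longrightarrow> conf_state c = fst (fst (tr t)) \<and>
      (\<forall>i<D. \<forall>j<?K. cs t i ! j = (conf_tape c j (int i - int (W + 1)), clip (conf_head c j - (int i - int (W + 1))))))"
    for t c
  have base: "ok 0 (init_conf x)"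
  proof -
    have u: "ucompat ?K (w ! i) (fst (S i), tr 0, cs 0 i)" if "i < D" for i
      using tile(2)[of i] idx[of 0 i] Srep[of 0 i] that by simp
    have wi: "w ! i = (if i = 0 then 1 else if i = W + 1 then 5 + tape_of (map bit_symbol x) 0
      else 2 + tape_of (map bit_symbol x) (int i - int (W + 1)))" if "i < D" for i
      unfolding w by (rule type_word_nth(1)[OF D that])
    have le7: "w ! i \<le> 7" if "i < D" for i
      using wi[OF that] tape_of_bits_le[of x 0] tape_of_bits_le[of x "int i - int (W + 1)"] by auto
    have sym: "init_symbol (w ! i) = tape_of (map bit_symbol x) (int i - int (W + 1))" if "i < D" for i
      using wi[OF that] tape_of_bits_le[of x 0] tape_of_bits_le[of x "int i - int (W + 1)"]
      by (auto simp: init_symbol_def)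
    have st: "fst (fst (tr 0)) = 0" using u[of 0] le7[of 0] D by simp
    have "cs 0 i ! j = (conf_tape (init_conf x) j (int i - int (W + 1)), clip (0 - (int i - int (W + 1))))"
      if ij: "i < D" "j < ?K" for i j
    proof (rule prod_eqI)
      show "fst (cs 0 i ! j) = fst (conf_tape (init_conf x) j (int i - int (W + 1)), clip (0 - (int i - int (W + 1))))"
        using u[OF ij(1)] le7[OF ij(1)] ij(2) sym[OF ij(1)] by (simp add: init_conf_tape)
      have "w ! (W + 1) \<in> {5, 6, 7}" using wi[of "W + 1"] D tape_of_bits_le[of x 0] by auto
      then have z: "snd (cs 0 (W + 1) ! j) = 0" using u[of "W + 1"] D ij by simp
      \<comment> \<open>The anchor is column \<open>W + 1\<close>, whose type 5, 6 or 7 sets the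
        distance to 0 for every tape.\<close>
      have "snd (cs 0 i ! j) = clip (int (W + 1) - int i)"
        by (rule clip_propagate[of D "\<lambda>i. snd (cs 0 i ! j)" "W + 1"])
          (use hc(2)[of 0] ij z D in \<open>auto simp: clip_def\<close>)
      then show "snd (cs 0 i ! j) = snd (conf_tape (init_conf x) j (int i - int (W + 1)), clip (0 - (int i - int (W + 1))))"
        by simp
    qed
    then show ?thesis using st by (auto simp: ok_def init_conf_def)
  qed
  have step: "\<exists>c'. ok (Suc t) c' \<and> conf_state c' = fst (snd (tr t))" if ok: "ok t c" and t: "t \<le> T" for t c
  proof -
    obtain q rs q' ws where tr_t: "tr t = ((q, rs), (q', ws))" by (metis surj_pair)
    have state: "conf_state c = q"
      and cells: "cs t i ! j = (conf_tape c j (int i - int (W + 1)), clip (conf_head c j - (int i - int (W + 1))))"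
      if "i < D" "j < ?K" for i j using ok t that tr_t by (auto simp: ok_def)
    have mem: "S (t * D + i) \<in> tiles M" if "i < D" for i using tile(1) idx[OF t that] by simp
    have mv: "tr t \<in> tm_moves M" using mem[of 0] Srep[OF t, of 0] D by (auto simp: tiles_def)
    have rs: "length rs = ?K" and ws: "valid_writes ?K (tm_symbols M) ws"
      using tm_moves_ok[OF M mv[unfolded tr_t]] by (auto simp: reads_def)
    have dir: "snd (ws ! j) \<in> {-1, 0, 1}" if "j < ?K" for j
      using ws that nth_mem[of j ws] by (auto simp: valid_writes_def case_prod_unfold)
    have hd: "\<bar>conf_head c j\<bar> \<le> int t" if "j < ?K" for j using ok that by (auto simp: ok_def)
    \<comment> \<open>The column displaying the cell under head \<open>j\<close>; it exists because
      the head is within \<open>t \<le> T \<le> W\<close> of cell 0.\<close>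
    define p where "p j = nat (conf_head c j + int (W + 1))" for j
    have p: "p j < D" "int (p j) - int (W + 1) = conf_head c j" if "j < ?K" for j
      using hd[OF that] t TW D by (auto simp: p_def)
    \<comment> \<open>The transition was merely guessed by the tiles. In column \<open>p j\<close>
      the distance is 0, so the definition of \<open>tiles\<close> ties \<open>rs ! j\<close> to the
      symbol displayed there.\<close>
    have rs_eq: "rs = conf_reads ?K c"
    proof (rule nth_equalityI)
      fix j assume "j < length rs"
      then have j: "j < ?K" using rs by simp
      have c1: "cs t (p j) ! j = (conf_tape c j (conf_head c j), 0)"
        using cells[OF p(1)[OF j] j] p(2)[OF j] by (simp del: of_nat_add)
      have "fst (cs t (p j) ! j) = rs ! j"
        using mem[OF p(1)[OF j]] Srep[OF t p(1)[OF j]] j c1 tr_t by (auto simp: tiles_def)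
      then show "rs ! j = conf_reads ?K c ! j" using c1 j by (simp add: conf_reads_def)
    qed (simp add: rs conf_reads_def)
    define c' where "c' = apply_move ?K q' ws c"
    have K: "0 < ?K" using M by (simp add: wf_tm_def)
    have q: "conf_state c = q" using state[of 0 0] D K by simp
    have "(c, c') \<in> (tm_step M)\<^sup>*"
      unfolding c'_def by (rule tm_moves_step) (use mv tr_t rs_eq q in simp)
    then have reach: "(init_conf x, c') \<in> (tm_step M)\<^sup>*" using ok by (auto simp: ok_def)
    have head': "conf_head c' j = conf_head c j + snd (ws ! j)"
      and tape': "conf_tape c' j = (conf_tape c j)(conf_head c j := fst (ws ! j))" if "j < ?K" for j
      using that by (auto simp: c'_def apply_move_def)
    have hd': "\<bar>conf_head c' j\<bar> \<le> int (Suc t)" if "j < ?K" for j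
      using hd[OF that] dir[OF that] head'[OF that] by auto
    have st': "conf_state c' = q'" by (simp add: c'_def apply_move_def)
    have "conf_state c' = fst (fst (tr (Suc t))) \<and> (\<forall>i<D. \<forall>j<?K. cs (Suc t) i ! j =
      (conf_tape c' j (int i - int (W + 1)), clip (conf_head c' j - (int i - int (W + 1)))))" if t': "Suc t \<le> T"
    proof -
      have vc: "vcompat ?K (fst (S (t * D + i)), tr t, cs t i) (fst (S (Suc t * D + i)), tr (Suc t), cs (Suc t) i)"
        if i: "i < D" for i
      proof -
        have "t * D + i + D = Suc t * D + i" by simp
        moreover have "Suc t * D + i < length w" using idx[OF t' i] by simp
        ultimately have "vcompat ?K (S (t * D + i)) (S (Suc t * D + i))"
          using S idx[OF t i] unfolding tiling_def by (metis add_lessD1)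
        then show ?thesis unfolding Srep[OF t i, symmetric] Srep[OF t' i, symmetric] .
      qed
      have "conf_state c' = fst (fst (tr (Suc t)))" using vc[of 0] D tr_t st' by simp
      moreover have "cs (Suc t) i ! j = (conf_tape c' j (int i - int (W + 1)), clip (conf_head c' j - (int i - int (W + 1))))"
        if ij: "i < D" "j < ?K" for i j
      proof (rule prod_eqI)
        have v: "if snd (cs t i ! j) = 0 then cs (Suc t) i ! j = ws ! j else fst (cs (Suc t) i ! j) = fst (cs t i ! j)"
          if "i < D" for i using vc[OF that] ij(2) tr_t by simp
        show "fst (cs (Suc t) i ! j) = fst (conf_tape c' j (int i - int (W + 1)), clip (conf_head c' j - (int i - int (W + 1))))"
          using v[OF ij(1)] cells[OF ij] tape'[OF ij(2)] by (auto split: if_splits)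
        have "snd (cs t (p j) ! j) = 0" using cells[OF p(1)[OF ij(2)] ij(2)] p(2)[OF ij(2)] by simp
        then have z: "snd (cs (Suc t) (p j) ! j) = snd (ws ! j)" using v[OF p(1)[OF ij(2)]] by simp
        \<comment> \<open>The anchor is the old head column \<open>p j\<close>, where
          \<open>vcompat\<close> has set the new distance to the displacement; it has absolute value
          at most 1, as \<open>clip_propagate\<close> requires.\<close>
        have "snd (cs (Suc t) i ! j) = clip (conf_head c' j + int (W + 1) - int i)"
        proof (rule clip_propagate[of D "\<lambda>i. snd (cs (Suc t) i ! j)" "p j"])
          show "\<exists>e. snd (cs (Suc t) i ! j) = clip e \<and> snd (cs (Suc t) (Suc i) ! j) = clip (e - 1)" if "Suc i < D" for i
            using hc(2)[OF t' that ij(2)] .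
          have e: "conf_head c' j + int (W + 1) - int (p j) = snd (ws ! j)"
            using p(2)[OF ij(2)] head'[OF ij(2)] by simp
          show "snd (cs (Suc t) (p j) ! j) = clip (conf_head c' j + int (W + 1) - int (p j))"
            "\<bar>conf_head c' j + int (W + 1) - int (p j)\<bar> \<le> 1"
            unfolding e z using dir[OF ij(2)] by (auto simp: clip_def)
        qed (use p ij in auto)
        then show "snd (cs (Suc t) i ! j) = snd (conf_tape c' j (int i - int (W + 1)), clip (conf_head c' j - (int i - int (W + 1))))"
          by (simp add: algebra_simps)
      qed
      ultimately show ?thesis by blast
    qed
    then have "ok (Suc t) c'" using reach hd' by (auto simp: ok_def)
    then show ?thesis using st' tr_t by auto
  qed
  have "t \<le> T \<Longrightarrow> \<exists>c. ok t c" for t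
    by (induction t) (use base step in \<open>auto dest: Suc_leD\<close>, meson Suc_leD step)
  then obtain c where "ok T c" by blast
  then obtain c' where c': "ok (Suc T) c'" "conf_state c' = fst (snd (tr T))" using step by blast
  \<comment> \<open>The final cell lies below the first cell of row \<open>T\<close>, so its source
    state is the target state of that row's transition, and its type 10 forces this state to be
    1.\<close>
  have "vcompat ?K (S (T * D)) (S (T * D + D))"
    using S N by (simp add: tiling_def)
  moreover have "ucompat ?K 10 (S (T * D + D))"
  proof -
    have e: "T * D + D = Suc T * D" by simp
    have "w ! (T * D + D) = 10" unfolding w e by (rule type_word_nth(3)[OF D, of 0]) (simp add: D)
    then show ?thesis using tile(2)[of "T * D + D"] N by simp
  qed
  ultimately have "fst (snd (tr T)) = 1"
    unfolding tr_def by (cases "S (T * D)"; cases "S (T * D + D)") auto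
  then show ?thesis using c' by (auto simp: ok_def)
qed

text \<open>A row of the diagram shows the tape cells \<open>- (W + 1), \<dots>, W\<close>.\<close>

definition conf_tile :: "nat \<Rightarrow> nat \<Rightarrow> transition \<Rightarrow> conf \<Rightarrow> nat \<Rightarrow> tile" where
  "conf_tile K W tr c i = (i = 0, tr, map (\<lambda>j. (conf_tape c j (int i - int (W + 1)),
     clip (conf_head c j - (int i - int (W + 1))))) [0..<K])"

section \<open>From accepting computations to tilings\<close>

lemma reachable_symbols:
  assumes M: "wf_tm M" and r: "(init_conf x, c) \<in> tm_step M ^^ m"
  shows "conf_tape c j z < tm_symbols M"
  using r
proof (induction m arbitrary: c j z)
  case 0
  then show ?case using M tape_of_bits_le[of x z] by (auto simp: init_conf_tape wf_tm_def)
next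
  case (Suc m)
  then obtain b where b: "(init_conf x, b) \<in> tm_step M ^^ m" "(b, c) \<in> tm_step M" by auto
  then obtain q' ws where t: "((conf_state b, conf_reads (tm_tapes M) b), (q', ws)) \<in> tm_trans M"
    "c = apply_move (tm_tapes M) q' ws b" by (auto simp: tm_step_iff)
  have "fst (ws ! j) < tm_symbols M" if "j < tm_tapes M"
    using wf_tm_trans(5)[OF M t(1)] that nth_mem[of j ws] by (auto simp: valid_writes_def case_prod_unfold)
  then show ?case using Suc.IH[OF b(1)] by (simp add: t(2) apply_move_def)
qed

text \<open>The run is prolonged by idling in its accepting configuration, which fills all rows and
  leaves state 1 in the final cell. Every row then shows the window of its configuration with the
  true distances clipped.\<close>

lemma tiling_complete:
  assumes M: "wf_tm M" and D: "D = 2 * W + 2" and w: "w = type_word x W T"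
    and run: "(init_conf x, ca) \<in> tm_step M ^^ m" "conf_state ca = 1" "m \<le> T"
  shows "\<exists>S. tiling M D w S"
proof -
  let ?K = "tm_tapes M" and ?G = "tm_symbols M"
  obtain f where f: "f 0 = init_conf x" "f m = ca" "\<And>i. i < m \<Longrightarrow> (f i, f (Suc i)) \<in> tm_step M"
    using run(1) unfolding relpow_fun_conv by blast
  \<comment> \<open>\<open>min t m\<close> freezes the run after its last step.\<close>
  define C where "C t = f (min t m)" for t
  have reach: "(init_conf x, C t) \<in> tm_step M ^^ min t m" for t
    unfolding C_def relpow_fun_conv using f by (intro exI[of _ f]) auto
  have symb: "conf_tape (C t) j z < ?G" for t j z by (rule reachable_symbols[OF M reach])
  have ex: "\<exists>q' ws. ((conf_state (C t), conf_reads ?K (C t)), (q', ws)) \<in> tm_moves M \<and>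
    C (Suc t) = apply_move ?K q' ws (C t)" for t
  proof (cases "t < m")
    case True
    then have "(C t, C (Suc t)) \<in> tm_step M" using f(3)[of t] by (simp add: C_def)
    then show ?thesis by (auto simp: tm_step_iff tm_moves_def)
  next
    case False
    then have c: "C t = ca" "C (Suc t) = ca" using f(2) by (simp_all add: C_def)
    have "conf_reads ?K ca \<in> reads ?K ?G" using symb[of t] c by (auto simp: conf_reads_def reads_def)
    then show ?thesis using c run(2) apply_move_keep[of ?K ca]
      by (intro exI[of _ 1] exI[of _ "keep (conf_reads ?K ca)"]) (auto simp: tm_moves_def)
  qed
  then obtain q' ws where mv: "\<And>t. ((conf_state (C t), conf_reads ?K (C t)), (q' t, ws t)) \<in> tm_moves M"
    and nxt: "\<And>t. C (Suc t) = apply_move ?K (q' t) (ws t) (C t)" by metis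
  define tr where "tr t = ((conf_state (C t), conf_reads ?K (C t)), (q' t, ws t))" for t
  define S where "S c = conf_tile ?K W (tr (c div D)) (C (c div D)) (c mod D)" for c
  have N: "length w = Suc T * D + 1" using w D by (simp add: length_type_word)
  have D0: "0 < D" using D by simp
  have "tiling M D w S"
    unfolding tiling_def
  proof (intro allI impI conjI)
    fix c assume c: "c < length w"
    define t i where "t = c div D" and "i = c mod D"
    have ci: "c = t * D + i" "i < D" using D0 by (auto simp: t_def i_def)
    have Sc: "S c = conf_tile ?K W (tr t) (C t) i" by (simp add: S_def t_def i_def)
    show "S c \<in> tiles M"
    proof -
      have "-2 \<le> clip z \<and> clip z \<le> 2" for z by (simp add: clip_def)
      then show ?thesis using symb mv[of t]
        by (auto simp: Sc conf_tile_def tiles_def tr_def conf_reads_def)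
    qed
    show "ucompat ?K (w ! c) (S c)"
    proof -
      consider "t = 0" | t' where "t = Suc t'" "t' < T" | "t = Suc T" "i = 0"
      proof -
        have "t * D \<le> Suc T * D" using c N ci by linarith
        then have "t \<le> Suc T" using D0 unfolding mult_le_cancel2 by simp
        moreover have "i = 0" if "t = Suc T" using c N ci that by simp
        ultimately show ?thesis using that by (cases t) force+
      qed
      then show ?thesis
      proof cases
        case 1
        then have C0: "C t = init_conf x" using f(1) by (simp add: C_def)
        have wc: "w ! c = (if i = 0 then 1 else if i = W + 1 then 5 + tape_of (map bit_symbol x) 0
          else 2 + tape_of (map bit_symbol x) (int i - int (W + 1)))"
          using type_word_nth(1)[OF D ci(2), of x T] ci(1) 1 by (simp add: w)
        consider "i = 0" | "i = W + 1" | "i \<noteq> 0" "i \<noteq> W + 1" by blast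
        then show ?thesis
        proof cases
          case 1
          then show ?thesis using wc unfolding Sc conf_tile_def tr_def C0
            by (simp add: init_conf_tape init_symbol_def) (simp add: init_conf_def)
        next
          case 2
          then have "w ! c = 5 + tape_of (map bit_symbol x) 0" using wc by simp
          then show ?thesis using 2 tape_of_bits_le[of x 0] unfolding Sc conf_tile_def tr_def C0
            by (auto simp: init_conf_tape init_symbol_def) (auto simp: init_conf_def)
        next
          case 3
          then have "w ! c = 2 + tape_of (map bit_symbol x) (int i - int (W + 1))" using wc by simp
          then show ?thesis using 3 tape_of_bits_le[of x "int i - int (W + 1)"] unfolding Sc conf_tile_def tr_def C0
            by (auto simp: init_conf_tape init_symbol_def) (auto simp: init_conf_def)
        qed
      next
        case (2 t')
        then have "w ! c = (if i = 0 then 8 else 9)"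
          using type_word_nth(2)[OF D ci(2) 2(2), of x] ci(1) by (simp add: w)
        then show ?thesis by (simp add: Sc conf_tile_def)
      next
        case 3
        then have "w ! c = 10" using type_word_nth(3)[OF D ci(2), of x T] ci(1) by (simp add: w)
        moreover have "conf_state (C t) = 1" using 3 run f(2) by (simp add: C_def)
        ultimately show ?thesis using 3 by (simp add: Sc conf_tile_def tr_def)
      qed
    qed
    show "hcompat ?K (S c) (S (c + 1))"
    proof (cases "Suc i < D")
      case True
      have "c + 1 = Suc i + t * D" using ci by simp
      then have "(c + 1) div D = t" "(c + 1) mod D = Suc i"
        using True D0 by (simp_all only: div_mult_self1 mod_mult_self1) simp_all
      then have S1: "S (c + 1) = conf_tile ?K W (tr t) (C t) (Suc i)" by (simp only: S_def)
      \<comment> \<open>The witness is the true, unclipped distance.\<close>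
      have "\<exists>e. clip (h - (int i - int (W + 1))) = clip e \<and> clip (h - (int (Suc i) - int (W + 1))) = clip (e - 1)" for h
        by (rule exI[of _ "h - (int i - int (W + 1))"]) (simp add: algebra_simps)
      then show ?thesis unfolding Sc S1 conf_tile_def by (simp del: of_nat_Suc of_nat_add)
    next
      case False
      then have "Suc i = D" using ci by simp
      then have "c + 1 = Suc t * D" using ci by simp
      then have "(c + 1) mod D = 0" by (simp only: mod_mult_self2_is_0)
      then show ?thesis unfolding Sc S_def[of "c + 1"] conf_tile_def by simp
    qed
    show "vcompat ?K (S c) (S (c + D))"
    proof -
      have "(c + D) div D = Suc t" "(c + D) mod D = i" using D0 by (simp_all add: t_def i_def)
      then have S1: "S (c + D) = conf_tile ?K W (tr (Suc t)) (C (Suc t)) i" by (simp only: S_def)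
      have "snd (ws t ! j) \<in> {-1, 0, 1}" if "j < ?K" for j
        using tm_moves_ok(2)[OF M mv[of t]] that nth_mem[of j "ws t"] by (auto simp: valid_writes_def case_prod_unfold)
      \<comment> \<open>Displacements are within the range of \<open>clip\<close>, so the entry of
        the new tile equals the written pair literally, as \<open>vcompat\<close> demands.\<close>
      then have "clip (snd (ws t ! j)) = snd (ws t ! j)" if "j < ?K" for j
        using that by (fastforce simp: clip_def)
      then show ?thesis unfolding Sc S1 conf_tile_def tr_def
        by (auto simp: nxt apply_move_def prod_eq_iff)
    qed
  qed
  then show ?thesis by blast
qed

section \<open>The reduction\<close>

text \<open>The base \<open>n + 2\<close> absorbs constants through \<open>a \<le> 2 ^ a\<close>,
  also for \<open>n = 0\<close>. The additional 1 in the exponent pays for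
  \<open>1 + n \<le> n + 2\<close> in the Horner step.\<close>

lemma poly_le_power:
  fixes p :: "nat poly"
  shows "\<exists>e. \<forall>n. poly p n \<le> (n + 2) ^ e"
proof (induction p)
  case 0
  then show ?case by simp
next
  case (pCons a q)
  then obtain e where e: "\<And>n. poly q n \<le> (n + 2) ^ e" by blast
  have "poly (pCons a q) n \<le> (n + 2) ^ (a + e + 1)" for n
  proof -
    have "a \<le> 2 ^ a" by simp
    also have "\<dots> \<le> (n + 2) ^ a" by (rule power_mono) simp_all
    also have "\<dots> \<le> (n + 2) ^ a * (n + 2) ^ e" by simp
    finally have 1: "a \<le> (n + 2) ^ (a + e)" by (simp only: power_add)
    have "(n + 2) ^ e \<le> (n + 2) ^ (a + e)" by (rule power_increasing) simp_all
    then have 2: "n * poly q n \<le> n * (n + 2) ^ (a + e)" using e[of n] by (meson le_trans mult_le_mono2)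
    have "poly (pCons a q) n \<le> (n + 2) ^ (a + e) + n * (n + 2) ^ (a + e)"
      unfolding poly_pCons by (rule add_mono[OF 1 2])
    also have "\<dots> \<le> (n + 2) ^ (a + e + 1)" by simp
    finally show ?thesis .
  qed
  then show ?case by blast
qed

section \<open>Polynomial running time\<close>

definition is_poly :: "(nat \<Rightarrow> nat) \<Rightarrow> bool" where
  "is_poly F \<longleftrightarrow> (\<exists>P. \<forall>n. F n = poly P n)"

lemma is_poly_const: "is_poly (\<lambda>_. c)"
  unfolding is_poly_def by (rule exI[of _ "[:c:]"]) simp

lemma is_poly_id: "is_poly (\<lambda>n. n)"
  unfolding is_poly_def by (rule exI[of _ "[:0, 1:]"]) simp

lemma is_poly_add: "is_poly F \<Longrightarrow> is_poly F' \<Longrightarrow> is_poly (\<lambda>n. F n + F' n)"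
  unfolding is_poly_def by (metis poly_add)

lemma is_poly_mult: "is_poly F \<Longrightarrow> is_poly F' \<Longrightarrow> is_poly (\<lambda>n. F n * F' n)"
  unfolding is_poly_def by (metis poly_mult)

lemma is_poly_power: "is_poly F \<Longrightarrow> is_poly (\<lambda>n. F n ^ e)"
  unfolding is_poly_def by (metis poly_power)

lemma is_poly_Suc: "is_poly F \<Longrightarrow> is_poly (\<lambda>n. Suc (F n))"
  using is_poly_add[OF is_poly_const[of 1]] by simp

lemmas is_poly_intros = is_poly_const is_poly_id is_poly_add is_poly_mult is_poly_power is_poly_Suc

lemma is_poly_powers_time: "is_poly F \<Longrightarrow> is_poly (\<lambda>n. powers_time (F n) k)"
  by (induction k) (auto intro!: is_poly_intros)

lemma is_poly_time:
  "is_poly (\<lambda>n. prepare_time e n + instance_time g ((2 * (n + 2) ^ Suc e + 2) * Suc ((n + 2) ^ e) + 1))"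
  unfolding prepare_time_def instance_time_def by (intro is_poly_intros is_poly_powers_time)

section \<open>Well-formedness of the programs\<close>

lemma wf_prog_rewind: "j < K \<Longrightarrow> wf_prog K G (rewind j)"
  by (simp add: rewind_def)

text \<open>Eleven symbols are needed: the blank and the cell types 1 to 10.\<close>

lemma wf_prog_emit: "ou < K \<Longrightarrow> wf_prog K 11 (emit ou b)"
  by (simp add: emit_def bit_symbol_def)

lemma wf_prog_instance_prog: "6 < ou \<Longrightarrow> ou < K \<Longrightarrow> wf_prog K 11 (instance_prog ou U H V g)"
  by (auto simp: instance_prog_def pass_def phase_def count_prog_def header_prog_def print_counter_def
      trees_prog_def row_prog_def scan_def sweep_def return_heads_def step_heads_def emits_def bit_prog_def incr_def
      advance_def retreat_def shift_def unshift_def wf_prog_rewind wf_prog_emit)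

lemma wf_prog_powers_prog: "k + 7 < K \<Longrightarrow> wf_prog K 11 (powers_prog k)"
  by (induction k) (auto simp: mult_prog_def over_def wf_prog_rewind)

lemma wf_prog_prepare_prog: "e + 8 < K \<Longrightarrow> wf_prog K 11 (prepare_prog e)"
  by (auto simp: prepare_prog_def ruler_prog_def word_prog_def row0_prog_def rows_prog_def over_def
      put_def putx_def mult_prog_def wf_prog_rewind wf_prog_powers_prog)

text \<open>Membership only provides some instance with the given code; injectivity of the encoding
  identifies it with the intended one.\<close>

lemma encode_instance_in_BSTSO_iff:
  assumes "\<forall>T\<in>set Ts. T \<subseteq> {1..n}"
  shows "encode_instance n Ts k \<in> BSTSO f \<longleftrightarrow> (\<exists>C. is_solution f n (set Ts) C \<and> card (gates C) \<le> k)"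
proof
  assume "encode_instance n Ts k \<in> BSTSO f"
  then obtain n' Ts' k' where i: "encode_instance n Ts k = encode_instance n' Ts' k'" "\<forall>T\<in>set Ts'. T \<subseteq> {1..n'}"
    "\<exists>C. is_solution f n' (set Ts') C \<and> card (gates C) \<le> k'" unfolding BSTSO_def by blast
  then show "\<exists>C. is_solution f n (set Ts) C \<and> card (gates C) \<le> k"
    using encode_instance_inject[OF assms i(2), of k k'] by simp
qed (use assms in \<open>auto simp: BSTSO_def\<close>)

lemma tiling_trees_subset:
  assumes "T \<in> set (tiling_trees U H V g D w)"
  shows "T \<subseteq> {1..Suc (length w * g)}"
proof -
  obtain r c a b where q: "(r, c, a, b) \<in> set (quads (length w) g D (\<lambda>r c. conflict U H V (w ! (c + offset D r)) r))"
    "T = tree_of g D (r, c, a, b)" using assms by (force simp: tiling_trees_def)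
  have "vertex g c a \<le> Suc (length w * g)" if "c < length w" "a < g" for c a
    using vertex_less[OF that(2,1), of 0] by (simp add: vertex_def)
  then show ?thesis using q by (force simp: set_quads tree_of_def vertex_def)
qed

theorem theorem4:
  fixes f :: "bool \<Rightarrow> bool \<Rightarrow> bool"
  assumes "abel_semigroup f"
  shows "NP_hard (BSTSO f)"
  unfolding NP_hard_def
proof
  fix A assume "A \<in> NP"
  then obtain M and p :: "nat poly" where M: "wf_tm M"
    and time: "\<And>x m c. (init_conf x, c) \<in> tm_step M ^^ m \<Longrightarrow> m \<le> poly p (length x)"
    and acc: "\<And>x. x \<in> A \<longleftrightarrow> (\<exists>c. (init_conf x, c) \<in> (tm_step M)\<^sup>* \<and> conf_state c = 1)"
    unfolding NP_def by blast
  obtain e where e: "\<And>n. poly p n \<le> (n + 2) ^ e" using poly_le_power by blast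
  obtain ts where ts: "set ts = tiles M" using finite_list[OF finite_tiles[OF M]] by blast
  define U where "U y a = ucompat (tm_tapes M) y (ts ! a)" for y a
  define H where "H a b = hcompat (tm_tapes M) (ts ! a) (ts ! b)" for a b
  define V where "V a b = vcompat (tm_tapes M) (ts ! a) (ts ! b)" for a b
  define g where "g = length ts"
  \<comment> \<open>\<open>W x\<close> has to be at least \<open>T x\<close>. The next power is
    taken instead of \<open>T x\<close> itself because the loop over rows and the loops inside a row
    need rulers on different tapes.\<close>
  define W where "W x = (length x + 2) ^ Suc e" for x :: "bool list"
  define T where "T x = (length x + 2) ^ e" for x :: "bool list"
  define D where "D x = 2 * W x + 2" for x
  define w where "w x = type_word x (W x) (T x)" for x
  define F where "F x = encode_instance (Suc (length (w x) * g)) (tiling_trees U H V g (D x) (w x))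
    (tiling_bound H V (length (w x)) g (D x))" for x
  have "g > 0" using tiles_nonempty[OF M] ts by (auto simp: g_def)
  have correct: "x \<in> A \<longleftrightarrow> F x \<in> BSTSO f" for x
  proof -
    have "F x \<in> BSTSO f \<longleftrightarrow> tileable U H V g (D x) (w x)"
      unfolding F_def
      by (subst encode_instance_in_BSTSO_iff)
        (use tiling_trees_subset in blast, rule tiling_trees_iff[OF assms \<open>g > 0\<close>], simp_all add: D_def)
    also have "\<dots> \<longleftrightarrow> (\<exists>S. tiling M (D x) (w x) S)"
      unfolding U_def[abs_def] H_def[abs_def] V_def[abs_def] g_def by (rule tileable_iff_tiling[OF ts])
    also have "\<dots> \<longleftrightarrow> x \<in> A"
    proof
      have "T x \<le> W x" by (simp add: T_def W_def)
      then show "x \<in> A" if "\<exists>S. tiling M (D x) (w x) S"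
        using that tiling_sound[OF M D_def _ w_def] acc by blast
      show "\<exists>S. tiling M (D x) (w x) S" if x: "x \<in> A"
      proof -
        obtain c m where c: "(init_conf x, c) \<in> tm_step M ^^ m" "conf_state c = 1"
          using x acc rtrancl_imp_relpow by metis
        have "m \<le> T x" using time[OF c(1)] e[of "length x"] by (simp add: T_def)
        then show ?thesis using tiling_complete[OF M D_def w_def c] by blast
      qed
    qed
    finally show ?thesis by blast
  qed
  have lw: "length (w x) = (2 * (length x + 2) ^ Suc e + 2) * Suc ((length x + 2) ^ e) + 1" for x
    unfolding w_def length_type_word W_def T_def ..
  obtain P where P: "\<And>n. prepare_time e n +
      instance_time g ((2 * (n + 2) ^ Suc e + 2) * Suc ((n + 2) ^ e) + 1) = poly P n"
    using is_poly_time unfolding is_poly_def by blast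
  have "poly_time_computable F"
  proof (rule poly_time_computable_by_prog)
    show "wf_prog (e + 10) 11 (Seq (prepare_prog e) (instance_prog (e + 9) U H V g))"
      by (simp add: wf_prog_prepare_prog wf_prog_instance_prog)
    fix x
    \<comment> \<open>So there is a row after the initial one; its first cell, at position
      \<open>D x\<close>, has type 8, from which the program recognises the row length.\<close>
    have T1: "0 < T x" by (simp add: T_def)
    obtain s where s: "runs (prepare_prog e) (init_store x) (main_store (e + 9) s (w x) 0 0 0 0 0 0 []) (prepare_time e (length x))"
      using runs_prepare_prog[OF refl, of e x] unfolding w_def W_def T_def by blast
    define t where "t = main_store (e + 9) s (w x) 0 0 0 0 (tiling_bound H V (length (w x)) g (D x)) 0 (F x)"
    have "runs (instance_prog (e + 9) U H V g) (main_store (e + 9) s (w x) 0 0 0 0 0 0 []) t (instance_time g (length (w x)))"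
      unfolding t_def F_def
    proof (rule runs_instance_prog)
      show "0 \<notin> set (w x)" unfolding w_def by (rule type_word_nonzero)
      show "D x < length (w x)" by (simp add: w_def length_type_word D_def)
      show "w x ! i \<notin> {8, 10}" if "1 \<le> i" "i < D x" for i
        using that type_word_nth(1)[OF D_def that(2), of x "T x"] tape_of_bits_le[of x 0]
          tape_of_bits_le[of x "int i - int (W x + 1)"] by (auto simp: w_def)
      show "w x ! D x \<in> {8, 10}"
        using type_word_nth(2)[OF D_def _ T1, of 0 x] by (simp add: w_def D_def)
    qed (simp_all add: D_def)
    from runs_Seq[OF s this]
    obtain m where m: "m \<le> poly P (length x)"
      "run (Seq (prepare_prog e) (instance_prog (e + 9) U H V g)) (init_store x) t m"
      unfolding runs_def lw P by blast
    have "fst (t (e + 10 - 1)) = tape_of (map bit_symbol (F x))" by (simp add: t_def main_store_def)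
    then show "\<exists>t m. run (Seq (prepare_prog e) (instance_prog (e + 9) U H V g)) (init_store x) t m \<and>
      m \<le> poly P (length x) \<and> (\<forall>j<length (F x). fst (t (e + 10 - 1)) (int j) = bit_symbol (F x ! j)) \<and>
      fst (t (e + 10 - 1)) (int (length (F x))) = 0"
      using m by (intro exI[of _ t] exI[of _ m]) simp
  qed simp_all
  then show "poly_time_reducible A (BSTSO f)"
    unfolding poly_time_reducible_def using correct by blast
qed

end
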